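(* Let $k\in\mathbb{Z}^+$ and let $\mu$ be a Carleson measure of $A^2(\mathbb{H}_k)$. The following are equivalent: (i) $\mu$ is vanishing; (ii) there exists $\delta>0$ such that $|w_2|^\delta\,\mathcal{B}_\mu(w)\to0$ as $w=(w_1,w_2)\to\partial\mathbb{H}_k$; (iii) there exists $\delta>0$ such that $|w_2|^\delta\,T_\mu(w)\to0$ as $w\to\partial\mathbb{H}_k$.
   Context: $\mathbb{H}_k=\{(z_1,z_2)\in\mathbb{C}^2:|z_1|^k<|z_2|<1\}$. $dV$ is Lebesgue measure, $A^2(\mathbb{H}_k)$ the holomorphic $dV$-square-integrable functions. With $s=z_1\overline{w}_1$, $t=z_2\overline{w}_2$, the Bergman kernel of $\mathbb{H}_k$ is $K(z,w)=\dfrac{p_k(s)t^2+q_k(s)t+s^kp_k(s)}{k\pi^2(1-t)^2(t-s^k)^2}$, where $p_k(s)=\sum_{j=1}^{k-1}j(k-j)s^{j-1}$ ($p_1\equiv0$) and $q_k(s)=\sum_{j=1}^k\big(j^2+(k-j)^2s^k\big)s^{j-1}$. Define $\mathcal{P}(z,w)=\dfrac{t}{(1-t)^2(t-s^k)^2}$, $T_\mu(w)=\int_{\mathbb{H}_k}\frac{|\mathcal{P}(z,w)|^2}{K(w,w)}d\mu(z)$ and $\mathcal{B}_\mu(w)=\int_{\mathbb{H}_k}\frac{|K(z,w)|^2}{K(w,w)}d\mu(z)$. A non-negative finite Borel measure $\mu$ is Carleson if the inclusion $A^2(\mathbb{H}_k)\hookrightarrow L^2(\mathbb{H}_k,\mu)$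 is bounded, vanishing if it is compact. "$w\to\partial\mathbb{H}_k$" means the distance to the topological boundary tends to $0$. *)

theory Defs
  imports "HOL-Analysis.Analysis"
begin

type_synonym c2 = "complex \<times> complex"

definition Hk :: "nat \<Rightarrow> c2 set" where
  "Hk k = {z. norm (fst z) ^ k < norm (snd z) \<and> norm (snd z) < 1}"

text \<open>Holomorphy on an open subset of C^2: at every point the (real Frechet)
  derivative exists and is complex-linear.\<close>
definition holo2 :: "(c2 \<Rightarrow> complex) \<Rightarrow> c2 set \<Rightarrow> bool" where
  "holo2 f U \<longleftrightarrow> open U \<and>
     (\<forall>z\<in>U. \<exists>a b. (f has_derivative (\<lambda>h. a * fst h + b * snd h)) (at z))"

definition normA2sq :: "nat \<Rightarrow> (c2 \<Rightarrow> complex) \<Rightarrow> ennreal" where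
  "normA2sq k f = (\<integral>\<^sup>+ z. indicator (Hk k) z * ennreal ((norm (f z))\<^sup>2) \<partial>lebesgue)"

definition normL2sq :: "nat \<Rightarrow> c2 measure \<Rightarrow> (c2 \<Rightarrow> complex) \<Rightarrow> ennreal" where
  "normL2sq k \<mu> f = (\<integral>\<^sup>+ z. indicator (Hk k) z * ennreal ((norm (f z))\<^sup>2) \<partial>\<mu>)"

definition A2 :: "nat \<Rightarrow> (c2 \<Rightarrow> complex) set" where
  "A2 k = {f. holo2 f (Hk k) \<and> normA2sq k f < \<infinity>}"

definition fin_borel_on :: "nat \<Rightarrow> c2 measure \<Rightarrow> bool" where
  "fin_borel_on k \<mu> \<longleftrightarrow> sets \<mu> = sets borel \<and> finite_measure \<mu> \<and> emeasure \<mu> (- Hk k) = 0"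

definition carleson :: "nat \<Rightarrow> c2 measure \<Rightarrow> bool" where
  "carleson k \<mu> \<longleftrightarrow> fin_borel_on k \<mu> \<and>
     (\<exists>C::real. \<forall>f\<in>A2 k. normL2sq k \<mu> f \<le> ennreal C * normA2sq k f)"

text \<open>Vanishing: the inclusion is compact, i.e. every sequence in the unit ball of A^2
  has a subsequence converging in L^2(mu).\<close>
definition vanishing :: "nat \<Rightarrow> c2 measure \<Rightarrow> bool" where
  "vanishing k \<mu> \<longleftrightarrow> fin_borel_on k \<mu> \<and>
     (\<forall>f::nat \<Rightarrow> c2 \<Rightarrow> complex. (\<forall>n. f n \<in> A2 k \<and> normA2sq k (f n) \<le> 1) \<longrightarrow>
        (\<exists>r g. strict_mono r \<and> g \<in> borel_measurable borel \<and> normL2sq k \<mu> g < \<infinity> \<and>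
           (\<lambda>n. normL2sq k \<mu> (\<lambda>z. f (r n) z - g z)) \<longlonglongrightarrow> 0))"

definition pk :: "nat \<Rightarrow> complex \<Rightarrow> complex" where
  "pk k s = (\<Sum>j=1..k-1. of_nat (j * (k - j)) * s ^ (j - 1))"

definition qk :: "nat \<Rightarrow> complex \<Rightarrow> complex" where
  "qk k s = (\<Sum>j=1..k. (of_nat (j^2) + of_nat ((k - j)^2) * s ^ k) * s ^ (j - 1))"

text \<open>Bergman kernel of H_k, with s = z1 conj(w1), t = z2 conj(w2).\<close>
definition Kb :: "nat \<Rightarrow> c2 \<Rightarrow> c2 \<Rightarrow> complex" where
  "Kb k z w = (let s = fst z * cnj (fst w); t = snd z * cnj (snd w) in
     (pk k s * t^2 + qk k s * t + s^k * pk k s) /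
     (of_nat k * of_real (pi^2) * (1 - t)^2 * (t - s^k)^2))"

definition Pk :: "nat \<Rightarrow> c2 \<Rightarrow> c2 \<Rightarrow> complex" where
  "Pk k z w = (let s = fst z * cnj (fst w); t = snd z * cnj (snd w) in
     t / ((1 - t)^2 * (t - s^k)^2))"

definition T_mu :: "nat \<Rightarrow> c2 measure \<Rightarrow> c2 \<Rightarrow> ennreal" where
  "T_mu k \<mu> w = (\<integral>\<^sup>+ z. indicator (Hk k) z *
      ennreal ((norm (Pk k z w))\<^sup>2 / Re (Kb k w w)) \<partial>\<mu>)"

definition B_mu :: "nat \<Rightarrow> c2 measure \<Rightarrow> c2 \<Rightarrow> ennreal" where
  "B_mu k \<mu> w = (\<integral>\<^sup>+ z. indicator (Hk k) z *
      ennreal ((norm (Kb k z w))\<^sup>2 / Re (Kb k w w)) \<partial>\<mu>)"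

definition tends0_bdry :: "c2 set \<Rightarrow> (c2 \<Rightarrow> ennreal) \<Rightarrow> bool" where
  "tends0_bdry U F \<longleftrightarrow> (\<forall>\<epsilon>>0. \<exists>\<eta>>0. \<forall>w\<in>U. infdist w (frontier U) < \<eta> \<longrightarrow> F w < ennreal \<epsilon>)"

end

theory Submission
  imports Defs "HOL-Complex_Analysis.Complex_Analysis"
begin

text \<open>
  Write \<open>z = (u v, v ^ k)\<close> with \<open>u\<close> in the disc and \<open>v\<close> in the punctured disc. In these coordinates
  \<open>\<P>\<close> is \<open>1 / (y ^ k (1 - y ^ k)^2 (1 - x ^ k)^2)\<close> with \<open>x = u cnj u'\<close>, \<open>y = v cnj v'\<close>, and the Bergman kernel is
  \<open>\<P>\<close> times a polynomial in \<open>x, y\<close> which is at least 1 at points with real nonnegative coordinates. Hence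
  \<open>\<bar>K\<bar> \<le> C \<bar>\<P>\<bar>\<close>, which gives (iii) \<open>\<Longrightarrow>\<close> (ii), and \<open>\<bar>K\<bar>\<close> is as large as possible on Bergman balls.

  For (ii) \<open>\<Longrightarrow>\<close> (i), square integrability lets \<open>v ^ k f(u v, v ^ k)\<close> extend over \<open>v = 0\<close>, so points near the
  origin are controlled by points with \<open>\<bar>v\<bar>\<close> bounded below (this is why the weight \<open>\<bar>w\<^sub>2\<bar> powr \<delta>\<close> is harmless).
  The mean value inequality on polydiscs and Tonelli then yield
  \<open>\<integral>\<bar>f\<bar>^2 d\<mu> \<le> C \<integral>\<bar>f\<bar>^2 B_mu dV\<close> for the parts near the boundary; Montel and dominated convergence do the rest.

  For (i) \<open>\<Longrightarrow>\<close> (iii), the norm of \<open>\<P>(\<cdot>, w)\<close> is at most a constant times the square root of \<open>K(w, w)\<close>, and the normalised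
  functions tend to 0 pointwise as \<open>w\<close> approaches the boundary with \<open>\<bar>w\<^sub>2\<bar>\<close> bounded below. If \<open>\<bar>w\<^sub>2\<bar>\<close> tends to 0,
  the weight wins because \<open>T_mu\<close> is bounded for a Carleson measure.
\<close>

text \<open>The corner at the origin shapes the argument. Sliding a centre along its fibre to the
  circle |v0| = \<kappa> relies on the maximum principle, which does not prescribe the argument of
  v0. The lower bound for |K| must therefore hold for every v0 on that circle; it does because
  \<kappa> is so small that y is close to the real point 0. The move costs a factor |v^k|^2, and
  this is exactly what |K(z,w)|^2 / K(w,w) gains as z tends to the corner, since the powers of |w2|
  cancel.

  The set left after removing the boundary tail still reaches the origin, so it is not compact in
  H_k and locally uniform convergence would not finish the proof. Dominated convergence is used
  there with a multiple of 1/|z2|^2 as majorant. A Carleson measure integrates it because P(.,w) for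
  w = (0, 1/2) lies in A^2 and is comparable with 1/z2.

  Kernel norms are only bounded, not computed: disc integrals are dominated by sums over dyadic
  balls, and powers x^k are removed by averaging over the k-th roots of unity.\<close>

abbreviation sq_on :: "'a set \<Rightarrow> ('a \<Rightarrow> complex) \<Rightarrow> 'a \<Rightarrow> ennreal" where
  "sq_on S f \<equiv> \<lambda>z. indicator S z * ennreal ((cmod (f z))^2)"

abbreviation sq_mass :: "'a measure \<Rightarrow> 'a set \<Rightarrow> ('a \<Rightarrow> complex) \<Rightarrow> ennreal" where
  "sq_mass M S f \<equiv> integral\<^sup>N M (sq_on S f)"

section \<open>Area integrals over the complex plane\<close>

text \<open>Makes Tonelli in real and imaginary part available. Both measures are determined by
  their values on boxes.\<close>

lemma lborel_complex:
  "(lborel :: complex measure) = distr (lborel \<Otimes>\<^sub>M lborel) borel (\<lambda>(x, y). Complex x y)"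
proof (rule lborel_eqI)
  have [measurable]: "(\<lambda>(x, y). Complex x y) \<in> borel \<rightarrow>\<^sub>M borel"
    by (intro borel_measurable_continuous_onI)
       (auto simp: Complex_eq case_prod_beta intro!: continuous_intros)
  fix l u :: complex
  assume lu: "\<And>b. b \<in> Basis \<Longrightarrow> l \<bullet> b \<le> u \<bullet> b"
  have le: "Re l \<le> Re u" "Im l \<le> Im u"
    using lu[of 1] lu[of \<i>] by (auto simp: Basis_complex_def inner_complex_def)
  have eq: "(\<lambda>(x, y). Complex x y) -` box l u = {Re l<..<Re u} \<times> {Im l<..<Im u}"
    by (auto simp: box_def Basis_complex_def inner_complex_def)
  have "emeasure (distr (lborel \<Otimes>\<^sub>M lborel) borel (\<lambda>(x, y). Complex x y)) (box l u)
     = emeasure (lborel \<Otimes>\<^sub>M lborel) ({Re l<..<Re u} \<times> {Im l<..<Im u})"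
    by (subst emeasure_distr) (auto simp: eq lborel_prod)
  also have "\<dots> = ennreal (Re u - Re l) * ennreal (Im u - Im l)"
    using le by (subst lborel.emeasure_pair_measure_Times) auto
  also have "\<dots> = (\<Prod>b\<in>Basis. (u - l) \<bullet> b)"
    using le by (simp add: Basis_complex_def inner_complex_def ennreal_mult)
  finally show "emeasure (distr (lborel \<Otimes>\<^sub>M lborel) borel (\<lambda>(x, y). Complex x y)) (box l u)
     = (\<Prod>b\<in>Basis. (u - l) \<bullet> b)" .
qed simp

lemma nn_integral_complex:
  assumes [measurable]: "h \<in> borel_measurable borel"
  shows "(\<integral>\<^sup>+z. h z \<partial>lborel) = (\<integral>\<^sup>+x. \<integral>\<^sup>+y. h (Complex x y) \<partial>lborel \<partial>lborel)"
proof -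
  have [measurable]: "(\<lambda>(x, y). Complex x y) \<in> borel \<rightarrow>\<^sub>M borel"
    by (intro borel_measurable_continuous_onI)
       (auto simp: Complex_eq case_prod_beta intro!: continuous_intros)
  have "(\<integral>\<^sup>+z. h z \<partial>lborel) = (\<integral>\<^sup>+p. h (case p of (x, y) \<Rightarrow> Complex x y) \<partial>(lborel \<Otimes>\<^sub>M lborel))"
    by (subst lborel_complex, subst nn_integral_distr) (auto simp: lborel_prod)
  also have "\<dots> = (\<integral>\<^sup>+x. \<integral>\<^sup>+y. h (Complex x y) \<partial>lborel \<partial>lborel)"
    by (subst lborel.nn_integral_fst[symmetric]) (auto simp: lborel_prod)
  finally show ?thesis .
qed

lemma measurable_Complex [measurable (raw)]:
  assumes "f \<in> borel_measurable M" "g \<in> borel_measurable M"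
  shows "(\<lambda>x. Complex (f x) (g x)) \<in> borel_measurable M"
  using assms unfolding Complex_eq by measurable

text \<open>Multiplication by \<open>c\<close> is a real 2x2 matrix of determinant |c|^2. Factored
  into triangular maps, it becomes two one-dimensional affine substitutions, one inside each order
  of integration.\<close>

lemma nn_integral_complex_mult:
  fixes c :: complex
  assumes [measurable]: "h \<in> borel_measurable borel" and c: "c \<noteq> 0"
  shows "(\<integral>\<^sup>+z. h z \<partial>lborel) = ennreal ((cmod c)^2) * (\<integral>\<^sup>+z. h (c * z) \<partial>lborel)"
proof -
  have shear: "(\<integral>\<^sup>+z. h z \<partial>lborel) = ennreal (\<bar>p\<bar> * \<bar>q\<bar>) *
      (\<integral>\<^sup>+x. \<integral>\<^sup>+y. h (Complex (p * x - b * y) (b / p * (p * x - b * y) + q * y)) \<partial>lborel \<partial>lborel)"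
    if p: "p \<noteq> 0" and q: "q \<noteq> 0" for p q b :: real
  proof -
    have "(\<integral>\<^sup>+z. h z \<partial>lborel) = (\<integral>\<^sup>+x. \<integral>\<^sup>+y. h (Complex x y) \<partial>lborel \<partial>lborel)"
      by (rule nn_integral_complex) fact
    also have "\<dots> = (\<integral>\<^sup>+x. ennreal \<bar>q\<bar> * (\<integral>\<^sup>+y. h (Complex x (b / p * x + q * y)) \<partial>lborel) \<partial>lborel)"
      by (rule nn_integral_cong, subst nn_integral_real_affine[OF _ q]) simp_all
    also have "\<dots> = ennreal \<bar>q\<bar> * (\<integral>\<^sup>+x. (\<integral>\<^sup>+y. h (Complex x (b / p * x + q * y)) \<partial>lborel) \<partial>lborel)"
      by (rule nn_integral_cmult) simp
    also have "(\<integral>\<^sup>+x. (\<integral>\<^sup>+y. h (Complex x (b / p * x + q * y)) \<partial>lborel) \<partial>lborel)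
       = (\<integral>\<^sup>+y. (\<integral>\<^sup>+x. h (Complex x (b / p * x + q * y)) \<partial>lborel) \<partial>lborel)"
      by (rule lborel_pair.Fubini'[symmetric]) measurable
    also have "\<dots> = (\<integral>\<^sup>+y. ennreal \<bar>p\<bar> * (\<integral>\<^sup>+x. h (Complex (- (b * y) + p * x) (b / p * (- (b * y) + p * x) + q * y)) \<partial>lborel) \<partial>lborel)"
      by (rule nn_integral_cong, subst nn_integral_real_affine[OF _ p, where t = "- (b * _)"]) simp_all
    also have "\<dots> = ennreal \<bar>p\<bar> * (\<integral>\<^sup>+y. (\<integral>\<^sup>+x. h (Complex (- (b * y) + p * x) (b / p * (- (b * y) + p * x) + q * y)) \<partial>lborel) \<partial>lborel)"
      by (rule nn_integral_cmult) simp
    also have "(\<integral>\<^sup>+y. (\<integral>\<^sup>+x. h (Complex (- (b * y) + p * x) (b / p * (- (b * y) + p * x) + q * y)) \<partial>lborel) \<partial>lborel)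
       = (\<integral>\<^sup>+x. (\<integral>\<^sup>+y. h (Complex (- (b * y) + p * x) (b / p * (- (b * y) + p * x) + q * y)) \<partial>lborel) \<partial>lborel)"
      by (rule lborel_pair.Fubini') measurable
    finally show ?thesis
      by (simp add: ennreal_mult mult_ac)
  qed
  show ?thesis
  proof (cases "Re c = 0")
    case False
    \<comment> \<open>The pivots of the triangular factorisation of the matrix of multiplication by
      \<open>c\<close>; their product is its determinant.\<close>
    define p q where "p = Re c" and "q = (cmod c)^2 / Re c"
    have eq: "Complex (p * x - Im c * y) (Im c / p * (p * x - Im c * y) + q * y) = c * Complex x y" for x y
      using False unfolding p_def q_def
      by (simp add: complex_eq_iff cmod_power2 divide_simps) (simp add: algebra_simps power2_eq_square)
    have "(\<integral>\<^sup>+z. h z \<partial>lborel) = ennreal (\<bar>p\<bar> * \<bar>q\<bar>) *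
      (\<integral>\<^sup>+x. \<integral>\<^sup>+y. h (c * Complex x y) \<partial>lborel \<partial>lborel)"
      unfolding eq[symmetric] using False c by (intro shear) (auto simp: p_def q_def)
    also have "\<bar>p\<bar> * \<bar>q\<bar> = (cmod c)^2"
      using False by (simp add: p_def q_def abs_mult[symmetric] del: abs_mult)
    also have "(\<integral>\<^sup>+x. \<integral>\<^sup>+y. h (c * Complex x y) \<partial>lborel \<partial>lborel) = (\<integral>\<^sup>+z. h (c * z) \<partial>lborel)"
      by (rule nn_integral_complex[symmetric]) simp
    finally show ?thesis .
  next
    case True
    \<comment> \<open>Here the first pivot vanishes. Multiplication by a purely imaginary number
      swaps the two coordinates and scales them, so exchanging the order of integration takes the
      place of the shear.\<close>
    define b where "b = Im c"
    have b: "b \<noteq> 0" and cb: "c = Complex 0 b"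
      using True c by (auto simp: b_def complex_eq_iff)
    have "(\<integral>\<^sup>+z. h z \<partial>lborel) = (\<integral>\<^sup>+x. \<integral>\<^sup>+y. h (Complex x y) \<partial>lborel \<partial>lborel)"
      by (rule nn_integral_complex) fact
    also have "\<dots> = (\<integral>\<^sup>+x. ennreal \<bar>b\<bar> * (\<integral>\<^sup>+y. h (Complex x (b * y)) \<partial>lborel) \<partial>lborel)"
      by (rule nn_integral_cong, subst nn_integral_real_affine[OF _ b, where t = 0]) simp_all
    also have "\<dots> = ennreal \<bar>b\<bar> * (\<integral>\<^sup>+x. (\<integral>\<^sup>+y. h (Complex x (b * y)) \<partial>lborel) \<partial>lborel)"
      by (rule nn_integral_cmult) simp
    also have "(\<integral>\<^sup>+x. (\<integral>\<^sup>+y. h (Complex x (b * y)) \<partial>lborel) \<partial>lborel)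
      = ennreal \<bar>-b\<bar> * (\<integral>\<^sup>+x. (\<integral>\<^sup>+y. h (Complex (- b * x) (b * y)) \<partial>lborel) \<partial>lborel)"
      using b by (subst nn_integral_real_affine[where c = "-b" and t = 0]) simp_all
    also have "(\<integral>\<^sup>+x. (\<integral>\<^sup>+y. h (Complex (- b * x) (b * y)) \<partial>lborel) \<partial>lborel)
       = (\<integral>\<^sup>+y. (\<integral>\<^sup>+x. h (Complex (- b * x) (b * y)) \<partial>lborel) \<partial>lborel)"
      by (rule lborel_pair.Fubini'[symmetric]) measurable
    also have "\<dots> = (\<integral>\<^sup>+z. h (c * z) \<partial>lborel)"
    proof -
      have "Complex (- b * y) (b * x) = c * Complex x y" for x y
        by (simp add: cb complex_eq_iff)
      then show ?thesis
        by (simp add: nn_integral_complex[where h = "\<lambda>z. h (c * z)"])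
    qed
    finally show ?thesis
      by (simp add: cb ennreal_mult[symmetric] mult.assoc[symmetric] cmod_def power2_eq_square abs_mult[symmetric])
  qed
qed

lemma nn_integral_complex_translate:
  fixes c :: complex
  assumes [measurable]: "h \<in> borel_measurable borel"
  shows "(\<integral>\<^sup>+z. h (c + z) \<partial>lborel) = (\<integral>\<^sup>+z. h z \<partial>lborel)"
proof -
  have "(\<integral>\<^sup>+z. h z \<partial>lborel) = (\<integral>\<^sup>+z. h z \<partial>distr lborel borel ((+) c))"
    using lborel_distr_plus[of c] by (simp add: lborel_distr_plus)
  also have "\<dots> = (\<integral>\<^sup>+z. h (c + z) \<partial>lborel)"
    by (subst nn_integral_distr) auto
  finally show ?thesis ..
qed

lemma emeasure_ball_complex: "r \<ge> 0 \<Longrightarrow> emeasure lborel (ball (c::complex) r) = ennreal (pi * r^2)"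
  using emeasure_ball[of r c] by (simp add: unit_ball_vol_2)

lemma circle_mean_value:
  assumes g: "g holomorphic_on cball 0 r" and r: "r > 0"
  shows "((\<lambda>x. g (of_real r * exp (2 * of_real pi * \<i> * of_real x))) has_integral g 0) {0..1::real}"
proof -
  have "((\<lambda>u. g u / (u - 0)) has_contour_integral (2 * of_real pi * \<i> * g 0)) (circlepath 0 r)"
    using g r by (intro Cauchy_integral_circlepath_simple) auto
  then have "((\<lambda>x. g (circlepath 0 r x) / circlepath 0 r x *
      vector_derivative (circlepath 0 r) (at x)) has_integral (2 * of_real pi * \<i> * g 0)) {0..1}"
    unfolding has_contour_integral by simp
  then have "((\<lambda>x. (2 * of_real pi * \<i>) * g (of_real r * exp (2 * of_real pi * \<i> * of_real x)))
      has_integral (2 * of_real pi * \<i> * g 0)) {0..1}"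
    using r unfolding vector_derivative_circlepath by (simp add: circlepath mult_ac)
  moreover have "inverse (2 * of_real pi * \<i>) * ((2 * of_real pi * \<i>) * w) = w" for w :: complex
    by (simp add: field_simps)
  ultimately show ?thesis
    using has_integral_mult_right[of _ _ _ "inverse (2 * of_real pi * \<i>)"] by (metis (no_types, lifting) has_integral_cong)
qed

text \<open>The mean value property is used for \<open>(g (w * z))^2\<close> as a function of
  \<open>w\<close>, so the squared modulus appears at once, without a convexity inequality. Rotating
  a fixed \<open>z\<close> covers all circles simultaneously, the degenerate one at 0
  included.\<close>

lemma circle_mean_sq:
  assumes g: "g holomorphic_on ball 0 \<rho>" and z: "cmod z < \<rho>"
  shows "ennreal ((cmod (g 0))^2) \<le>
    (\<integral>\<^sup>+x. indicator {0..1} x * ennreal ((cmod (g (exp (2 * of_real pi * \<i> * of_real x) * z)))^2) \<partial>lborel)"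
proof -
  define e :: "real \<Rightarrow> complex" where "e x = exp (2 * of_real pi * \<i> * of_real x)" for x
  have ne: "cmod (e x) = 1" for x
    by (simp add: e_def norm_exp_eq_Re)
  define G where "G w = (g (w * z))^2" for w
  have hG: "G holomorphic_on cball 0 1"
  proof -
    have "(\<lambda>w. g (w * z)) holomorphic_on cball 0 1"
    proof (rule holomorphic_on_compose_gen[OF _ g, of "\<lambda>w. w * z", unfolded o_def])
      show "(\<lambda>w. w * z) ` cball 0 1 \<subseteq> ball 0 \<rho>"
      proof safe
        fix w :: complex assume "w \<in> cball 0 1"
        then have "cmod w * cmod z \<le> 1 * cmod z"
          by (intro mult_right_mono) auto
        then show "w * z \<in> ball 0 \<rho>"
          using z by (simp add: norm_mult)
      qed
    qed (auto intro!: holomorphic_intros)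
    then show ?thesis
      unfolding G_def by (intro holomorphic_intros)
  qed
  have hi: "((\<lambda>x. G (e x)) has_integral G 0) {0..1}"
    using circle_mean_value[OF hG] by (simp add: e_def)
  have cG: "continuous_on {0..1} (\<lambda>x. G (e x))"
    unfolding e_def
    by (rule continuous_on_compose2[OF holomorphic_on_imp_continuous_on[OF hG]])
       (auto intro!: continuous_intros simp: norm_exp_eq_Re)
  then have cN: "(\<lambda>x. cmod (G (e x))) integrable_on {0..1}"
    by (intro integrable_continuous_real continuous_intros)
  have "cmod (G 0) \<le> integral {0..1} (\<lambda>x. cmod (G (e x)))"
    using hi cN by (metis integral_norm_bound_integral order_refl has_integral_integrable integral_unique)
  moreover have "(\<integral>\<^sup>+x. indicator {0..1} x * ennreal (cmod (G (e x))) \<partial>lborel)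
      = ennreal (integral {0..1} (\<lambda>x. cmod (G (e x))))"
    using nn_integral_has_integral_lebesgue'[OF _ integrable_integral[OF cN]] by (simp add: mult.commute)
  ultimately show ?thesis
    by (simp add: G_def norm_power e_def ennreal_leI)
qed

text \<open>Integrating the circle inequality over all \<open>z\<close> in the disc and swapping
  with the rotation angle replaces polar coordinates: for each angle the area integral is
  unchanged.\<close>

lemma submean_disc:
  fixes g :: "complex \<Rightarrow> complex"
  assumes g: "g holomorphic_on ball a \<rho>" and \<rho>: "\<rho> > 0"
  shows "ennreal (pi * \<rho>^2) * ennreal ((cmod (g a))^2) \<le>
    sq_mass lborel (ball a \<rho>) g"
proof -
  define G where "G z = g (a + z)" for z
  define H where "H z = indicator (ball 0 \<rho>) z * ennreal ((cmod (G z))^2)" for z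
  define e :: "real \<Rightarrow> complex" where "e x = exp (2 * of_real pi * \<i> * of_real x)" for x
  have ne: "cmod (e x) = 1" "e x \<noteq> 0" for x
    by (auto simp: e_def norm_exp_eq_Re)
  have hG: "G holomorphic_on ball 0 \<rho>"
    unfolding G_def
    by (rule holomorphic_on_compose_gen[OF _ g, of "\<lambda>z. a + z", unfolded o_def])
       (auto intro!: holomorphic_intros simp: dist_norm)
  have [measurable]: "H \<in> borel_measurable borel"
  proof -
    have "(\<lambda>z. indicator (ball 0 \<rho>) z *\<^sub>R (cmod (G z))^2) \<in> borel_measurable borel"
      by (intro borel_measurable_continuous_on_indicator) 
         (auto intro!: continuous_intros holomorphic_on_imp_continuous_on[OF hG])
    then have "(\<lambda>z. ennreal (indicator (ball 0 \<rho>) z *\<^sub>R (cmod (G z))^2)) \<in> borel_measurable borel"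
      by simp
    also have "(\<lambda>z. ennreal (indicator (ball 0 \<rho>) z *\<^sub>R (cmod (G z))^2)) = H"
      by (auto simp: H_def fun_eq_iff indicator_def)
    finally show ?thesis .
  qed
  have [measurable]: "e \<in> borel_measurable borel"
    unfolding e_def by (intro borel_measurable_continuous_onI continuous_intros)
  have rot: "(\<integral>\<^sup>+z. H (e x * z) \<partial>lborel) = (\<integral>\<^sup>+z. H z \<partial>lborel)" for x
    using nn_integral_complex_mult[of H "e x"] by (simp add: ne)
  have "ennreal (pi * \<rho>^2) * ennreal ((cmod (g a))^2) =
      (\<integral>\<^sup>+z. ennreal ((cmod (G 0))^2) * indicator (ball 0 \<rho>) z \<partial>(lborel::complex measure))"
    using \<rho> by (subst nn_integral_cmult_indicator) (auto simp: emeasure_ball_complex G_def mult.commute)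
  also have "\<dots> \<le> (\<integral>\<^sup>+z. \<integral>\<^sup>+x. indicator {0..1} x * H (e x * z) \<partial>lborel \<partial>lborel)"
  proof (rule nn_integral_mono)
    fix z :: complex
    show "ennreal ((cmod (G 0))^2) * indicator (ball 0 \<rho>) z \<le> (\<integral>\<^sup>+x. indicator {0..1} x * H (e x * z) \<partial>lborel)"
      using circle_mean_sq[OF hG, of z] by (auto simp: indicator_def H_def norm_mult ne e_def[symmetric])
  qed
  also have "\<dots> = (\<integral>\<^sup>+x. \<integral>\<^sup>+z. indicator {0..1} x * H (e x * z) \<partial>lborel \<partial>lborel)"
    by (rule lborel_pair.Fubini') simp
  also have "\<dots> = (\<integral>\<^sup>+x. indicator {0..1} x * (\<integral>\<^sup>+z. H z \<partial>lborel) \<partial>(lborel::real measure))"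
    by (intro nn_integral_cong, subst nn_integral_cmult) (auto simp: rot)
  also have "\<dots> = (\<integral>\<^sup>+z. H z \<partial>lborel)"
    by (subst nn_integral_multc) auto
  also have "\<dots> = (\<integral>\<^sup>+z. H (-a + z) \<partial>lborel)"
    by (rule nn_integral_complex_translate[symmetric]) simp
  also have "\<dots> = sq_mass lborel (ball a \<rho>) g"
    by (intro nn_integral_cong) (auto simp: H_def G_def indicator_def dist_norm norm_minus_commute)
  finally show ?thesis .
qed

section \<open>The mean value inequality on the Hartogs triangle\<close>

lemma open_Hk: "open (Hk k)"
  unfolding Hk_def by (intro open_Collect_conj open_Collect_less continuous_intros)

lemma Hk_param:
  assumes "cmod u < 1" "v \<noteq> 0" "cmod v < 1" "k > 0"
  shows "(u * v, v ^ k) \<in> Hk k"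
proof -
  have "cmod u ^ k < 1 ^ k"
    using assms by (intro power_strict_mono) auto
  moreover have "cmod v ^ k < 1 ^ k"
    using assms by (intro power_strict_mono) auto
  ultimately show ?thesis
    using assms by (simp add: Hk_def norm_mult norm_power power_mult_distrib)
qed

lemma cmod_lt_one_power_iff: "k > 0 \<Longrightarrow> cmod v ^ k < 1 \<longleftrightarrow> cmod v < 1"
  by (metis norm_ge_zero one_power2 power_less_one_iff power_one power_less_imp_less_base power_strict_mono zero_le_one)

text \<open>Any k-th root \<open>v\<close> of the second coordinate will do: dividing the first
  coordinate by \<open>v\<close> turns |z1|^k < |z2| into |u| < 1. The pair is determined only up to
  a k-th root of unity, so later statements are made for an arbitrary choice.\<close>

lemma Hk_paramE:
  assumes z: "z \<in> Hk k" and k: "k > 0"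
  obtains u v where "cmod u < 1" "v \<noteq> 0" "cmod v < 1" "z = (u * v, v ^ k)"
proof -
  obtain z1 z2 where zz: "z = (z1, z2)" by force
  have lt: "cmod z1 ^ k < cmod z2" "cmod z2 < 1"
    using z by (auto simp: Hk_def zz)
  have z2: "z2 \<noteq> 0"
    using lt(1) by (metis norm_zero norm_ge_zero not_less zero_le_power)
  define v where "v = exp (Ln z2 / of_nat k)"
  have vk: "v ^ k = z2"
    using k z2 by (simp add: v_def exp_of_nat_mult[symmetric])
  have v0: "v \<noteq> 0" by (simp add: v_def)
  have "cmod v ^ k < 1"
    using vk lt(2) by (simp add: norm_power[symmetric])
  then have v1: "cmod v < 1"
    using k cmod_lt_one_power_iff by blast
  have "cmod (z1 / v) ^ k < 1"
    using lt(1) v0 vk z2 by (simp add: norm_divide power_divide norm_power[symmetric])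
  then have "cmod (z1 / v) < 1"
    using k cmod_lt_one_power_iff by blast
  then show ?thesis
    using that[of "z1 / v" v] v0 v1 vk zz by simp
qed

text \<open>The chain rule through which all function theory in two variables is reduced to
  one-variable discs.\<close>

lemma holo2_compose:
  assumes f: "holo2 f U" and S: "open S"
    and a: "a holomorphic_on S" and b: "b holomorphic_on S"
    and in_U: "\<And>\<zeta>. \<zeta> \<in> S \<Longrightarrow> (a \<zeta>, b \<zeta>) \<in> U"
  shows "(\<lambda>\<zeta>. f (a \<zeta>, b \<zeta>)) holomorphic_on S"
proof -
  have "(\<lambda>\<zeta>. f (a \<zeta>, b \<zeta>)) field_differentiable (at \<zeta>)" if \<zeta>: "\<zeta> \<in> S" for \<zeta>
  proof -
    obtain a' b' where d: "(a has_field_derivative a') (at \<zeta>)" "(b has_field_derivative b') (at \<zeta>)"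
      using a b S \<zeta> by (meson field_differentiable_def holomorphic_on_imp_differentiable_at)
    obtain p q where pq: "(f has_derivative (\<lambda>h. p * fst h + q * snd h)) (at (a \<zeta>, b \<zeta>))"
      using f in_U[OF \<zeta>] unfolding holo2_def by blast
    have "((\<lambda>\<zeta>. (a \<zeta>, b \<zeta>)) has_derivative (\<lambda>h. (a' * h, b' * h))) (at \<zeta>)"
      using d unfolding has_field_derivative_def by (rule has_derivative_Pair)
    from has_derivative_compose[OF this pq]
    have "((\<lambda>\<zeta>. f (a \<zeta>, b \<zeta>)) has_derivative (\<lambda>h. p * (a' * h) + q * (b' * h))) (at \<zeta>)"
      by simp
    also have "(\<lambda>h. p * (a' * h) + q * (b' * h)) = (*) (p * a' + q * b')"
      by (auto simp: algebra_simps)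
    finally show ?thesis
      unfolding field_differentiable_def has_field_derivative_def by blast
  qed
  then show ?thesis
    using S holomorphic_on_open field_differentiable_def by blast
qed

lemma holo2_continuous_on: "holo2 f U \<Longrightarrow> continuous_on U f"
  unfolding holo2_def
  by (meson continuous_at_imp_continuous_on has_derivative_continuous)

lemma measurable_restrict_continuous:
  fixes f :: "'a::topological_space \<Rightarrow> 'b::{real_normed_vector, second_countable_topology}"
  assumes "continuous_on U f" "open U"
  shows "(\<lambda>z. indicator U z *\<^sub>R f z) \<in> borel_measurable borel"
  using assms by (intro borel_measurable_continuous_on_indicator) auto

lemma measurable_ind_ennreal:
  fixes g :: "'a::topological_space \<Rightarrow> real"
  assumes "continuous_on U g" "open U"
  shows "(\<lambda>z. indicator U z * ennreal (g z)) \<in> borel_measurable borel"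
proof -
  have "(\<lambda>z. ennreal (indicator U z *\<^sub>R g z)) \<in> borel_measurable borel"
    using measurable_restrict_continuous[OF assms] by simp
  also have "(\<lambda>z. ennreal (indicator U z *\<^sub>R g z)) = (\<lambda>z. indicator U z * ennreal (g z))"
    by (auto simp: fun_eq_iff indicator_def)
  finally show ?thesis .
qed

lemma measurable_holo2_sq:
  assumes "holo2 f (Hk k)"
  shows "sq_on (Hk k) f \<in> borel_measurable borel"
  by (intro measurable_ind_ennreal continuous_intros holo2_continuous_on[OF assms] open_Hk)

text \<open>The branch of the k-th root near \<open>v ^ k\<close> that takes the value
  \<open>v\<close> there. The logarithm is taken of a quotient close to 1, so the principal branch
  works whatever the argument of \<open>v\<close> is.\<close>

definition root_branch :: "nat \<Rightarrow> complex \<Rightarrow> complex \<Rightarrow> complex" where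
  "root_branch k v \<zeta> = v * exp (Ln (\<zeta> / v ^ k) / of_nat k)"

text \<open>The quotient lies within distance 1 of the point 1, hence in the right half-plane, off
  the cut of the logarithm.\<close>

lemma root_branch_aux:
  assumes "v \<noteq> 0" "cmod (\<zeta> - v ^ k) < cmod (v ^ k)"
  shows "\<zeta> / v ^ k \<notin> \<real>\<^sub>\<le>\<^sub>0" "\<zeta> \<noteq> 0"
proof -
  have "cmod (\<zeta> / v ^ k - 1) = cmod (\<zeta> - v ^ k) / cmod (v ^ k)"
    using assms by (simp add: norm_divide[symmetric] diff_divide_distrib)
  also have "\<dots> < 1"
    using assms by (simp add: divide_less_eq)
  finally have "Re (\<zeta> / v ^ k) > 0"
    using abs_Re_le_cmod[of "\<zeta> / v ^ k - 1"] by simp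
  then show "\<zeta> / v ^ k \<notin> \<real>\<^sub>\<le>\<^sub>0"
    by (auto simp: complex_nonpos_Reals_iff)
  then show "\<zeta> \<noteq> 0" by auto
qed

lemma root_branch_power:
  assumes "k > 0" "v \<noteq> 0" "cmod (\<zeta> - v ^ k) < cmod (v ^ k)"
  shows "root_branch k v \<zeta> ^ k = \<zeta>" "root_branch k v \<zeta> \<noteq> 0"
proof -
  have "\<zeta> / v ^ k \<noteq> 0"
    using root_branch_aux[OF assms(2,3)] assms(2) by simp
  then show "root_branch k v \<zeta> ^ k = \<zeta>"
    using assms(1,2) by (simp add: root_branch_def power_mult_distrib exp_of_nat_mult[symmetric])
  show "root_branch k v \<zeta> \<noteq> 0"
    using assms(2) by (simp add: root_branch_def)
qed

lemma root_branch_center: "v \<noteq> 0 \<Longrightarrow> root_branch k v (v ^ k) = v"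
  by (simp add: root_branch_def)

lemma holomorphic_root_branch:
  assumes "v \<noteq> 0" "\<rho> \<le> cmod (v ^ k)"
  shows "root_branch k v holomorphic_on ball (v ^ k) \<rho>"
proof -
  have "\<zeta> / v ^ k \<notin> \<real>\<^sub>\<le>\<^sub>0" if "\<zeta> \<in> ball (v ^ k) \<rho>" for \<zeta>
    using root_branch_aux(1)[of v \<zeta> k] assms that by (auto simp: dist_norm norm_minus_commute)
  then show ?thesis
    unfolding root_branch_def using assms(1) by (intro holomorphic_intros) auto
qed

text \<open>The submean inequality is applied in \<open>\<zeta>\<close> along fixed
  \<open>u\<close>, then in \<open>u'\<close> for each \<open>\<zeta>\<close>. Passing from
  \<open>u'\<close> to the first coordinate \<open>u' * B \<zeta>\<close> has Jacobian |B
  \<zeta>|^2, which is the source of the factor |v|^2. The weight \<open>W\<close> only has to be at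
  least 1 on the polydisc, so an indicator or a multiple of the Berezin density can be
  inserted.\<close>

lemma local_submean:
  assumes f: "holo2 f (Hk k)" and k: "k > 0"
    and u: "cmod u < 1" and v: "v \<noteq> 0" "cmod v < 1"
    and r1: "0 < r1" "r1 \<le> 1 - cmod u"
    and r2: "0 < r2" "r2 \<le> 1 - cmod (v ^ k)" "r2 \<le> cmod (v ^ k) / 2"
    and W[measurable]: "W \<in> borel_measurable borel"
    and W1: "\<And>u' \<zeta>. cmod (u' - u) < r1 \<Longrightarrow> cmod (\<zeta> - v ^ k) < r2 \<Longrightarrow>
      1 \<le> W (u' * root_branch k v \<zeta>, \<zeta>)"
  shows "ennreal ((cmod v)^2 * r1^2 * r2^2) * ennreal ((cmod (f (u * v, v ^ k)))^2) \<le>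
    (\<integral>\<^sup>+w. indicator (Hk k) w * W w * ennreal ((cmod (f w))^2) \<partial>lborel)"
proof -
  define B where "B = root_branch k v"
  define H where "H w = indicator (Hk k) w * W w * ennreal ((cmod (f w))^2)" for w
  have [measurable]: "H \<in> borel_measurable borel"
  proof -
    have [measurable]: "sq_on (Hk k) f \<in> borel_measurable borel"
      by (rule measurable_holo2_sq[OF f])
    have "(\<lambda>w. W w * (indicator (Hk k) w * ennreal ((cmod (f w))^2))) \<in> borel_measurable borel"
      by measurable
    then show ?thesis
      by (simp add: H_def[abs_def] mult_ac)
  qed
  have [measurable]: "(\<lambda>w1. H (w1, \<zeta>)) \<in> borel_measurable borel" for \<zeta>
    by (rule measurable_compose[OF _ \<open>H \<in> _\<close>]) (intro borel_measurable_continuous_onI continuous_intros)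
  have vk: "v ^ k \<noteq> 0" using v by simp
  have near: "B \<zeta> ^ k = \<zeta>" "B \<zeta> \<noteq> 0" "cmod \<zeta> < 1" "cmod (B \<zeta>) < 1" "cmod v / 2 \<le> cmod (B \<zeta>)"
    if \<zeta>: "cmod (\<zeta> - v ^ k) < r2" for \<zeta>
  proof -
    have "cmod (\<zeta> - v ^ k) < cmod (v ^ k)"
      using \<zeta> r2 vk by (smt (verit) half_gt_zero_iff zero_less_norm_iff field_sum_of_halves)
    then show B: "B \<zeta> ^ k = \<zeta>" "B \<zeta> \<noteq> 0"
      unfolding B_def using k v root_branch_power[of k v \<zeta>] by auto
    show \<zeta>1: "cmod \<zeta> < 1"
      using \<zeta> r2 norm_triangle_sub[of \<zeta> "v ^ k"] by linarith
    have Bn: "cmod (B \<zeta>) ^ k = cmod \<zeta>"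
      using B by (simp add: norm_power[symmetric])
    then show "cmod (B \<zeta>) < 1"
      using \<zeta>1 k cmod_lt_one_power_iff by metis
    \<comment> \<open>Since \<open>k\<close> is positive, halving \<open>v\<close> before taking the
      power loses at least a factor 2; together with |\<zeta>| \<ge> |v^k| / 2 this keeps the
      Jacobian away from 0.\<close>
    have "(cmod v / 2) ^ k \<le> cmod v ^ k / 2"
    proof -
      have "(2::real) ^ 1 \<le> 2 ^ k" using k by (intro power_increasing) auto
      then show ?thesis
        using mult_left_mono[of "2" "2 ^ k" "cmod v ^ k"] by (simp add: power_divide field_simps)
    qed
    also have "\<dots> \<le> cmod \<zeta>"
      using norm_triangle_sub[of "v ^ k" \<zeta>] \<zeta> r2 by (simp add: norm_power norm_minus_commute)
    finally have "(cmod v / 2) ^ k \<le> cmod (B \<zeta>) ^ k"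
      unfolding Bn .
    then show "cmod v / 2 \<le> cmod (B \<zeta>)"
      using k power_mono_iff[of "cmod v / 2" "cmod (B \<zeta>)" k] by simp
  qed
  have u1: "cmod u' < 1" if "cmod (u' - u) < r1" for u'
    using that r1 norm_triangle_sub[of u' u] by linarith
  have inH: "(u' * B \<zeta>, \<zeta>) \<in> Hk k" if "cmod \<zeta> < 1" "cmod u' < 1" "cmod (\<zeta> - v ^ k) < r2" for u' \<zeta>
    using Hk_param[of u' "B \<zeta>" k] near[of \<zeta>] that k by simp
  \<comment> \<open>Bounds the inverse Jacobian, because |B \<zeta>| is at least half of
    |v|.\<close>
  define c where "c = 4 / ((cmod v)^2)"
  have inner: "ennreal (pi * r1^2) * ennreal ((cmod (f (u * B \<zeta>, \<zeta>)))^2) \<le>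
      ennreal c * (\<integral>\<^sup>+w1. H (w1, \<zeta>) \<partial>lborel)" if \<zeta>: "cmod (\<zeta> - v ^ k) < r2" for \<zeta>
  proof -
    have "(\<lambda>u'. f (u' * B \<zeta>, \<zeta>)) holomorphic_on ball u r1"
      using u1 near[OF \<zeta>] inH \<zeta>
      by (intro holo2_compose[OF f]) (auto intro!: holomorphic_intros simp: dist_norm norm_minus_commute)
    from submean_disc[OF this r1(1)]
    have "ennreal (pi * r1^2) * ennreal ((cmod (f (u * B \<zeta>, \<zeta>)))^2) \<le>
       sq_mass lborel (ball u r1) (\<lambda>u'. f (u' * B \<zeta>, \<zeta>))" .
    also have "\<dots> \<le> (\<integral>\<^sup>+u'. H (B \<zeta> * u', \<zeta>) \<partial>lborel)"
    proof (rule nn_integral_mono)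
      fix u' :: complex
      show "indicator (ball u r1) u' * ennreal ((cmod (f (u' * B \<zeta>, \<zeta>)))^2) \<le> H (B \<zeta> * u', \<zeta>)"
      proof (cases "cmod (u' - u) < r1")
        case True
        have "1 * ennreal ((cmod (f (u' * B \<zeta>, \<zeta>)))^2) \<le> W (u' * B \<zeta>, \<zeta>) * ennreal ((cmod (f (u' * B \<zeta>, \<zeta>)))^2)"
          using W1[OF True \<zeta>] unfolding B_def by (rule mult_right_mono) simp
        then show ?thesis
          using inH[OF near(3)[OF \<zeta>] u1[OF True] \<zeta>] True
          by (simp add: H_def mult.commute[of u'] dist_norm norm_minus_commute)
      next
        case False
        then show ?thesis by (simp add: dist_norm norm_minus_commute)
      qed
    qed
    also have "\<dots> = ennreal (1 / (cmod (B \<zeta>))^2) * (\<integral>\<^sup>+w1. H (w1, \<zeta>) \<partial>lborel)"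
      using near(2)[OF \<zeta>]
      by (subst nn_integral_complex_mult[where c = "B \<zeta>" and h = "\<lambda>w1. H (w1, \<zeta>)"])
         (auto simp: mult.assoc[symmetric] ennreal_mult[symmetric])
    also have "\<dots> \<le> ennreal c * (\<integral>\<^sup>+w1. H (w1, \<zeta>) \<partial>lborel)"
    proof (intro mult_right_mono ennreal_leI)
      have "(cmod v / 2)^2 \<le> (cmod (B \<zeta>))^2"
        using near(5)[OF \<zeta>] by (intro power_mono) auto
      then show "1 / (cmod (B \<zeta>))^2 \<le> c"
        using v near(2)[OF \<zeta>] by (simp add: c_def field_simps)
    qed simp
    finally show ?thesis .
  qed
  have "B holomorphic_on ball (v ^ k) r2"
    unfolding B_def using v r2 by (intro holomorphic_root_branch) auto
  then have "(\<lambda>\<zeta>. f (u * B \<zeta>, \<zeta>)) holomorphic_on ball (v ^ k) r2"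
    using u near inH
    by (intro holo2_compose[OF f]) (auto intro!: holomorphic_intros simp: dist_norm norm_minus_commute)
  from submean_disc[OF this r2(1)]
  have "ennreal (pi * r2^2) * ennreal ((cmod (f (u * v, v ^ k)))^2) \<le>
     sq_mass lborel (ball (v ^ k) r2) (\<lambda>\<zeta>. f (u * B \<zeta>, \<zeta>))"
    using v by (simp add: B_def root_branch_center)
  then have "ennreal (pi * r1^2) * (ennreal (pi * r2^2) * ennreal ((cmod (f (u * v, v ^ k)))^2)) \<le>
     ennreal (pi * r1^2) * sq_mass lborel (ball (v ^ k) r2) (\<lambda>\<zeta>. f (u * B \<zeta>, \<zeta>))"
    by (rule mult_left_mono) simp
  also have "\<dots> = (\<integral>\<^sup>+\<zeta>. ennreal (pi * r1^2) * (indicator (ball (v ^ k) r2) \<zeta> * ennreal ((cmod (f (u * B \<zeta>, \<zeta>)))^2)) \<partial>lborel)"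
  proof (rule nn_integral_cmult[symmetric])
    show "sq_on (ball (v ^ k) r2) (\<lambda>\<zeta>. f (u * B \<zeta>, \<zeta>)) \<in> borel_measurable lborel"
      using measurable_ind_ennreal[of "ball (v ^ k) r2" "\<lambda>\<zeta>. (cmod (f (u * B \<zeta>, \<zeta>)))^2"]
        holomorphic_on_imp_continuous_on[OF \<open>(\<lambda>\<zeta>. f (u * B \<zeta>, \<zeta>)) holomorphic_on _\<close>]
      by (simp add: continuous_intros)
  qed
  also have "\<dots> \<le> (\<integral>\<^sup>+\<zeta>. ennreal c * (\<integral>\<^sup>+w1. H (w1, \<zeta>) \<partial>lborel) \<partial>lborel)"
  proof (rule nn_integral_mono)
    fix \<zeta> :: complex
    show "ennreal (pi * r1^2) * (indicator (ball (v ^ k) r2) \<zeta> * ennreal ((cmod (f (u * B \<zeta>, \<zeta>)))^2))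
      \<le> ennreal c * (\<integral>\<^sup>+w1. H (w1, \<zeta>) \<partial>lborel)"
      using inner[of \<zeta>] by (auto simp: indicator_def dist_norm norm_minus_commute)
  qed
  also have "\<dots> = ennreal c * (\<integral>\<^sup>+\<zeta>. (\<integral>\<^sup>+w1. H (w1, \<zeta>) \<partial>lborel) \<partial>lborel)"
  proof (rule nn_integral_cmult)
    have "(\<lambda>(\<zeta>, w1). H (w1, \<zeta>)) \<in> borel_measurable (lborel \<Otimes>\<^sub>M lborel)"
      unfolding lborel_prod case_prod_beta
      by (rule measurable_compose[OF _ \<open>H \<in> _\<close>])
         (auto intro!: borel_measurable_continuous_onI continuous_intros)
    then show "(\<lambda>\<zeta>. \<integral>\<^sup>+w1. H (w1, \<zeta>) \<partial>lborel) \<in> borel_measurable lborel"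
      by (rule lborel.borel_measurable_nn_integral[of "\<lambda>\<zeta> w1. H (w1, \<zeta>)" lborel])
  qed
  also have "(\<integral>\<^sup>+\<zeta>. (\<integral>\<^sup>+w1. H (w1, \<zeta>) \<partial>lborel) \<partial>lborel) = (\<integral>\<^sup>+w. H w \<partial>lborel)"
    by (subst lborel_pair.nn_integral_snd) (auto simp: lborel_prod)
  finally have *: "ennreal (pi * r1^2) * (ennreal (pi * r2^2) * ennreal ((cmod (f (u * v, v ^ k)))^2))
     \<le> ennreal c * (\<integral>\<^sup>+w. H w \<partial>lborel)" .
  \<comment> \<open>The two disc areas contribute pi^2, which outweighs the 4 in \<open>c\<close>;
    hence the final constant is 1.\<close>
  have "ennreal ((cmod v)^2 * r1^2 * r2^2) * ennreal ((cmod (f (u * v, v ^ k)))^2)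
     \<le> ennreal ((cmod v)^2 / 4) * (ennreal (pi * r1^2) * (ennreal (pi * r2^2) * ennreal ((cmod (f (u * v, v ^ k)))^2)))"
  proof -
    have "2^2 \<le> pi^2" using pi_ge_two by (intro power_mono) auto
    then have "(cmod v)^2 * r1^2 * r2^2 * 4 \<le> (cmod v)^2 * r1^2 * r2^2 * pi^2"
      by (intro mult_left_mono) auto
    then have "(cmod v)^2 * r1^2 * r2^2 \<le> (cmod v)^2 / 4 * ((pi * r1^2) * (pi * r2^2))"
      by (simp add: power2_eq_square algebra_simps)
    then have "(cmod v)^2 * r1^2 * r2^2 * (cmod (f (u * v, v ^ k)))^2
       \<le> (cmod v)^2 / 4 * ((pi * r1^2) * (pi * r2^2)) * (cmod (f (u * v, v ^ k)))^2"
      by (rule mult_right_mono) simp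
    then show ?thesis
      by (simp add: ennreal_mult[symmetric] mult.assoc ennreal_leI)
  qed
  also have "\<dots> \<le> ennreal ((cmod v)^2 / 4) * (ennreal c * (\<integral>\<^sup>+w. H w \<partial>lborel))"
    by (rule mult_left_mono[OF *]) simp
  also have "\<dots> = (\<integral>\<^sup>+w. H w \<partial>lborel)"
    using v by (simp add: c_def mult.assoc[symmetric] ennreal_mult[symmetric])
  finally show ?thesis
    by (simp add: H_def)
qed

section \<open>Extension of the fibres over the puncture and the maximum principle\<close>

lemma normA2sq_lborel:
  "normA2sq k f = sq_mass lborel (Hk k) f"
  by (simp add: normA2sq_def nn_integral_completion)

lemma A2_holo2: "f \<in> A2 k \<Longrightarrow> holo2 f (Hk k)"
  by (simp add: A2_def)

text \<open>The slabs |w2| < 1/(n+1) shrink to nothing on H_k, so dominated convergence applies.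
  This smallness is what turns boundedness into a limit 0 at the puncture.\<close>

lemma A2_mass_near_zero:
  assumes f: "f \<in> A2 k"
  shows "(\<lambda>n. \<integral>\<^sup>+w. indicator (Hk k) w * indicator {w. cmod (snd w) < inverse (real (Suc n))} w *
      ennreal ((cmod (f w))^2) \<partial>lborel) \<longlonglongrightarrow> 0"
proof -
  define h where "h w = indicator (Hk k) w * ennreal ((cmod (f w))^2)" for w
  define X where "X n = {w::c2. cmod (snd w) < inverse (real (Suc n))}" for n
  have hm[measurable]: "h \<in> borel_measurable borel"
    unfolding h_def by (rule measurable_holo2_sq[OF A2_holo2[OF f]])
  have [measurable]: "X n \<in> sets borel" for n
    unfolding X_def by (intro borel_open open_Collect_less continuous_intros)
  have "(\<lambda>n. \<integral>\<^sup>+w. indicator (X n) w * h w \<partial>lborel) \<longlonglongrightarrow> (\<integral>\<^sup>+w. 0 \<partial>(lborel::c2 measure))"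
  proof (rule nn_integral_dominated_convergence[where w = h])
    show "(\<integral>\<^sup>+w. h w \<partial>lborel) < \<infinity>"
      using f by (simp add: A2_def normA2sq_lborel h_def)
    show "AE w in lborel. (\<lambda>n. indicator (X n) w * h w) \<longlonglongrightarrow> 0"
    proof (intro AE_I2 tendsto_eventually)
      fix w :: c2
      show "\<forall>\<^sub>F n in sequentially. indicator (X n) w * h w = 0"
      proof (cases "w \<in> Hk k")
        case True
        then have "cmod (snd w) > 0"
          by (auto simp: Hk_def)
        then have "\<forall>\<^sub>F n in sequentially. inverse (real (Suc n)) < cmod (snd w)"
          using LIMSEQ_inverse_real_of_nat by (metis order_tendstoD(2))
        then show ?thesis
          by eventually_elim (auto simp: X_def)
      qed (simp add: h_def)
    qed
    show "AE w in lborel. indicator (X n) w * h w \<le> h w" for n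
      by (rule AE_I2) (auto simp: indicator_def)
  qed auto
  moreover have "indicator (X n) w * h w = indicator (Hk k) w * indicator (X n) w * ennreal ((cmod (f w))^2)" for n w
    by (simp add: h_def mult_ac)
  ultimately show ?thesis
    by (simp add: X_def)
qed

lemma fibre_holomorphic:
  assumes f: "holo2 f (Hk k)" and k: "k > 0" and u: "cmod u < 1"
  shows "(\<lambda>\<eta>. \<eta> ^ k * f (u * \<eta>, \<eta> ^ k)) holomorphic_on ball 0 1 - {0}"
  using Hk_param[OF u _ _ k]
  by (intro holomorphic_intros holo2_compose[OF f]) auto

text \<open>Square integrability forces every fibre to extend over the puncture: the local mean value
  estimate on polydiscs of size \<open>\<bar>\<eta>\<bar> ^ k / 2\<close> loses only one power of \<open>\<eta>\<close>.\<close>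

lemma fibre_extension:
  assumes f: "f \<in> A2 k" and k: "k > 0" and u: "cmod u < 1"
  obtains g where "g holomorphic_on ball 0 1"
    "\<And>\<eta>. \<eta> \<noteq> 0 \<Longrightarrow> cmod \<eta> < 1 \<Longrightarrow> g \<eta> = \<eta> ^ k * f (u * \<eta>, \<eta> ^ k)"
proof -
  define F where "F \<eta> = \<eta> ^ k * f (u * \<eta>, \<eta> ^ k)" for \<eta>
  define d where "d = 1 - cmod u"
  have d: "d > 0" using u by (simp add: d_def)
  have "((\<lambda>\<eta>. (\<eta> - 0) * F \<eta>) \<longlongrightarrow> 0) (at 0)"
  proof (rule tendstoI)
    fix e :: real assume e: "e > 0"
    define I where "I n = (\<integral>\<^sup>+w. indicator (Hk k) w * indicator {w. cmod (snd w) < inverse (real (Suc n))} w *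
      ennreal ((cmod (f w))^2) \<partial>lborel)" for n
    have "I \<longlonglongrightarrow> 0"
      unfolding I_def by (rule A2_mass_near_zero[OF f])
    moreover have "0 < ennreal (d^2 * e^2 / 4)"
      using d e by simp
    \<comment> \<open>The threshold is the one for which the local estimate, with radii
      \<open>d\<close> and |\<eta>^k| / 2, reads |\<eta> F \<eta>| < e after cancelling d^2 /
      4.\<close>
    ultimately obtain n where n: "I n < ennreal (d^2 * e^2 / 4)"
      by (metis order_tendstoD(2) eventually_sequentially order_refl)
    \<comment> \<open>With |\<eta>^k| < 1/2 the radius |\<eta>^k| / 2 stays inside the unit disc;
      the second bound leaves room for |\<zeta>| to reach 3/2 |\<eta>^k| without leaving the
      slab.\<close>
    define b where "b = min (1/2) (inverse (real (Suc n)) / 2)"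
    have b: "b > 0" by (simp add: b_def)
    have "((\<lambda>\<eta>::complex. cmod \<eta> ^ k) \<longlongrightarrow> cmod 0 ^ k) (at 0)"
      by (intro tendsto_intros)
    then have "\<forall>\<^sub>F \<eta>::complex in at 0. cmod \<eta> ^ k < b"
      using order_tendstoD(2)[of "\<lambda>\<eta>::complex. cmod \<eta> ^ k" "cmod 0 ^ k" "at 0" b] b k
      by (simp add: zero_power)
    moreover have "\<forall>\<^sub>F \<eta>::complex in at 0. \<eta> \<noteq> 0"
      by (simp add: eventually_at_filter)
    ultimately show "\<forall>\<^sub>F \<eta> in at 0. dist ((\<eta> - 0) * F \<eta>) 0 < e"
    proof eventually_elim
      case (elim \<eta>)
      have k1: "cmod (\<eta> ^ k) < 1 / 2" "cmod (\<eta> ^ k) < inverse (real (Suc n)) / 2"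
        using elim by (auto simp: b_def norm_power)
      then have "cmod \<eta> ^ k < 1" by (simp add: norm_power)
      then have \<eta>1: "cmod \<eta> < 1"
        using k cmod_lt_one_power_iff by blast
      have "ennreal ((cmod \<eta>)^2 * d^2 * (cmod (\<eta> ^ k) / 2)^2) * ennreal ((cmod (f (u * \<eta>, \<eta> ^ k)))^2)
        \<le> I n"
        unfolding I_def
      proof (rule local_submean[OF A2_holo2[OF f] k u])
        show "indicator {w. cmod (snd w) < inverse (real (Suc n))} \<in> borel_measurable borel"
          by (intro borel_measurable_indicator borel_open open_Collect_less continuous_intros)
        fix u' \<zeta> :: complex
        assume "cmod (\<zeta> - \<eta> ^ k) < cmod (\<eta> ^ k) / 2"
        then have "cmod \<zeta> < inverse (real (Suc n))"
          using k1 norm_triangle_sub[of \<zeta> "\<eta> ^ k"] norm_ge_zero[of "\<eta> ^ k"] by linarith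
        then show "(1::ennreal) \<le> indicator {w::c2. cmod (snd w) < inverse (real (Suc n))} (u' * root_branch k \<eta> \<zeta>, \<zeta>)"
          by simp
      qed (use elim \<eta>1 d k1 in \<open>auto simp: d_def norm_power\<close>)
      also have "\<dots> < ennreal (d^2 * e^2 / 4)" by fact
      finally have "(cmod \<eta>)^2 * d^2 * (cmod (\<eta> ^ k) / 2)^2 * (cmod (f (u * \<eta>, \<eta> ^ k)))^2 < d^2 * e^2 / 4"
        by (simp add: ennreal_mult[symmetric] ennreal_less_iff)
      also have "(cmod \<eta>)^2 * d^2 * (cmod (\<eta> ^ k) / 2)^2 * (cmod (f (u * \<eta>, \<eta> ^ k)))^2
        = d^2 / 4 * (cmod (\<eta> * F \<eta>))^2"
        by (simp add: F_def norm_mult power_mult_distrib power_divide)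
      finally have "d^2 / 4 * (cmod (\<eta> * F \<eta>))^2 < d^2 / 4 * e^2"
        by simp
      then have "(cmod (\<eta> * F \<eta>))^2 < e^2"
        using d by simp
      then show ?case
        using e by (simp add: power_less_imp_less_base)
    qed
  qed
  \<comment> \<open>Riemann's removable singularity theorem asks for the limit 0 only after
    multiplication by \<eta>, so the lost power is affordable.\<close>
  then have "\<exists>g. g holomorphic_on ball 0 1 \<and> (\<forall>z\<in>ball 0 1 - {0}. g z = F z)"
    using fibre_holomorphic[OF A2_holo2[OF f] k u]
    by (subst holomorphic_on_extend_lim) (auto simp: F_def[abs_def])
  then show ?thesis
    using that by (auto simp: F_def)
qed

text \<open>The maximum principle for the extended fibre on the disc of radius
  \<open>\<kappa>\<close>. The point \<open>v0\<close> depends on \<open>f\<close> and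
  \<open>u\<close>, and nothing is known about its argument.\<close>

lemma fibre_max_modulus:
  assumes f: "f \<in> A2 k" and k: "k > 0" and u: "cmod u < 1"
    and v: "v \<noteq> 0" "cmod v < \<kappa>" and \<kappa>: "\<kappa> < 1"
  obtains v0 where "cmod v0 = \<kappa>"
    "cmod (v ^ k) * cmod (f (u * v, v ^ k)) \<le> cmod (v0 ^ k) * cmod (f (u * v0, v0 ^ k))"
proof -
  obtain g where g: "g holomorphic_on ball 0 1"
    and gF: "\<And>\<eta>. \<eta> \<noteq> 0 \<Longrightarrow> cmod \<eta> < 1 \<Longrightarrow> g \<eta> = \<eta> ^ k * f (u * \<eta>, \<eta> ^ k)"
    using fibre_extension[OF f k u] by blast
  have \<kappa>0: "\<kappa> > 0" using v by (meson norm_ge_zero le_less_trans)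
  have gc: "continuous_on (cball 0 \<kappa>) g"
    using g \<kappa> by (intro holomorphic_on_imp_continuous_on) (auto intro: holomorphic_on_subset)
  have "sphere (0::complex) \<kappa> \<noteq> {}"
    using \<kappa>0 by simp
  moreover have "continuous_on (sphere 0 \<kappa>) (\<lambda>z. cmod (g z))"
    using gc by (intro continuous_on_norm) (auto intro: continuous_on_subset)
  ultimately obtain v0 where v0: "v0 \<in> sphere 0 \<kappa>" "\<And>z. z \<in> sphere 0 \<kappa> \<Longrightarrow> cmod (g z) \<le> cmod (g v0)"
    using continuous_attains_sup[OF compact_sphere, of 0 \<kappa> "\<lambda>z. cmod (g z)"] by blast
  have "cmod (g v) \<le> cmod (g v0)"
  proof (rule maximum_modulus_frontier[where f = g and S = "cball 0 \<kappa>"])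
    show "g holomorphic_on interior (cball 0 \<kappa>)"
      using g \<kappa> by (auto intro: holomorphic_on_subset)
  qed (use gc v v0 \<kappa>0 in \<open>auto simp: frontier_cball\<close>)
  moreover have "v0 \<noteq> 0" "cmod v0 < 1"
    using v0 \<kappa> \<kappa>0 by auto
  ultimately show ?thesis
    using that[of v0] v0 gF[of v] gF[of v0] v \<kappa> by (simp add: norm_mult)
qed

text \<open>Unifies the two regimes: a point with |v| \<ge> \<kappa> is its own centre, any other is
  moved out to the circle of radius \<kappa>. Later estimates then only meet centres away from the
  corner.\<close>

lemma fibre_center:
  assumes f: "f \<in> A2 k" and k: "k > 0" and u: "cmod u < 1"
    and v: "v \<noteq> 0" "cmod v < 1" and \<kappa>: "0 < \<kappa>" "\<kappa> < 1"
  obtains v0 where "v0 \<noteq> 0" "\<kappa> \<le> cmod v0" "cmod v \<le> cmod v0" "cmod v0 < 1"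
    "v0 = v \<or> cmod v0 = \<kappa>"
    "cmod (v ^ k) * cmod (f (u * v, v ^ k)) \<le> cmod (v0 ^ k) * cmod (f (u * v0, v0 ^ k))"
proof (cases "cmod v < \<kappa>")
  case True
  obtain v0 where v0: "cmod v0 = \<kappa>"
    "cmod (v ^ k) * cmod (f (u * v, v ^ k)) \<le> cmod (v0 ^ k) * cmod (f (u * v0, v0 ^ k))"
    using fibre_max_modulus[OF f k u v(1) True \<kappa>(2)] .
  show ?thesis
    by (rule that[of v0]) (use v0 True \<kappa> in auto)
next
  case False
  show ?thesis
    by (rule that[of v]) (use False v in auto)
qed

section \<open>The kernels in fibre coordinates\<close>

text \<open>The numerator of the Bergman kernel divided by t. With s = x y and t = y^k one has s^k =
  x^k t, so t factors out and a polynomial without poles on the closed bidisc remains.\<close>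

definition kernel_num :: "nat \<Rightarrow> complex \<Rightarrow> complex \<Rightarrow> complex" where
  "kernel_num k x y = pk k (x * y) * (y ^ k + x ^ k) + qk k (x * y)"

lemma Pk_param:
  fixes u u' v v' :: complex
  assumes "v \<noteq> 0" "v' \<noteq> 0"
  defines "x \<equiv> u * cnj u'" and "y \<equiv> v * cnj v'"
  shows "Pk k (u * v, v ^ k) (u' * v', v' ^ k) = 1 / (y ^ k * (1 - y ^ k)^2 * (1 - x ^ k)^2)"
proof -
  have y0: "y \<noteq> 0" using assms by simp
  have s: "fst (u * v, v ^ k) * cnj (fst (u' * v', v' ^ k)) = x * y"
    and t: "snd (u * v, v ^ k) * cnj (snd (u' * v', v' ^ k)) = y ^ k"
    by (simp_all add: x_def y_def power_mult_distrib)
  have *: "y ^ k - (x * y) ^ k = y ^ k * (1 - x ^ k)"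
    by (simp add: power_mult_distrib algebra_simps)
  show ?thesis
    unfolding Pk_def Let_def s t * using y0 by (simp add: power_mult_distrib power2_eq_square)
qed

lemma Kb_Pk_param:
  fixes u u' v v' :: complex
  assumes "v \<noteq> 0" "v' \<noteq> 0"
  defines "x \<equiv> u * cnj u'" and "y \<equiv> v * cnj v'"
  shows "Kb k (u * v, v ^ k) (u' * v', v' ^ k) =
    Pk k (u * v, v ^ k) (u' * v', v' ^ k) * kernel_num k x y / (of_nat k * of_real (pi^2))"
proof -
  have s: "fst (u * v, v ^ k) * cnj (fst (u' * v', v' ^ k)) = x * y"
    and t: "snd (u * v, v ^ k) * cnj (snd (u' * v', v' ^ k)) = y ^ k"
    by (simp_all add: x_def y_def power_mult_distrib)
  have *: "pk k (x * y) * (y ^ k)^2 + qk k (x * y) * y ^ k + (x * y) ^ k * pk k (x * y)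
     = y ^ k * kernel_num k x y"
    by (simp add: kernel_num_def power_mult_distrib power2_eq_square algebra_simps)
  show ?thesis
    unfolding Kb_def Pk_def Let_def s t * by (simp add: mult_ac)
qed

lemma continuous_on_kernel_num: "continuous_on S (\<lambda>p. kernel_num k (fst p) (snd p))"
  unfolding kernel_num_def pk_def qk_def by (intro continuous_intros)

lemma kernel_num_bounded:
  obtains M where "M \<ge> 1" "\<And>x y. cmod x \<le> 1 \<Longrightarrow> cmod y \<le> 1 \<Longrightarrow> cmod (kernel_num k x y) \<le> M"
proof -
  have "compact ((\<lambda>p. kernel_num k (fst p) (snd p)) ` (cball 0 1 \<times> cball 0 1))"
    by (intro compact_continuous_image continuous_on_kernel_num compact_Times compact_cball)
  then obtain M where M: "\<forall>w\<in>(\<lambda>p. kernel_num k (fst p) (snd p)) ` (cball 0 1 \<times> cball 0 1). cmod w \<le> M"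
    using compact_imp_bounded bounded_iff by blast
  show ?thesis
  proof (rule that[of "max M 1"])
    fix x y :: complex assume "cmod x \<le> 1" "cmod y \<le> 1"
    then have "(x, y) \<in> cball 0 1 \<times> cball 0 1" by auto
    then show "cmod (kernel_num k x y) \<le> max M 1"
      using M by (metis (no_types, lifting) fst_conv image_eqI max.coboundedI1 snd_conv)
  qed simp
qed

text \<open>All coefficients are nonnegative, and the summand j = 1 of \<open>qk\<close> contributes
  the constant 1.\<close>

lemma kernel_num_real:
  assumes k: "k > 0" and ab: "a \<ge> 0" "b \<ge> 0"
  obtains R where "R \<ge> 1" "kernel_num k (of_real a) (of_real b) = of_real R"
proof -
  define s where "s = a * b"
  have s: "s \<ge> 0" using ab by (simp add: s_def)
  define p where "p = (\<Sum>j=1..k-1. real (j * (k - j)) * s ^ (j - 1))"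
  define q where "q = (\<Sum>j=1..k. (real (j^2) + real ((k - j)^2) * s ^ k) * s ^ (j - 1))"
  have p0: "p \<ge> 0"
    unfolding p_def using s by (intro sum_nonneg) auto
  have "1 \<le> real (1^2) + real ((k - 1)^2) * s ^ k"
    using s by simp
  also have "\<dots> = (real (1^2) + real ((k - 1)^2) * s ^ k) * s ^ (1 - 1)"
    by simp
  also have "\<dots> \<le> q"
    unfolding q_def using k s
    by (intro member_le_sum[where f = "\<lambda>j. (real (j^2) + real ((k - j)^2) * s ^ k) * s ^ (j - 1)"]) auto
  finally have q1: "q \<ge> 1" .
  have "kernel_num k (of_real a) (of_real b) = of_real (p * (b ^ k + a ^ k) + q)"
    unfolding kernel_num_def pk_def qk_def p_def q_def s_def by simp
  moreover have "p * (b ^ k + a ^ k) + q \<ge> 1"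
    using p0 q1 ab by (smt (verit) mult_nonneg_nonneg zero_le_power add_nonneg_nonneg)
  ultimately show ?thesis using that by blast
qed

text \<open>Uniform continuity on the closed bidisc spreads the lower bound to a neighbourhood of
  fixed size around all real points, including those with \<open>b = 0\<close>, which serve the
  corner.\<close>

lemma kernel_num_near_real:
  assumes k: "k > 0"
  obtains \<delta> where "\<delta> > 0" "\<And>x y a b. cmod x \<le> 1 \<Longrightarrow> cmod y \<le> 1 \<Longrightarrow> 0 \<le> a \<Longrightarrow> a \<le> 1 \<Longrightarrow> 0 \<le> b \<Longrightarrow> b \<le> 1 \<Longrightarrow>
     cmod (x - of_real a) < \<delta> \<Longrightarrow> cmod (y - of_real b) < \<delta> \<Longrightarrow> 1 / 2 \<le> cmod (kernel_num k x y)"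
proof -
  let ?N = "\<lambda>p. kernel_num k (fst p) (snd p)" and ?S = "cball (0::complex) 1 \<times> cball (0::complex) 1"
  have "uniformly_continuous_on ?S ?N"
    by (intro compact_uniformly_continuous continuous_on_kernel_num compact_Times compact_cball)
  then obtain d where d: "d > 0" "\<And>p q. p \<in> ?S \<Longrightarrow> q \<in> ?S \<Longrightarrow> dist q p < d \<Longrightarrow> dist (?N q) (?N p) < 1 / 2"
    unfolding uniformly_continuous_on_def by (metis half_gt_zero zero_less_one)
  show ?thesis
  proof (rule that[of "d / 2"])
    fix x y :: complex and a b :: real
    assume h: "cmod x \<le> 1" "cmod y \<le> 1" "0 \<le> a" "a \<le> 1" "0 \<le> b" "b \<le> 1"
      "cmod (x - of_real a) < d / 2" "cmod (y - of_real b) < d / 2"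
    obtain R where R: "R \<ge> 1" "kernel_num k (of_real a) (of_real b) = of_real R"
      using kernel_num_real[OF k h(3) h(5)] .
    have "dist (x, y) (of_real a, of_real b) \<le> cmod (x - of_real a) + cmod (y - of_real b)"
      using sqrt_sum_squares_le_sum_abs[of "dist x (of_real a)" "dist y (of_real b)"]
      unfolding dist_Pair_Pair by (simp add: dist_norm)
    then have "dist (x, y) (of_real a, of_real b) < d" using h by simp
    then have "dist (kernel_num k x y) (of_real R) < 1 / 2"
      using d(2)[of "(of_real a, of_real b)" "(x, y)"] h R by simp
    then show "1 / 2 \<le> cmod (kernel_num k x y)"
      using R norm_triangle_ineq2[of "of_real R" "kernel_num k x y"]
      by (simp add: dist_norm norm_minus_commute)
  qed (use d in simp)
qed

text \<open>On the diagonal both fibre variables become squared moduli, so the positivity of the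
  numerator at real points applies.\<close>

lemma Kb_diag:
  assumes k: "k > 0" and v: "v \<noteq> 0"
  obtains R where "R \<ge> 1" "kernel_num k (of_real ((cmod u)^2)) (of_real ((cmod v)^2)) = of_real R"
    "Re (Kb k (u * v, v ^ k) (u * v, v ^ k)) =
      R / (real k * pi^2 * (cmod (v ^ k))^2 * (1 - (cmod (v ^ k))^2)^2 * (1 - (cmod u ^ k)^2)^2)"
proof -
  obtain R where R: "R \<ge> 1" "kernel_num k (of_real ((cmod u)^2)) (of_real ((cmod v)^2)) = of_real R"
    using kernel_num_real[OF k, of "(cmod u)^2" "(cmod v)^2"] by auto
  have sq: "w * cnj w = complex_of_real ((cmod w)^2)" for w
    by (rule complex_norm_square[symmetric])
  have pw: "complex_of_real ((cmod w)^2) ^ k = complex_of_real ((cmod w ^ k)^2)" for w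
    by (simp add: power_mult[symmetric] mult.commute)
  have "Kb k (u * v, v ^ k) (u * v, v ^ k) =
     of_real (R / (real k * pi^2 * (cmod (v ^ k))^2 * (1 - (cmod (v ^ k))^2)^2 * (1 - (cmod u ^ k)^2)^2))"
    unfolding Kb_Pk_param[OF v v] Pk_param[OF v v] sq pw R(2)
    by (simp add: norm_power)
  then show ?thesis
    using that R by simp
qed

text \<open>This kernel is read in two ways: integrated in \<open>z\<close> against \<mu> it is the
  Berezin transform, integrated in \<open>w\<close> against |f|^2 it dominates |f(z)|^2. Tonelli
  connects the two.\<close>

definition berezin_density :: "nat \<Rightarrow> c2 \<Rightarrow> c2 \<Rightarrow> real" where
  "berezin_density k z w = (cmod (Kb k z w))^2 / Re (Kb k w w)"

text \<open>The points close to the boundary, disregarding the corner at the origin.\<close>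

definition tail :: "nat \<Rightarrow> real \<Rightarrow> c2 set" where
  "tail k \<rho> = {z \<in> Hk k. 1 - cmod (snd z) \<le> \<rho> \<or> 1 - cmod (fst z) ^ k / cmod (snd z) \<le> \<rho>}"

lemma fst_param_ratio: "v \<noteq> 0 \<Longrightarrow> cmod (u * v) ^ k / cmod (v ^ k) = cmod u ^ k"
  by (simp add: norm_mult norm_power power_mult_distrib)

section \<open>Lower bounds for the Berezin density on mean value regions\<close>

lemma norm_one_diff_power_le:
  fixes x :: complex
  assumes "cmod x \<le> 1"
  shows "cmod (1 - x ^ k) \<le> real k * cmod (1 - x)"
proof -
  have "cmod (\<Sum>i<k. x ^ i) \<le> (\<Sum>i<k. 1)"
    using assms by (intro sum_norm_le) (auto simp: norm_power power_le_one)
  then have "cmod (1 - x) * cmod (\<Sum>i<k. x ^ i) \<le> cmod (1 - x) * real k"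
    by (intro mult_left_mono) auto
  then show ?thesis
    by (subst one_diff_power_eq) (simp add: norm_mult mult.commute)
qed

text \<open>The arithmetic of the next estimate in isolation. \<open>p\<close> and \<open>q\<close>
  are the boundary distances of w, \<open>P\<close> and \<open>Q\<close> the factors of K(w,w),
  \<open>a\<close> and \<open>b\<close> those of K(z,w). The former enter squared, the latter to the
  fourth power, so comparability leaves inverse squares of \<open>p\<close> and
  \<open>q\<close>.\<close>

lemma ratio_lower:
  fixes n :: real
  assumes "n \<ge> 1 / 2" "0 < R" "R \<le> M" "0 < p" "0 < q" "p \<le> P" "q \<le> Q" "0 < T" "0 < c"
    "0 < a" "a \<le> A * p" "0 < b" "b \<le> B * q"
  shows "1 / (4 * M * c * A ^ 4 * B ^ 4 * (T^2 * p^2 * q^2)) \<le> n^2 * P^2 * Q^2 / (R * c * T^2 * a ^ 4 * b ^ 4)"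
proof -
  have AB: "A > 0" "B > 0"
    using assms by (smt (verit) mult_nonpos_nonneg)+
  have "(1 / 4) * p^2 * q^2 \<le> n^2 * P^2 * Q^2"
  proof (intro mult_mono power_mono)
    have "(1 / 2)^2 \<le> n^2" using assms by (intro power_mono) auto
    then show "1 / 4 \<le> n^2" by (simp add: power2_eq_square)
  qed (use assms in auto)
  moreover have "R * c * T^2 * a ^ 4 * b ^ 4 \<le> M * c * T^2 * (A * p) ^ 4 * (B * q) ^ 4"
    using assms by (intro mult_mono power_mono) auto
  ultimately have "(1 / 4) * p^2 * q^2 / (M * c * T^2 * (A * p) ^ 4 * (B * q) ^ 4)
     \<le> n^2 * P^2 * Q^2 / (R * c * T^2 * a ^ 4 * b ^ 4)"
    using assms by (intro frac_le) auto
  also have "(1 / 4) * p^2 * q^2 / (M * c * T^2 * (A * p) ^ 4 * (B * q) ^ 4)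
     = 1 / (4 * M * c * A ^ 4 * B ^ 4 * (T^2 * p^2 * q^2))"
    using assms AB by (simp add: field_simps power_mult_distrib)
  finally show ?thesis .
qed

text \<open>The hypotheses \<open>t\<close> and \<open>s\<close> say that the off-diagonal factors
  are no larger than the boundary distances of the second point. The power of |v'^k| in |K(z,w)|^2
  cancels against the one in K(w,w), so only |v^k|^2 survives, matching the factor lost when a point
  is slid along its fibre.\<close>

lemma berezin_density_lower:
  assumes k: "k > 0" and u: "cmod u < 1" "cmod u' < 1"
    and v: "v \<noteq> 0" "cmod v < 1" and v': "v' \<noteq> 0" "cmod v' < 1"
    and N: "1 / 2 \<le> cmod (kernel_num k (u * cnj u') (v * cnj v'))"
    and M: "\<And>x y. cmod x \<le> 1 \<Longrightarrow> cmod y \<le> 1 \<Longrightarrow> cmod (kernel_num k x y) \<le> M"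
    and t: "cmod (1 - (v * cnj v') ^ k) \<le> 6 * (1 - cmod (v' ^ k))"
    and s: "cmod (1 - u * cnj u') \<le> 6 * (1 - cmod u')"
  shows "1 / (4 * M * (real k * pi^2) * 6 ^ 4 * (6 * real k) ^ 4 *
       ((cmod (v ^ k))^2 * (1 - cmod (v' ^ k))^2 * (1 - cmod u')^2))
     \<le> berezin_density k (u * v, v ^ k) (u' * v', v' ^ k)"
proof -
  define x y where "x = u * cnj u'" and "y = v * cnj v'"
  define n where "n = cmod (kernel_num k x y)"
  define T T' where "T = cmod (v ^ k)" and "T' = cmod (v' ^ k)"
  define a b where "a = cmod (1 - y ^ k)" and "b = cmod (1 - x ^ k)"
  obtain R where R: "R \<ge> 1" "kernel_num k (of_real ((cmod u')^2)) (of_real ((cmod v')^2)) = of_real R"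
    "Re (Kb k (u' * v', v' ^ k) (u' * v', v' ^ k)) =
      R / (real k * pi^2 * T'^2 * (1 - T'^2)^2 * (1 - (cmod u' ^ k)^2)^2)"
    unfolding T'_def using Kb_diag[OF k v'(1)] by metis
  have "cmod (complex_of_real R) \<le> M"
    unfolding R(2)[symmetric] using u v' by (intro M) (auto simp: norm_power power_le_one)
  then have RM: "R \<le> M" using R(1) by simp
  have x1: "cmod x < 1" and y1: "cmod y < 1"
    using mult_strict_mono'[of "cmod u" 1 "cmod u'" 1] mult_strict_mono'[of "cmod v" 1 "cmod v'" 1] u v v'
    by (auto simp: x_def y_def norm_mult)
  have pos: "0 < a" "0 < b"
  proof -
    have "cmod y ^ k < 1" "cmod x ^ k < 1"
      using x1 y1 k by (auto simp: cmod_lt_one_power_iff)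
    then have "y ^ k \<noteq> 1" "x ^ k \<noteq> 1"
      by (metis norm_one norm_power less_irrefl)+
    then show "0 < a" "0 < b" by (auto simp: a_def b_def)
  qed
  have T: "0 < T" "0 < T'" "T' < 1"
    using v v' k by (auto simp: T_def T'_def norm_power cmod_lt_one_power_iff)
  have g: "0 \<le> cmod u' ^ k" "cmod u' ^ k \<le> cmod u'" "cmod u' ^ k < 1"
    using u k power_decreasing[of 1 k "cmod u'"] by auto
  have P: "1 - T' \<le> 1 - T'^2"
    using T by (simp add: power2_eq_square mult_left_le)
  have Q: "1 - cmod u' \<le> 1 - (cmod u' ^ k)^2"
  proof -
    have "(cmod u' ^ k)^2 \<le> cmod u' ^ k"
      using g by (simp add: power2_eq_square mult_left_le)
    then show ?thesis using g by linarith
  qed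
  have bb: "b \<le> (6 * real k) * (1 - cmod u')"
  proof -
    have "b \<le> real k * cmod (1 - x)"
      unfolding b_def by (rule norm_one_diff_power_le) (use x1 in simp)
    also have "\<dots> \<le> real k * (6 * (1 - cmod u'))"
      using s by (intro mult_left_mono) (auto simp: x_def)
    finally show ?thesis by (simp add: mult_ac)
  qed
  have Y: "cmod y ^ k = T * T'"
    by (simp add: y_def T_def T'_def norm_mult norm_power power_mult_distrib)
  have "cmod (Kb k (u * v, v ^ k) (u' * v', v' ^ k)) = n / (T * T' * a^2 * b^2 * (real k * pi^2))"
    unfolding Kb_Pk_param[OF v(1) v'(1)] Pk_param[OF v(1) v'(1)] x_def[symmetric] y_def[symmetric]
    by (simp add: norm_mult norm_divide norm_power Y n_def a_def b_def)
  then have "berezin_density k (u * v, v ^ k) (u' * v', v' ^ k)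
    = (n / (T * T' * a^2 * b^2 * (real k * pi^2)))^2 /
      (R / (real k * pi^2 * T'^2 * (1 - T'^2)^2 * (1 - (cmod u' ^ k)^2)^2))"
    by (simp add: berezin_density_def R(3))
  also have "\<dots> = n^2 * (1 - T'^2)^2 * (1 - (cmod u' ^ k)^2)^2 / (R * (real k * pi^2) * T^2 * a ^ 4 * b ^ 4)"
  proof -
    have "(n / (T * T' * a^2 * b^2 * d))^2 / (R / (d * T'^2 * p * q)) = n^2 * p * q / (R * d * T^2 * a ^ 4 * b ^ 4)"
      if "d > 0" for p q d :: real
      using that T pos R(1) by (simp add: power_divide power_mult_distrib field_simps) (simp add: power2_eq_square power4_eq_xxxx)
    from this[of "real k * pi^2"] show ?thesis using k by simp
  qed
  also have "\<dots> \<ge> 1 / (4 * M * (real k * pi^2) * 6 ^ 4 * (6 * real k) ^ 4 * (T^2 * (1 - T')^2 * (1 - cmod u')^2))"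
    by (rule ratio_lower) (use N R RM T u P Q k pos t bb in \<open>auto simp: n_def x_def y_def a_def T'_def\<close>)
  finally show ?thesis
    by (simp add: T_def T'_def)
qed

text \<open>In the u-direction x stays near |u|^2. In the v-direction there are two reasons for y to
  be near a real point: if \<open>v0 = v\<close>, it is close to |v|^2; if |v0| = \<kappa>, it is
  close to 0 for every argument of \<open>v0\<close> and every smaller \<open>v\<close>. Either way
  the numerator cannot vanish.\<close>

lemma berezin_region:
  assumes k: "k > 0"
  obtains \<kappa> r C where "0 < \<kappa>" "\<kappa> \<le> 1 / 4" "0 < r" "r \<le> 1 / 2" "r \<le> \<kappa> ^ k / 2" "C > 0"
    "\<And>u v v0 u' \<zeta>. cmod u < 1 \<Longrightarrow> v \<noteq> 0 \<Longrightarrow> v0 \<noteq> 0 \<Longrightarrow> \<kappa> \<le> cmod v0 \<Longrightarrow> cmod v0 < 1 \<Longrightarrow>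
       cmod v \<le> cmod v0 \<Longrightarrow> v0 = v \<or> cmod v0 = \<kappa> \<Longrightarrow>
       cmod (u' - u) < r * (1 - cmod u) \<Longrightarrow> cmod (\<zeta> - v0 ^ k) < r * (1 - cmod (v0 ^ k)) \<Longrightarrow>
       1 \<le> C * ((cmod (v ^ k))^2 * (1 - cmod (v0 ^ k))^2 * (1 - cmod u)^2) *
           berezin_density k (u * v, v ^ k) (u' * root_branch k v0 \<zeta>, \<zeta>) \<and>
       cmod u' < 1 \<and> cmod \<zeta> < 1 \<and> \<kappa> ^ k / 2 \<le> cmod \<zeta> \<and> 1 - cmod \<zeta> \<le> 2 * (1 - cmod (v0 ^ k)) \<and>
       1 - cmod u' \<le> 2 * (1 - cmod u) \<and> root_branch k v0 \<zeta> ^ k = \<zeta> \<and> root_branch k v0 \<zeta> \<noteq> 0"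
proof -
  obtain M where M: "M \<ge> 1" "\<And>x y. cmod x \<le> 1 \<Longrightarrow> cmod y \<le> 1 \<Longrightarrow> cmod (kernel_num k x y) \<le> M"
    using kernel_num_bounded[of k] by blast
  obtain \<delta> where \<delta>: "\<delta> > 0" and near: "\<And>x y a b. cmod x \<le> 1 \<Longrightarrow> cmod y \<le> 1 \<Longrightarrow> 0 \<le> a \<Longrightarrow> a \<le> 1 \<Longrightarrow>
      0 \<le> b \<Longrightarrow> b \<le> 1 \<Longrightarrow> cmod (x - of_real a) < \<delta> \<Longrightarrow> cmod (y - of_real b) < \<delta> \<Longrightarrow>
      1 / 2 \<le> cmod (kernel_num k x y)"
    using kernel_num_near_real[OF k] by metis
  \<comment> \<open>The branch depends on \<zeta> / v0^k only, so continuity of the root at the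
    single point 1 serves all centres.\<close>
  have "isCont (\<lambda>\<zeta>. exp (Ln \<zeta> / of_nat k)) (1::complex)"
    using k by (intro continuous_intros) auto
  then obtain d where d: "d > 0" "\<And>\<zeta>. cmod (\<zeta> - 1) < d \<Longrightarrow> cmod (exp (Ln \<zeta> / of_nat k) - 1) < \<delta>"
    using \<delta> unfolding continuous_at_eps_delta by (auto simp: dist_norm)
  \<comment> \<open>On the circle case |y| \<le> |v'| \<le> 2 \<kappa>, which must stay below
    \<delta>; the bound 1/4 keeps \<zeta> at distance at least 1/2 from the unit circle.\<close>
  define \<kappa> where "\<kappa> = min (1 / 4) (\<delta> / 4)"
  have \<kappa>: "0 < \<kappa>" "\<kappa> \<le> 1 / 4" "2 * \<kappa> < \<delta>" "2 * \<kappa> \<le> 1"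
    using \<delta> by (auto simp: \<kappa>_def)
  have \<kappa>k: "0 < \<kappa> ^ k" "\<kappa> ^ k \<le> 1 / 4"
  proof -
    have "\<kappa> ^ k \<le> \<kappa> ^ 1" using \<kappa> k by (intro power_decreasing) auto
    then show "0 < \<kappa> ^ k" "\<kappa> ^ k \<le> 1 / 4" using \<kappa> by auto
  qed
  \<comment> \<open>The first bound keeps |\<zeta>| \<ge> \<kappa>^k / 2 and the root branch
    defined, the second controls x, and the third puts \<zeta> / v0^k within \<open>d\<close> of
    1.\<close>
  define r where "r = min (\<kappa> ^ k / 2) (min (\<delta> / 2) (d * \<kappa> ^ k))"
  have r: "0 < r" "r \<le> 1 / 2" "r \<le> \<kappa> ^ k / 2" "r < \<delta>" "r \<le> d * \<kappa> ^ k"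
    using \<delta> d \<kappa>k by (auto simp: r_def)
  define C0 where "C0 = 4 * M * (real k * pi^2) * 6 ^ 4 * (6 * real k) ^ 4"
  have C0: "C0 > 0" using M k by (simp add: C0_def)
  show ?thesis
  proof (rule that[of \<kappa> r "C0 * 16"], goal_cases)
    case (7 u v v0 u' \<zeta>)
    note u = 7(1) and v = 7(2) and v0 = 7(3-7) and u' = 7(8) and \<zeta> = 7(9)
    define v' where "v' = root_branch k v0 \<zeta>"
    define e where "e = cmod (v0 ^ k)"
    have e: "\<kappa> ^ k \<le> e" "e < 1" "0 < e"
      using v0 \<kappa> k by (auto simp: e_def norm_power power_mono cmod_lt_one_power_iff)
    have v1: "cmod v < 1" using v0 by argo
    have ru: "r * (1 - cmod u) \<le> (1/2) * (1 - cmod u)" "r * (1 - cmod u) \<le> r * 1"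
      using r u by (auto intro!: mult_right_mono mult_left_mono)
    have u'h: "cmod (u' - u) * 2 < 1 - cmod u" "cmod (u' - u) < r"
      using less_le_trans[OF u' ru(1)] less_le_trans[OF u' ru(2)] by auto
    have re: "r * (1 - e) \<le> (1/2) * (1 - e)" "r * (1 - e) \<le> r * 1"
      using r e by (auto intro!: mult_right_mono mult_left_mono)
    have \<zeta>': "cmod (\<zeta> - v0 ^ k) * 2 < 1 - e" "cmod (\<zeta> - v0 ^ k) < r"
      using \<zeta> re by (auto simp: e_def)
    have \<zeta>e: "cmod \<zeta> - e \<le> cmod (\<zeta> - v0 ^ k)" "e - cmod \<zeta> \<le> cmod (\<zeta> - v0 ^ k)"
      unfolding e_def by (metis norm_triangle_ineq2 norm_minus_commute)+
    have u'u: "cmod u' - cmod u \<le> cmod (u' - u)" "cmod u - cmod u' \<le> cmod (u' - u)"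
      by (metis norm_triangle_ineq2 norm_minus_commute)+
    have u'1: "cmod u' < 1" "1 - cmod u' \<le> 2 * (1 - cmod u)" "1 - cmod u \<le> 2 * (1 - cmod u')"
      using u'u u'h u by - argo+
    have \<zeta>1: "cmod \<zeta> < 1" "1 - cmod \<zeta> \<le> 2 * (1 - e)" "1 - e \<le> 2 * (1 - cmod \<zeta>)" "\<kappa> ^ k / 2 \<le> cmod \<zeta>"
      "cmod (\<zeta> - v0 ^ k) < e"
      using \<zeta>e \<zeta>' e r \<kappa>k by - argo+
    have v'k: "v' ^ k = \<zeta>" "v' \<noteq> 0"
      using root_branch_power[OF k v0(1), of \<zeta>] \<zeta>1(5) by (auto simp: v'_def e_def)
    have v'n: "cmod v' ^ k = cmod \<zeta>"
      using v'k by (simp add: norm_power[symmetric])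
    have v'1: "cmod v' < 1"
      using v'n \<zeta>1 k cmod_lt_one_power_iff by metis
    define x y where "x = u * cnj u'" and "y = v * cnj v'"
    have x1: "cmod x \<le> 1" and y1: "cmod y \<le> 1"
      using mult_mono[of "cmod u" 1 "cmod u'" 1] mult_mono[of "cmod v" 1 "cmod v'" 1] u u'1 v1 v'1
      by (auto simp: x_def y_def norm_mult)
    have sqn: "complex_of_real ((cmod w)^2) = w * cnj w" for w
      by (rule complex_norm_square)
    have xu: "cmod (x - of_real ((cmod u)^2)) \<le> cmod (u' - u)"
    proof -
      have "x - of_real ((cmod u)^2) = u * cnj (u' - u)"
        by (simp only: x_def sqn complex_cnj_diff right_diff_distrib)
      then have "cmod (x - of_real ((cmod u)^2)) = cmod u * cmod (u' - u)"
        by (metis complex_mod_cnj norm_mult)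
      then show ?thesis using u by (simp add: mult_left_le_one_le)
    qed
    have one_sq: "cmod (1 - of_real (a^2)) \<le> 2 * (1 - a)" if "0 \<le> a" "a < 1" for a
    proof -
      have "1 - complex_of_real (a^2) = of_real (1 - a^2)" by simp
      then have "cmod (1 - of_real (a^2)) = \<bar>1 - a^2\<bar>"
        by (metis norm_of_real)
      also have "\<dots> = (1 - a) * (1 + a)"
        using that by (simp add: abs_square_le_1 abs_if power2_eq_square algebra_simps) (smt (verit) mult_le_one)
      also have "\<dots> \<le> (1 - a) * 2"
        using that by (intro mult_left_mono) auto
      finally show ?thesis by simp
    qed
    \<comment> \<open>The constant: 2 + 1 multiples of 1 - |u|, each at most twice 1 - |u'|.\<close>
    have s: "cmod (1 - x) \<le> 6 * (1 - cmod u')"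
    proof -
      have "cmod (1 - x) \<le> cmod (1 - of_real ((cmod u)^2)) + cmod (x - of_real ((cmod u)^2))"
        using norm_triangle_ineq4[of "1 - of_real ((cmod u)^2)" "x - of_real ((cmod u)^2)"] by simp
      also have "\<dots> \<le> 2 * (1 - cmod u) + (1 - cmod u)"
        using one_sq[of "cmod u"] xu u'h u by simp
      finally show ?thesis using u'1 by argo
    qed
    have yk: "y ^ k = v ^ k * cnj \<zeta>"
      by (simp add: y_def power_mult_distrib v'k flip: complex_cnj_power)
    have yN: "cmod (1 - y ^ k) \<le> 6 * (1 - cmod \<zeta>) \<and> (\<exists>b. 0 \<le> b \<and> b \<le> 1 \<and> cmod (y - of_real b) < \<delta>)"
      using v0(5)
    proof
      assume eq: "v0 = v"
      have "cmod (v ^ k * cnj \<zeta> - of_real (e^2)) \<le> cmod (\<zeta> - v0 ^ k)"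
      proof -
        have "v ^ k * cnj \<zeta> - of_real (e^2) = v ^ k * cnj (\<zeta> - v0 ^ k)"
          by (simp only: e_def sqn eq complex_cnj_diff right_diff_distrib)
        then have "cmod (v ^ k * cnj \<zeta> - of_real (e^2)) = e * cmod (\<zeta> - v0 ^ k)"
          by (metis complex_mod_cnj norm_mult eq e_def)
        then show ?thesis using e by (simp add: mult_left_le_one_le)
      qed
      then have "cmod (1 - y ^ k) \<le> 2 * (1 - e) + (1 - e)"
        using norm_triangle_ineq4[of "1 - of_real (e^2)" "y ^ k - of_real (e^2)"] one_sq[of e] e \<zeta>'
        by (simp add: yk)
      then have 1: "cmod (1 - y ^ k) \<le> 6 * (1 - cmod \<zeta>)"
        using \<zeta>1 by argo
      have "cmod (\<zeta> / v0 ^ k - 1) = cmod (\<zeta> - v0 ^ k) / e"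
        using e v0 by (simp add: e_def norm_divide[symmetric] diff_divide_distrib)
      also have "\<dots> < r / e"
        using \<zeta>' e by (intro divide_strict_right_mono) auto
      also have "\<dots> \<le> d * e / e"
      proof (intro divide_right_mono)
        have "d * \<kappa> ^ k \<le> d * e" using d e by (intro mult_left_mono) auto
        then show "r \<le> d * e" using r by argo
      qed (use e in simp)
      finally have "cmod (\<zeta> / v0 ^ k - 1) < d" using e by simp
      then have "cmod (exp (Ln (\<zeta> / v0 ^ k) / of_nat k) - 1) < \<delta>"
        by (rule d(2))
      moreover have "cmod (v' - v0) = cmod v0 * cmod (exp (Ln (\<zeta> / v0 ^ k) / of_nat k) - 1)"
        by (simp add: v'_def root_branch_def norm_mult[symmetric] algebra_simps)
      moreover have "\<dots> \<le> cmod (exp (Ln (\<zeta> / v0 ^ k) / of_nat k) - 1)"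
        using v0 by (simp add: mult_left_le_one_le)
      ultimately have vd: "cmod (v' - v) < \<delta>" using eq by simp
      have "y - of_real ((cmod v)^2) = v * cnj (v' - v)"
        by (simp only: y_def sqn complex_cnj_diff right_diff_distrib)
      then have "cmod (y - of_real ((cmod v)^2)) = cmod v * cmod (v' - v)"
        by (metis complex_mod_cnj norm_mult)
      also have "\<dots> \<le> cmod (v' - v)" using v1 by (simp add: mult_left_le_one_le)
      also have "\<dots> < \<delta>" by (rule vd)
      finally show ?thesis
        using 1 v1 by (intro conjI exI[of _ "(cmod v)^2"]) (auto simp: abs_square_le_1)
    next
      \<comment> \<open>The boundary is far away here, so the comparability condition is trivial (2
        against 6 times 1/2), and the real point is 0.\<close>
      assume eq: "cmod v0 = \<kappa>"
      have ek: "e = \<kappa> ^ k" by (simp add: e_def norm_power eq)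
      have "cmod \<zeta> \<le> 2 * \<kappa> ^ k"
        using \<zeta>e \<zeta>' r ek by argo
      also have "\<dots> \<le> 2 ^ k * \<kappa> ^ k"
        using k \<kappa>k power_increasing[of 1 k "2::real"] by (intro mult_right_mono) auto
      finally have "cmod v' ^ k \<le> (2 * \<kappa>) ^ k"
        by (simp add: v'n power_mult_distrib)
      then have "cmod v' \<le> 2 * \<kappa>"
        using k \<kappa> power_mono_iff[of "cmod v'" "2 * \<kappa>" k] by simp
      then have "cmod y < \<delta>"
        using \<kappa> v1 mult_left_le_one_le[of "cmod v'" "cmod v"] by (simp add: y_def norm_mult)
      moreover have "cmod (1 - y ^ k) \<le> 2"
        using norm_triangle_ineq4[of 1 "y ^ k"] y1 power_le_one[of "cmod y" k] by (simp add: norm_power)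
      moreover have "1 - cmod \<zeta> \<ge> 1 / 2"
        using \<zeta>e \<zeta>' r ek \<kappa>k by argo
      ultimately show ?thesis
        by (intro conjI exI[of _ 0]) auto
    qed
    then obtain b where b: "0 \<le> b" "b \<le> 1" "cmod (y - of_real b) < \<delta>" by blast
    have N: "1 / 2 \<le> cmod (kernel_num k x y)"
      by (rule near[OF x1 y1 _ _ b(1,2) _ b(3), of "(cmod u)^2"])
         (use u xu u'h r in \<open>auto simp: abs_square_le_1\<close>)
    have low: "1 / (C0 * ((cmod (v ^ k))^2 * (1 - cmod \<zeta>)^2 * (1 - cmod u')^2))
       \<le> berezin_density k (u * v, v ^ k) (u' * v', \<zeta>)"
      using berezin_density_lower[OF k u u'1(1) v v1 v'k(2) v'1 _ M(2)] N s yN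
      by (simp add: x_def y_def v'k C0_def)
    have vk: "0 < (cmod (v ^ k))^2" using v by simp
    \<comment> \<open>Replacing the distances of the variable point by those of the centre costs 2
      in each direction; squared, this is the 16 in the final constant.\<close>
    have "(cmod (v ^ k))^2 * (1 - cmod \<zeta>)^2 * (1 - cmod u')^2 \<le>
        (cmod (v ^ k))^2 * (2 * (1 - e))^2 * (2 * (1 - cmod u))^2"
      using u'1 \<zeta>1 by (intro mult_mono power_mono) auto
    also have "\<dots> = 16 * ((cmod (v ^ k))^2 * (1 - e)^2 * (1 - cmod u)^2)"
      unfolding power_mult_distrib by simp
    finally have le: "(cmod (v ^ k))^2 * (1 - cmod \<zeta>)^2 * (1 - cmod u')^2 \<le>
       16 * ((cmod (v ^ k))^2 * (1 - e)^2 * (1 - cmod u)^2)" .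
    have pos: "0 < (cmod (v ^ k))^2 * (1 - cmod \<zeta>)^2 * (1 - cmod u')^2"
      using vk u'1 \<zeta>1 by simp
    define Q where "Q = berezin_density k (u * v, v ^ k) (u' * v', \<zeta>)"
    have "1 \<le> C0 * ((cmod (v ^ k))^2 * (1 - cmod \<zeta>)^2 * (1 - cmod u')^2) * Q"
      using low C0 pos by (simp add: Q_def[symmetric] divide_le_eq mult.commute)
    also have "\<dots> \<le> C0 * (16 * ((cmod (v ^ k))^2 * (1 - e)^2 * (1 - cmod u)^2)) * Q"
    proof (intro mult_right_mono mult_left_mono le)
      have "0 \<le> 1 / (C0 * ((cmod (v ^ k))^2 * (1 - cmod \<zeta>)^2 * (1 - cmod u')^2))"
        using C0 by simp
      then show "0 \<le> Q" unfolding Q_def using low by (rule order_trans)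
    qed (use C0 in simp)
    finally have "1 \<le> C0 * 16 * ((cmod (v ^ k))^2 * (1 - e)^2 * (1 - cmod u)^2) * Q"
      by (simp add: mult_ac)
    then show ?case
      using u'1 \<zeta>1 v'k by (simp add: Q_def e_def v'_def)
  qed (use \<kappa> r C0 in auto)
qed

section \<open>Local domination by the Berezin transform\<close>

lemma measurable_fst_borel [measurable (raw)]:
  fixes f :: "'a \<Rightarrow> 'b::second_countable_topology \<times> 'c::second_countable_topology"
  assumes [measurable]: "f \<in> borel_measurable M"
  shows "(\<lambda>x. fst (f x)) \<in> borel_measurable M"
  by (rule measurable_compose[OF assms]) (intro borel_measurable_continuous_onI continuous_intros)

lemma measurable_snd_borel [measurable (raw)]:
  fixes f :: "'a \<Rightarrow> 'b::second_countable_topology \<times> 'c::second_countable_topology"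
  assumes [measurable]: "f \<in> borel_measurable M"
  shows "(\<lambda>x. snd (f x)) \<in> borel_measurable M"
  by (rule measurable_compose[OF assms]) (intro borel_measurable_continuous_onI continuous_intros)

lemma measurable_cnj [measurable (raw)]:
  assumes [measurable]: "f \<in> borel_measurable M"
  shows "(\<lambda>x. cnj (f x)) \<in> borel_measurable M"
  by (rule measurable_compose[OF assms]) (intro borel_measurable_continuous_onI continuous_intros)

lemma measurable_Kb [measurable (raw)]:
  assumes [measurable]: "f \<in> borel_measurable M" "g \<in> borel_measurable M"
  shows "(\<lambda>x. Kb k (f x) (g x)) \<in> borel_measurable M"
  unfolding Kb_def Let_def pk_def qk_def by measurable

lemma measurable_Pk [measurable (raw)]:
  assumes [measurable]: "f \<in> borel_measurable M" "g \<in> borel_measurable M"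
  shows "(\<lambda>x. Pk k (f x) (g x)) \<in> borel_measurable M"
  unfolding Pk_def Let_def by measurable

lemma measurable_berezin_density [measurable (raw)]:
  assumes [measurable]: "f \<in> borel_measurable M" "g \<in> borel_measurable M"
  shows "(\<lambda>x. berezin_density k (f x) (g x)) \<in> borel_measurable M"
  unfolding berezin_density_def by measurable

lemma sets_Hk [measurable]: "Hk k \<in> sets borel"
  by (intro borel_open open_Hk)

lemma sets_tail [measurable]: "tail k \<rho> \<in> sets borel"
  unfolding tail_def by measurable

lemma tail_subset: "tail k \<rho> \<subseteq> Hk k"
  by (auto simp: tail_def)

lemma one_diff_power_le:
  fixes a :: real
  assumes "0 \<le> a" "a \<le> 1" "k > 0"
  shows "1 - a ^ k \<le> real k * (1 - a)" "1 - a \<le> 1 - a ^ k"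
proof -
  show "1 - a ^ k \<le> real k * (1 - a)"
    using Bernoulli_inequality[of "a - 1" k] assms by (simp add: algebra_simps)
  show "1 - a \<le> 1 - a ^ k"
    using power_decreasing[of 1 k a] assms by simp
qed

text \<open>The mean value inequality at the slid centre, with a multiple of the Berezin density as
  weight. The squared radii are r^4 times the boundary factor of the density, and |v^k|^2 repays the
  slide, so all dependence on the point cancels. The average only sees |w2| \<ge> c, although z may
  be arbitrarily close to the corner.\<close>

lemma pointwise_berezin_bound:
  assumes k: "k > 0"
  obtains C c where "C > 0" "c > 0"
    "\<And>f \<rho> z. f \<in> A2 k \<Longrightarrow> z \<in> tail k \<rho> \<Longrightarrow> ennreal ((cmod (f z))^2) \<le> ennreal C *
       (\<integral>\<^sup>+w. indicator (tail k (2 * real k * \<rho>) \<inter> {w. c \<le> cmod (snd w)}) w *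
          ennreal (berezin_density k z w) * ennreal ((cmod (f w))^2) \<partial>lborel)"
proof -
  obtain \<kappa> r C where \<kappa>: "0 < \<kappa>" "\<kappa> \<le> 1 / 4" and r: "0 < r" "r \<le> 1 / 2" "r \<le> \<kappa> ^ k / 2" and C: "C > 0"
    and reg: "\<And>u v v0 u' \<zeta>. cmod u < 1 \<Longrightarrow> v \<noteq> 0 \<Longrightarrow> v0 \<noteq> 0 \<Longrightarrow> \<kappa> \<le> cmod v0 \<Longrightarrow> cmod v0 < 1 \<Longrightarrow>
       cmod v \<le> cmod v0 \<Longrightarrow> v0 = v \<or> cmod v0 = \<kappa> \<Longrightarrow>
       cmod (u' - u) < r * (1 - cmod u) \<Longrightarrow> cmod (\<zeta> - v0 ^ k) < r * (1 - cmod (v0 ^ k)) \<Longrightarrow>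
       1 \<le> C * ((cmod (v ^ k))^2 * (1 - cmod (v0 ^ k))^2 * (1 - cmod u)^2) *
           berezin_density k (u * v, v ^ k) (u' * root_branch k v0 \<zeta>, \<zeta>) \<and>
       cmod u' < 1 \<and> cmod \<zeta> < 1 \<and> \<kappa> ^ k / 2 \<le> cmod \<zeta> \<and> 1 - cmod \<zeta> \<le> 2 * (1 - cmod (v0 ^ k)) \<and>
       1 - cmod u' \<le> 2 * (1 - cmod u) \<and> root_branch k v0 \<zeta> ^ k = \<zeta> \<and> root_branch k v0 \<zeta> \<noteq> 0"
    by (rule berezin_region[OF k]) (rule that; assumption)
  show ?thesis
  proof (rule that[of "C / (\<kappa>^2 * r ^ 4)" "\<kappa> ^ k / 2"])
    fix f \<rho> z
    assume f: "f \<in> A2 k" and z: "z \<in> tail k \<rho>"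
    define T where "T = tail k (2 * real k * \<rho>) \<inter> {w. \<kappa> ^ k / 2 \<le> cmod (snd w)}"
    have [measurable]: "T \<in> sets borel"
      unfolding T_def by measurable
    define J where "J = (\<integral>\<^sup>+w. indicator T w * ennreal (berezin_density k z w) * ennreal ((cmod (f w))^2) \<partial>lborel)"
    obtain u v where u: "cmod u < 1" and v: "v \<noteq> 0" "cmod v < 1" and zuv: "z = (u * v, v ^ k)"
      using Hk_paramE[of z k] z tail_subset k by blast
    obtain v0 where v0: "v0 \<noteq> 0" "\<kappa> \<le> cmod v0" "cmod v \<le> cmod v0" "cmod v0 < 1" "v0 = v \<or> cmod v0 = \<kappa>"
      and fv0: "cmod (v ^ k) * cmod (f (u * v, v ^ k)) \<le> cmod (v0 ^ k) * cmod (f (u * v0, v0 ^ k))"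
      by (rule fibre_center[OF f k u v, of \<kappa>]) (use \<kappa> in auto)
    define e q where "e = cmod (v0 ^ k)" and "q = (cmod (v ^ k))^2"
    have e: "0 < e" "e < 1" "\<kappa> ^ k \<le> e"
      using v0 k \<kappa> by (auto simp: e_def norm_power cmod_lt_one_power_iff power_mono)
    have q: "q > 0" using v by (simp add: q_def)
    define D where "D = (1 - e)^2 * (1 - cmod u)^2"
    have D: "D > 0" using e u by (simp add: D_def)
    \<comment> \<open>By the region estimate this weight is at least 1 on the whole polydisc; the
      constant \<open>q * D\<close> is divided out again at the end.\<close>
    define W :: "c2 \<Rightarrow> ennreal" where "W w = indicator T w * ennreal (C * (q * D) * berezin_density k z w)" for w
    have z_tail: "1 - cmod (v ^ k) \<le> \<rho> \<or> 1 - cmod u ^ k \<le> \<rho>"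
      using z fst_param_ratio[OF v(1), of u k] by (auto simp: tail_def zuv)
    have "ennreal ((cmod v0)^2 * (r * (1 - cmod u))^2 * (r * (1 - e))^2) * ennreal ((cmod (f (u * v0, v0 ^ k)))^2) \<le>
       (\<integral>\<^sup>+w. indicator (Hk k) w * W w * ennreal ((cmod (f w))^2) \<partial>lborel)"
    proof (rule local_submean[OF A2_holo2[OF f] k u v0(1,4)])
      show "0 < r * (1 - cmod u)" "r * (1 - cmod u) \<le> 1 - cmod u"
        using r u by (auto intro!: mult_left_le_one_le)
      show "0 < r * (1 - e)" "r * (1 - e) \<le> 1 - cmod (v0 ^ k)"
        using r e by (auto intro!: mult_left_le_one_le simp: e_def)
      have "r * (1 - e) \<le> r * 1" using r e by (intro mult_left_mono) auto
      then show "r * (1 - e) \<le> cmod (v0 ^ k) / 2"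
        using r e unfolding e_def by argo
      show "W \<in> borel_measurable borel"
        unfolding W_def by measurable
    next
      fix u' \<zeta> :: complex
      assume "cmod (u' - u) < r * (1 - cmod u)" "cmod (\<zeta> - v0 ^ k) < r * (1 - e)"
      from reg[OF u v(1) v0(1,2,4,3,5), OF this(1) this(2)[unfolded e_def]]
      have R: "1 \<le> C * (q * D) * berezin_density k z (u' * root_branch k v0 \<zeta>, \<zeta>)"
         "cmod u' < 1" "cmod \<zeta> < 1" "\<kappa> ^ k / 2 \<le> cmod \<zeta>" "1 - cmod \<zeta> \<le> 2 * (1 - e)"
         "1 - cmod u' \<le> 2 * (1 - cmod u)" "root_branch k v0 \<zeta> ^ k = \<zeta>" "root_branch k v0 \<zeta> \<noteq> 0"
        by (simp_all add: e_def q_def D_def zuv mult.assoc)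
      define v' where "v' = root_branch k v0 \<zeta>"
      have v': "v' ^ k = \<zeta>" "v' \<noteq> 0" "cmod v' < 1"
        using R k cmod_lt_one_power_iff[OF k, of v'] by (auto simp: v'_def norm_power[symmetric])
      have inH: "(u' * v', \<zeta>) \<in> Hk k"
        using Hk_param[OF R(2) v'(2,3) k] v' by simp
      have ratio: "cmod (u' * v') ^ k / cmod \<zeta> = cmod u' ^ k"
        using fst_param_ratio[OF v'(2), of u' k] v' by simp
      have k1: "1 \<le> real k" using k by simp
      \<comment> \<open>Sliding outwards only decreases the distance in the second coordinate and
        keeps \<open>u\<close>. The polydisc then costs a factor 2, and passing from 1 - |u'| to 1 -
        |u'|^k a factor \<open>k\<close>; hence the enlarged tail.\<close>
      have "1 - cmod \<zeta> \<le> 2 * real k * \<rho> \<or> 1 - cmod u' ^ k \<le> 2 * real k * \<rho>"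
        using z_tail
      proof
        assume a: "1 - cmod (v ^ k) \<le> \<rho>"
        have "cmod (v ^ k) \<le> e"
          using v0 by (simp add: e_def norm_power power_mono)
        then have 1: "1 - e \<le> \<rho>" using a by linarith
        then have "0 \<le> \<rho>" using e by linarith
        then have "1 * \<rho> \<le> real k * \<rho>" using k1 by (intro mult_right_mono) auto
        then show ?thesis using 1 R(5) by argo
      next
        assume a: "1 - cmod u ^ k \<le> \<rho>"
        have "1 - cmod u ^ k \<ge> 1 - cmod u"
          using one_diff_power_le(2)[of "cmod u" k] u k by simp
        then have 1: "1 - cmod u' \<le> 2 * \<rho>"
          using a R(6) by argo
        have "1 - cmod u' ^ k \<le> real k * (1 - cmod u')"
          using one_diff_power_le(1)[of "cmod u'" k] R k by simp
        also have "\<dots> \<le> real k * (2 * \<rho>)"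
          using 1 by (intro mult_left_mono) auto
        finally show ?thesis by (simp add: mult_ac)
      qed
      then have "(u' * v', \<zeta>) \<in> T"
        using inH R(4) by (auto simp: T_def tail_def ratio)
      then show "1 \<le> W (u' * root_branch k v0 \<zeta>, \<zeta>)"
        using R(1) by (simp add: W_def v'_def)
    qed
    also have "\<dots> = (\<integral>\<^sup>+w. ennreal (C * (q * D)) * (indicator T w * ennreal (berezin_density k z w) * ennreal ((cmod (f w))^2)) \<partial>lborel)"
    proof (intro nn_integral_cong)
      fix w :: c2
      have "w \<in> T \<Longrightarrow> w \<in> Hk k" using tail_subset by (auto simp: T_def)
      moreover have "ennreal (C * (q * D) * b) = ennreal (C * (q * D)) * ennreal b" for b
        using C q D by (intro ennreal_mult') auto
      ultimately show "indicator (Hk k) w * W w * ennreal ((cmod (f w))^2) =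
         ennreal (C * (q * D)) * (indicator T w * ennreal (berezin_density k z w) * ennreal ((cmod (f w))^2))"
        by (cases "w \<in> T") (auto simp: W_def mult.assoc)
    qed
    also have "\<dots> = ennreal (C * (q * D)) * J"
      unfolding J_def
    proof (rule nn_integral_cmult)
      have [measurable]: "sq_on (Hk k) f \<in> borel_measurable borel"
        by (rule measurable_holo2_sq[OF A2_holo2[OF f]])
      have "(\<lambda>w. indicator T w * ennreal (berezin_density k z w) * (indicator (Hk k) w * ennreal ((cmod (f w))^2)))
         \<in> borel_measurable lborel" by measurable
      also have "(\<lambda>w. indicator T w * ennreal (berezin_density k z w) * (indicator (Hk k) w * ennreal ((cmod (f w))^2)))
        = (\<lambda>w. indicator T w * ennreal (berezin_density k z w) * ennreal ((cmod (f w))^2))"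
        using tail_subset by (auto simp: T_def fun_eq_iff indicator_def)
      finally show "(\<lambda>w. indicator T w * ennreal (berezin_density k z w) * ennreal ((cmod (f w))^2))
         \<in> borel_measurable lborel" .
    qed
    finally have main: "ennreal ((cmod v0)^2 * (r * (1 - cmod u))^2 * (r * (1 - e))^2) *
        ennreal ((cmod (f (u * v0, v0 ^ k)))^2) \<le> ennreal (C * (q * D)) * J" .
    have "\<kappa>^2 * r ^ 4 * (q * D) * (cmod (f z))^2 \<le>
       (cmod v0)^2 * (r * (1 - cmod u))^2 * (r * (1 - e))^2 * (cmod (f (u * v0, v0 ^ k)))^2"
    proof -
      \<comment> \<open>The left side is the squared modulus of the extended fibre at
        \<open>v\<close>; the maximum principle bounds it at \<open>v0\<close>, where the factor
        \<open>e\<close> is below 1.\<close>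
      have "q * (cmod (f z))^2 = (cmod (v ^ k) * cmod (f (u * v, v ^ k)))^2"
        by (simp add: q_def zuv power_mult_distrib)
      also have "\<dots> \<le> (e * cmod (f (u * v0, v0 ^ k)))^2"
        using fv0 by (intro power_mono) (auto simp: e_def)
      also have "\<dots> \<le> (cmod (f (u * v0, v0 ^ k)))^2"
        using e by (intro power_mono) (auto intro: mult_left_le_one_le)
      finally have X: "q * (cmod (f z))^2 \<le> (cmod (f (u * v0, v0 ^ k)))^2" .
      have Y: "\<kappa>^2 * (r ^ 4 * D) \<le> (cmod v0)^2 * (r ^ 4 * D)"
        using v0(2) \<kappa>(1) D by (intro mult_right_mono power_mono) auto
      have nn: "0 \<le> (cmod v0)^2 * (r ^ 4 * D)" "0 \<le> q * (cmod (f z))^2"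
        using q D by auto
      have "\<kappa>^2 * (r ^ 4 * D) * (q * (cmod (f z))^2) \<le> (cmod v0)^2 * (r ^ 4 * D) * (cmod (f (u * v0, v0 ^ k)))^2"
        by (rule mult_mono[OF Y X nn])
      moreover have r4: "r ^ 4 = r^2 * r^2" by (simp add: power2_eq_square power4_eq_xxxx)
      ultimately show ?thesis
        by (simp only: r4 D_def power_mult_distrib mult_ac)
    qed
    then have "ennreal (\<kappa>^2 * r ^ 4 * (q * D) * (cmod (f z))^2) \<le>
       ennreal ((cmod v0)^2 * (r * (1 - cmod u))^2 * (r * (1 - e))^2) * ennreal ((cmod (f (u * v0, v0 ^ k)))^2)"
      by (subst ennreal_mult[symmetric]) (auto intro: ennreal_leI)
    also note main
    finally have "ennreal (\<kappa>^2 * r ^ 4 * (q * D) * (cmod (f z))^2) \<le> ennreal (C * (q * D)) * J" .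
    then have "ennreal (1 / (\<kappa>^2 * r ^ 4 * (q * D))) * ennreal (\<kappa>^2 * r ^ 4 * (q * D) * (cmod (f z))^2)
       \<le> ennreal (1 / (\<kappa>^2 * r ^ 4 * (q * D))) * (ennreal (C * (q * D)) * J)"
      by (rule mult_left_mono) simp
    moreover have "ennreal (1 / (\<kappa>^2 * r ^ 4 * (q * D))) * ennreal (\<kappa>^2 * r ^ 4 * (q * D) * (cmod (f z))^2) = ennreal ((cmod (f z))^2)"
      using \<kappa> r q D by (simp add: ennreal_mult[symmetric])
    moreover have "ennreal (1 / (\<kappa>^2 * r ^ 4 * (q * D))) * (ennreal (C * (q * D)) * J) = ennreal (C / (\<kappa>^2 * r ^ 4)) * J"
      using \<kappa> r q D C by (simp add: mult.assoc[symmetric] ennreal_mult[symmetric])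
    ultimately show "ennreal ((cmod (f z))^2) \<le> ennreal (C / (\<kappa>^2 * r ^ 4)) *
       (\<integral>\<^sup>+w. indicator (tail k (2 * real k * \<rho>) \<inter> {w. \<kappa> ^ k / 2 \<le> cmod (snd w)}) w *
          ennreal (berezin_density k z w) * ennreal ((cmod (f w))^2) \<partial>lborel)"
      by (simp add: J_def T_def)
  qed (use C \<kappa> r in auto)
qed

lemma B_mu_density: "B_mu k \<mu> w = (\<integral>\<^sup>+z. indicator (Hk k) z * ennreal (berezin_density k z w) \<partial>\<mu>)"
  by (simp add: B_mu_def berezin_density_def)

text \<open>Integrates the pointwise bound against \<mu>. After Tonelli the inner integral over z is
  the Berezin transform, and the restriction |w2| \<ge> c, which concerns w alone, survives.\<close>

lemma tail_integral_le:
  assumes k: "k > 0"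
  obtains C c where "C > 0" "c > 0"
    "\<And>\<mu> f \<rho>. fin_borel_on k \<mu> \<Longrightarrow> f \<in> A2 k \<Longrightarrow>
      sq_mass \<mu> (tail k \<rho>) f \<le> ennreal C *
       (\<integral>\<^sup>+w. indicator (tail k (2 * real k * \<rho>) \<inter> {w. c \<le> cmod (snd w)}) w *
          B_mu k \<mu> w * ennreal ((cmod (f w))^2) \<partial>lborel)"
proof -
  obtain C c where C: "C > 0" "c > 0" and
    bnd: "\<And>f \<rho> z. f \<in> A2 k \<Longrightarrow> z \<in> tail k \<rho> \<Longrightarrow> ennreal ((cmod (f z))^2) \<le> ennreal C *
       (\<integral>\<^sup>+w. indicator (tail k (2 * real k * \<rho>) \<inter> {w. c \<le> cmod (snd w)}) w *
          ennreal (berezin_density k z w) * ennreal ((cmod (f w))^2) \<partial>lborel)"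
    using pointwise_berezin_bound[OF k] by blast
  show ?thesis
  proof (rule that[of C c])
    fix \<mu> f \<rho>
    assume \<mu>: "fin_borel_on k \<mu>" and f: "f \<in> A2 k"
    have [measurable_cong]: "sets \<mu> = sets borel" using \<mu> by (simp add: fin_borel_on_def)
    interpret finite_measure \<mu> using \<mu> by (simp add: fin_borel_on_def)
    interpret P: pair_sigma_finite \<mu> "lborel :: c2 measure" ..
    define T where "T = tail k (2 * real k * \<rho>) \<inter> {w. c \<le> cmod (snd w)}"
    have [measurable]: "T \<in> sets borel"
      unfolding T_def by measurable
    define F where "F w = indicator T w * ennreal ((cmod (f w))^2)" for w
    have [measurable]: "F \<in> borel_measurable borel"
    proof -
      have [measurable]: "sq_on (Hk k) f \<in> borel_measurable borel"
        by (rule measurable_holo2_sq[OF A2_holo2[OF f]])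
      have "(\<lambda>w. indicator T w * (indicator (Hk k) w * ennreal ((cmod (f w))^2))) \<in> borel_measurable borel"
        by measurable
      also have "(\<lambda>w. indicator T w * (indicator (Hk k) w * ennreal ((cmod (f w))^2))) = F"
        using tail_subset by (auto simp: F_def T_def fun_eq_iff indicator_def)
      finally show ?thesis .
    qed
    have "sq_mass \<mu> (tail k \<rho>) f \<le>
      (\<integral>\<^sup>+z. ennreal C * (\<integral>\<^sup>+w. indicator (Hk k) z * ennreal (berezin_density k z w) * F w \<partial>lborel) \<partial>\<mu>)"
    proof (rule nn_integral_mono)
      fix z
      show "indicator (tail k \<rho>) z * ennreal ((cmod (f z))^2) \<le>
        ennreal C * (\<integral>\<^sup>+w. indicator (Hk k) z * ennreal (berezin_density k z w) * F w \<partial>lborel)"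
      proof (cases "z \<in> tail k \<rho>")
        case True
        then have zH: "z \<in> Hk k" using tail_subset by blast
        have "(\<integral>\<^sup>+w. indicator T w * ennreal (berezin_density k z w) * ennreal ((cmod (f w))^2) \<partial>lborel)
          = (\<integral>\<^sup>+w. indicator (Hk k) z * ennreal (berezin_density k z w) * F w \<partial>lborel)"
          using zH by (intro nn_integral_cong) (simp add: F_def mult_ac)
        then show ?thesis
          using bnd[OF f True] True unfolding T_def[symmetric] by simp
      qed simp
    qed
    also have "\<dots> = ennreal C * (\<integral>\<^sup>+z. (\<integral>\<^sup>+w. indicator (Hk k) z * ennreal (berezin_density k z w) * F w \<partial>lborel) \<partial>\<mu>)"
      by (rule nn_integral_cmult) measurable
    also have "(\<integral>\<^sup>+z. (\<integral>\<^sup>+w. indicator (Hk k) z * ennreal (berezin_density k z w) * F w \<partial>lborel) \<partial>\<mu>)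
       = (\<integral>\<^sup>+w. (\<integral>\<^sup>+z. indicator (Hk k) z * ennreal (berezin_density k z w) * F w \<partial>\<mu>) \<partial>lborel)"
      by (rule P.Fubini'[symmetric]) measurable
    also have "\<dots> = (\<integral>\<^sup>+w. B_mu k \<mu> w * F w \<partial>lborel)"
      unfolding B_mu_density by (intro nn_integral_cong nn_integral_multc) measurable
    finally show "sq_mass \<mu> (tail k \<rho>) f \<le> ennreal C *
       (\<integral>\<^sup>+w. indicator (tail k (2 * real k * \<rho>) \<inter> {w. c \<le> cmod (snd w)}) w *
          B_mu k \<mu> w * ennreal ((cmod (f w))^2) \<partial>lborel)"
      by (simp add: F_def T_def mult_ac)
  qed (use C in auto)
qed

text \<open>The same mean value inequality with weight 1. Off the tail the radii at the slid centre
  are bounded below, so the only degeneration left is |z2|^2 from the corner.\<close>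

lemma interior_bound:
  assumes k: "k > 0" and \<rho>: "\<rho> > 0"
  obtains c where "c > 0"
    "\<And>f z. f \<in> A2 k \<Longrightarrow> z \<in> Hk k - tail k \<rho> \<Longrightarrow>
      ennreal (c * ((cmod (snd z))^2 * (cmod (f z))^2)) \<le> normA2sq k f"
proof -
  define \<kappa> :: real where "\<kappa> = 1 / 2"
  define r where "r = \<kappa> ^ k / 2"
  have \<kappa>k: "0 < \<kappa> ^ k" "\<kappa> ^ k \<le> 1 / 2"
    using power_decreasing[of 1 k \<kappa>] k by (auto simp: \<kappa>_def)
  have r: "0 < r" "r \<le> 1" using \<kappa>k by (auto simp: r_def)
  \<comment> \<open>A lower bound for 1 - |v0^k| in both cases: \<rho> if the centre is the point
    itself, 1/2 if it was moved to the circle of radius 1/2.\<close>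
  define m where "m = min \<rho> (1 / 2)"
  have m: "m > 0" using \<rho> by (simp add: m_def)
  define c where "c = \<kappa>^2 * (r * (\<rho> / real k))^2 * (r * m)^2"
  show ?thesis
  proof (rule that[of c])
    show "c > 0" using r m \<rho> k by (simp add: c_def \<kappa>_def)
    fix f z assume f: "f \<in> A2 k" and z: "z \<in> Hk k - tail k \<rho>"
    obtain u v where u: "cmod u < 1" and v: "v \<noteq> 0" "cmod v < 1" and zuv: "z = (u * v, v ^ k)"
      using Hk_paramE[of z k] z k by blast
    obtain v0 where v0: "v0 \<noteq> 0" "\<kappa> \<le> cmod v0" "cmod v \<le> cmod v0" "cmod v0 < 1" "v0 = v \<or> cmod v0 = \<kappa>"
      and fv0: "cmod (v ^ k) * cmod (f (u * v, v ^ k)) \<le> cmod (v0 ^ k) * cmod (f (u * v0, v0 ^ k))"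
      by (rule fibre_center[OF f k u v, of \<kappa>]) (auto simp: \<kappa>_def)
    define e where "e = cmod (v0 ^ k)"
    have e: "0 < e" "e < 1" "\<kappa> ^ k \<le> e"
      using v0 k by (auto simp: e_def norm_power cmod_lt_one_power_iff power_mono \<kappa>_def)
    have nz: "\<rho> < 1 - cmod (v ^ k)" "\<rho> < 1 - cmod u ^ k"
      using z fst_param_ratio[OF v(1), of u k] by (auto simp: tail_def zuv not_le)
    have em: "m \<le> 1 - e"
      using v0(5)
    proof
      assume "cmod v0 = \<kappa>"
      then have "e = \<kappa> ^ k" by (simp add: e_def norm_power)
      then show ?thesis using \<kappa>k by (simp add: m_def)
    qed (use nz in \<open>simp add: m_def e_def\<close>)
    have um: "\<rho> / real k \<le> 1 - cmod u"
    proof -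
      have "\<rho> \<le> real k * (1 - cmod u)"
        using one_diff_power_le(1)[of "cmod u" k] u k nz by simp
      then show ?thesis using k by (simp add: divide_le_eq mult.commute)
    qed
    have "ennreal ((cmod v0)^2 * (r * (1 - cmod u))^2 * (r * (1 - e))^2) * ennreal ((cmod (f (u * v0, v0 ^ k)))^2) \<le>
       (\<integral>\<^sup>+w. indicator (Hk k) w * 1 * ennreal ((cmod (f w))^2) \<partial>lborel)"
    proof (rule local_submean[OF A2_holo2[OF f] k u v0(1,4)])
      show "0 < r * (1 - cmod u)" "r * (1 - cmod u) \<le> 1 - cmod u"
        using r u by (auto intro!: mult_left_le_one_le)
      show "0 < r * (1 - e)" "r * (1 - e) \<le> 1 - cmod (v0 ^ k)"
        using r e by (auto intro!: mult_left_le_one_le simp: e_def)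
      have "r * (1 - e) \<le> r * 1" using r e by (intro mult_left_mono) auto
      then show "r * (1 - e) \<le> cmod (v0 ^ k) / 2"
        using e unfolding e_def r_def by argo
    qed auto
    then have main: "ennreal ((cmod v0)^2 * (r * (1 - cmod u))^2 * (r * (1 - e))^2) * ennreal ((cmod (f (u * v0, v0 ^ k)))^2)
       \<le> normA2sq k f"
      by (simp add: normA2sq_lborel)
    have "c * ((cmod (snd z))^2 * (cmod (f z))^2) \<le>
       (cmod v0)^2 * (r * (1 - cmod u))^2 * (r * (1 - e))^2 * (cmod (f (u * v0, v0 ^ k)))^2"
    proof (rule mult_mono)
      show "c \<le> (cmod v0)^2 * (r * (1 - cmod u))^2 * (r * (1 - e))^2"
        unfolding c_def using v0 r um em m \<rho> by (intro mult_mono power_mono mult_left_mono) (auto simp: \<kappa>_def)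
      have "(cmod (snd z))^2 * (cmod (f z))^2 = (cmod (v ^ k) * cmod (f (u * v, v ^ k)))^2"
        by (simp add: zuv power_mult_distrib)
      also have "\<dots> \<le> (e * cmod (f (u * v0, v0 ^ k)))^2"
        using fv0 by (intro power_mono) (auto simp: e_def)
      also have "\<dots> \<le> (cmod (f (u * v0, v0 ^ k)))^2"
        using e by (intro power_mono) (auto intro: mult_left_le_one_le)
      finally show "(cmod (snd z))^2 * (cmod (f z))^2 \<le> (cmod (f (u * v0, v0 ^ k)))^2" .
    qed auto
    then have "ennreal (c * ((cmod (snd z))^2 * (cmod (f z))^2)) \<le>
       ennreal ((cmod v0)^2 * (r * (1 - cmod u))^2 * (r * (1 - e))^2) * ennreal ((cmod (f (u * v0, v0 ^ k)))^2)"
      by (subst ennreal_mult[symmetric]) (auto intro: ennreal_leI)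
    also note main
    finally show "ennreal (c * ((cmod (snd z))^2 * (cmod (f z))^2)) \<le> normA2sq k f" .
  qed
qed

section \<open>Normal families and compactness\<close>

text \<open>Cauchy's estimate on discs of radius \<open>d\<close>, which stay inside the doubled
  ball.\<close>

lemma bounded_holomorphic_lipschitz:
  assumes g: "g holomorphic_on ball a (2 * d)" and d: "d > 0"
    and M: "\<And>x. x \<in> ball a (2 * d) \<Longrightarrow> cmod (g x) \<le> M"
    and x: "x \<in> ball a d"
  shows "cmod (g x - g a) \<le> M / d * cmod (x - a)"
proof (rule field_differentiable_bound[where S = "ball a d" and f' = "deriv g"])
  show "(g has_field_derivative deriv g z) (at z within ball a d)" if "z \<in> ball a d" for z
    by (rule has_field_derivative_at_within, rule holomorphic_derivI[OF g]) (use that d in auto)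
  show "cmod (deriv g z) \<le> M / d" if z: "z \<in> ball a d" for z
  proof -
    have sub: "cball z d \<subseteq> ball a (2 * d)"
    proof
      fix w assume "w \<in> cball z d"
      then show "w \<in> ball a (2 * d)"
        using z dist_triangle[of a w z] by (simp add: dist_commute)
    qed
    have "cmod ((deriv ^^ 1) g z) \<le> fact 1 * M / d ^ 1"
    proof (rule Cauchy_inequality)
      show "g holomorphic_on ball z d"
        using g sub by (meson ball_subset_cball holomorphic_on_subset order_trans)
      show "continuous_on (cball z d) g"
        using g sub holomorphic_on_imp_continuous_on continuous_on_subset by blast
      show "cmod (g x) \<le> M" if "cmod (z - x) = d" for x
        using that sub by (intro M) (auto simp: dist_norm)
    qed (use d in auto)
    then show ?thesis by simp
  qed
qed (use x d in auto)

lemma Hk_snd_pos: "z \<in> Hk k \<Longrightarrow> 0 < cmod (snd z)"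
  unfolding Hk_def by (metis (mono_tags) le_less_trans mem_Collect_eq norm_ge_zero zero_le_power)

text \<open>Equicontinuity and boundedness of the unit ball at a point. The interior estimate bounds
  all its members near \<open>z0\<close>; moving one coordinate at a time through a polydisc turns
  this into a Lipschitz bound.\<close>

lemma A2_local_lipschitz:
  assumes k: "k > 0" and z0: "z0 \<in> Hk k"
  obtains d L where "d > 0" "L \<ge> 0"
    "\<And>f z. f \<in> A2 k \<Longrightarrow> normA2sq k f \<le> 1 \<Longrightarrow> z \<in> ball z0 d \<Longrightarrow> z \<in> Hk k \<and> cmod (f z - f z0) \<le> L * dist z z0"
    "\<And>f. f \<in> A2 k \<Longrightarrow> normA2sq k f \<le> 1 \<Longrightarrow> cmod (f z0) \<le> L"
proof -
  obtain a b where ab: "z0 = (a, b)" by force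
  have z0': "cmod a ^ k < cmod b" "cmod b < 1" and b0: "0 < cmod b"
    using z0 Hk_snd_pos[OF z0] by (auto simp: Hk_def ab)
  \<comment> \<open>Half of each gap, so that \<open>z0\<close> and a neighbourhood lie strictly
    outside the tail.\<close>
  define \<rho> where "\<rho> = min ((1 - cmod b) / 2) ((1 - cmod a ^ k / cmod b) / 2)"
  have ratio: "cmod a ^ k / cmod b < 1" using z0' b0 by simp
  have \<rho>: "\<rho> > 0" "cmod b < 1 - \<rho>" "cmod a ^ k / cmod b < 1 - \<rho>"
  proof -
    show "\<rho> > 0" using z0' ratio by (simp add: \<rho>_def)
    have "\<rho> \<le> (1 - cmod b) / 2" "\<rho> \<le> (1 - cmod a ^ k / cmod b) / 2"
      unfolding \<rho>_def by (rule min.cobounded1, rule min.cobounded2)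
    then show "cmod b < 1 - \<rho>" "cmod a ^ k / cmod b < 1 - \<rho>"
      using z0' ratio by argo+
  qed
  obtain c where c: "c > 0" and cb: "\<And>f z. f \<in> A2 k \<Longrightarrow> z \<in> Hk k - tail k \<rho> \<Longrightarrow>
      ennreal (c * ((cmod (snd z))^2 * (cmod (f z))^2)) \<le> normA2sq k f"
    using interior_bound[OF k \<rho>(1)] by blast
  define U where "U = {z::c2. cmod (snd z) < 1 - \<rho> \<and> cmod (fst z) ^ k < (1 - \<rho>) * cmod (snd z) \<and> cmod b / 2 < cmod (snd z)}"
  have "open U"
    unfolding U_def by (intro open_Collect_conj open_Collect_less continuous_intros)
  moreover have "z0 \<in> U"
    using \<rho> b0 by (auto simp: U_def ab divide_less_eq)
  ultimately obtain \<epsilon> where \<epsilon>: "\<epsilon> > 0" "ball z0 \<epsilon> \<subseteq> U"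
    by (metis openE)
  \<comment> \<open>The Lipschitz lemma needs radius 2 d in each coordinate, and the two distances
    add up to less than 4 d.\<close>
  define d where "d = \<epsilon> / 4"
  have d: "d > 0" using \<epsilon> by (simp add: d_def)
  have poly: "(x, y) \<in> U" if "dist x a < 2 * d" "dist y b < 2 * d" for x y
  proof -
    have "dist z0 (x, y) \<le> dist x a + dist y b"
      using sqrt_sum_squares_le_sum_abs[of "dist a x" "dist b y"]
      unfolding ab dist_Pair_Pair by (simp add: dist_commute)
    also have "\<dots> < \<epsilon>" using that by (simp add: d_def)
    finally show ?thesis using \<epsilon> by auto
  qed
  have UH: "z \<in> Hk k - tail k \<rho>" if "z \<in> U" for z
  proof -
    have z: "cmod (snd z) < 1 - \<rho>" "cmod (fst z) ^ k < (1 - \<rho>) * cmod (snd z)" "0 < cmod (snd z)"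
      using that b0 by (auto simp: U_def)
    have "(1 - \<rho>) * cmod (snd z) \<le> 1 * cmod (snd z)"
      using \<rho> by (intro mult_right_mono) auto
    then have "cmod (fst z) ^ k < cmod (snd z)" "cmod (snd z) < 1"
      using z \<rho> by linarith+
    moreover have "cmod (fst z) ^ k / cmod (snd z) < 1 - \<rho>"
      using z by (simp add: pos_divide_less_eq)
    ultimately show ?thesis
      using z by (simp add: tail_def Hk_def)
  qed
  \<comment> \<open>Solves the interior estimate for |f| using |z2| \<ge> |b| / 2 on
    \<open>U\<close>.\<close>
  define M where "M = sqrt (1 / (c * (cmod b / 2)^2))"
  have M0: "M \<ge> 0" using c by (simp add: M_def)
  have M: "cmod (f z) \<le> M" if f: "f \<in> A2 k" "normA2sq k f \<le> 1" and z: "z \<in> U" for f z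
  proof -
    have "ennreal (c * ((cmod (snd z))^2 * (cmod (f z))^2)) \<le> ennreal 1"
      using cb[OF f(1) UH[OF z]] f(2) unfolding ennreal_1 by (rule order_trans)
    then have 1: "c * ((cmod (snd z))^2 * (cmod (f z))^2) \<le> 1"
      by (simp only: ennreal_le_iff[OF zero_le_one])
    have "(cmod b / 2)^2 \<le> (cmod (snd z))^2"
      using z b0 by (intro power_mono) (auto simp: U_def)
    then have "c * ((cmod b / 2)^2 * (cmod (f z))^2) \<le> c * ((cmod (snd z))^2 * (cmod (f z))^2)"
      using c by (intro mult_left_mono mult_right_mono) auto
    then have "(c * (cmod b / 2)^2) * (cmod (f z))^2 \<le> 1" using 1 by (simp add: mult.assoc)
    then have "(cmod (f z))^2 \<le> 1 / (c * (cmod b / 2)^2)"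
      using c b0 by (subst pos_le_divide_eq) (auto simp: mult.commute)
    then show ?thesis
      unfolding M_def by (rule real_le_rsqrt)
  qed
  show ?thesis
  proof (rule that[of d "max M (2 * (M / d))"])
    fix f z assume f: "f \<in> A2 k" "normA2sq k f \<le> 1" and z: "z \<in> ball z0 d"
    obtain x y where xy: "z = (x, y)" by force
    have "dist x a \<le> dist z z0" "dist y b \<le> dist z z0"
      using dist_fst_le[of z z0] dist_snd_le[of z z0] by (auto simp: xy ab)
    then have near: "dist x a < d" "dist y b < d" "cmod (x - a) \<le> dist z z0" "cmod (y - b) \<le> dist z z0"
      using z dist_norm[of x a] dist_norm[of y b] dist_commute[of z z0] by auto
    have "(\<lambda>s. f (s, y)) holomorphic_on ball a (2 * d)"
      using poly UH near d
      by (intro holo2_compose[OF A2_holo2[OF f(1)]]) (auto intro!: holomorphic_intros simp: dist_commute)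
    from bounded_holomorphic_lipschitz[OF this d, of M x]
    have 1: "cmod (f (x, y) - f (a, y)) \<le> M / d * cmod (x - a)"
      using M[OF f] poly near d by (auto simp: dist_commute)
    have "(\<lambda>s. f (a, s)) holomorphic_on ball b (2 * d)"
      using poly UH near d
      by (intro holo2_compose[OF A2_holo2[OF f(1)]]) (auto intro!: holomorphic_intros simp: dist_commute)
    from bounded_holomorphic_lipschitz[OF this d, of M y]
    have 2: "cmod (f (a, y) - f (a, b)) \<le> M / d * cmod (y - b)"
      using M[OF f] poly near d by (auto simp: dist_commute)
    have Md: "0 \<le> M / d" using M0 d by simp
    have "cmod (f z - f z0) \<le> cmod (f (x, y) - f (a, y)) + cmod (f (a, y) - f (a, b))"
      unfolding xy ab by (rule order_trans[OF _ norm_triangle_ineq]) simp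
    also have "\<dots> \<le> M / d * dist z z0 + M / d * dist z z0"
      using 1 2 mult_left_mono[OF near(3) Md] mult_left_mono[OF near(4) Md] by linarith
    also have "\<dots> = 2 * (M / d) * dist z z0" by simp
    also have "\<dots> \<le> max M (2 * (M / d)) * dist z z0"
      by (intro mult_right_mono) auto
    finally show "z \<in> Hk k \<and> cmod (f z - f z0) \<le> max M (2 * (M / d)) * dist z z0"
      using UH[OF poly[of x y]] near d by (auto simp: xy)
  next
    fix f assume f: "f \<in> A2 k" "normA2sq k f \<le> 1"
    show "cmod (f z0) \<le> max M (2 * (M / d))"
      using M[OF f \<open>z0 \<in> U\<close>] by simp
  qed (use d M0 in auto)
qed

text \<open>Diagonal extraction on a countable dense set, then equicontinuity transfers the Cauchy
  property to every point. Pointwise convergence is enough for the integral arguments that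
  follow.\<close>

lemma A2_unit_ball_Montel:
  assumes k: "k > 0" and f: "\<And>n::nat. f n \<in> A2 k \<and> normA2sq k (f n) \<le> 1"
  obtains r where "strict_mono (r::nat \<Rightarrow> nat)" "\<And>z. z \<in> Hk k \<Longrightarrow> convergent (\<lambda>n. f (r n) z)"
proof -
  obtain D :: "c2 set" where D: "countable D" "\<And>X. open X \<Longrightarrow> X \<noteq> {} \<Longrightarrow> \<exists>q\<in>D. q \<in> X"
    using countable_dense_setE by blast
  \<comment> \<open>The diagonal extraction works with one bound for all points, so values are
    divided by a positive pointwise bound and multiplied back afterwards.\<close>
  define L where "L z = (SOME l. l > 0 \<and> (\<forall>n. cmod (f n z) \<le> l))" for z
  have L: "L z > 0 \<and> (\<forall>n. cmod (f n z) \<le> L z)" if z: "z \<in> Hk k" for z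
    unfolding L_def
  proof (rule someI_ex)
    obtain d l :: real where "d > 0" "l \<ge> 0" "\<And>f. f \<in> A2 k \<Longrightarrow> normA2sq k f \<le> 1 \<Longrightarrow> cmod (f z) \<le> l"
      by (rule A2_local_lipschitz[OF k z]) (rule that; assumption)
    then have "l + 1 > 0 \<and> (\<forall>n. cmod (f n z) \<le> l + 1)"
      using f by (auto intro: order_trans[of _ l])
    then show "\<exists>l. l > 0 \<and> (\<forall>n. cmod (f n z) \<le> l)" by blast
  qed
  have "countable (D \<inter> Hk k)" using D by (simp add: countable_Int1)
  then obtain r :: "nat \<Rightarrow> nat" where r: "strict_mono r"
    and conv: "\<And>z. z \<in> D \<inter> Hk k \<Longrightarrow> \<exists>l. (\<lambda>n. f (r n) z / of_real (L z)) \<longlonglongrightarrow> l"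
  proof (rule function_convergent_subsequence[of "D \<inter> Hk k" "\<lambda>n z. f n z / of_real (L z)" 1])
    fix n z assume "z \<in> D \<inter> Hk k"
    then show "cmod (f n z / complex_of_real (L z)) \<le> 1"
      using L[of z] by (simp add: norm_divide)
  qed blast
  have convD: "convergent (\<lambda>n. f (r n) z)" if z: "z \<in> D \<inter> Hk k" for z
  proof -
    obtain l where "(\<lambda>n. f (r n) z / of_real (L z)) \<longlonglongrightarrow> l" using conv[OF z] by blast
    then have "(\<lambda>n. f (r n) z / of_real (L z) * of_real (L z)) \<longlonglongrightarrow> l * of_real (L z)"
      by (intro tendsto_intros)
    moreover have "L z \<noteq> 0" using L[of z] z by auto
    ultimately show ?thesis by (auto simp: convergent_def)
  qed
  have "convergent (\<lambda>n. f (r n) z)" if z: "z \<in> Hk k" for z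
  proof -
    obtain d l where d: "d > 0" "l \<ge> 0" and lip: "\<And>f q. f \<in> A2 k \<Longrightarrow> normA2sq k f \<le> 1 \<Longrightarrow>
        q \<in> ball z d \<Longrightarrow> q \<in> Hk k \<and> cmod (f q - f z) \<le> l * dist q z"
      by (rule A2_local_lipschitz[OF k z]) (rule that; assumption)
    have "Cauchy (\<lambda>n. f (r n) z)"
    proof (rule metric_CauchyI)
      fix e :: real assume e: "e > 0"
      \<comment> \<open>The 1 added to \<open>l\<close> keeps the quotient meaningful when the
        Lipschitz constant is 0.\<close>
      define s where "s = min d (e / (3 * (l + 1)))"
      have s: "s > 0" using d e by (simp add: s_def)
      obtain q where q: "q \<in> D" "q \<in> ball z s"
        using D(2)[of "ball z s"] s by auto
      have "q \<in> ball z d" using q by (auto simp: s_def)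
      note lq = lip[OF _ _ this]
      have qH: "q \<in> Hk k" using lq[of "f 0"] f by blast
      have close: "cmod (f n q - f n z) * 3 \<le> e" for n
      proof -
        have "cmod (f n q - f n z) \<le> l * dist q z" using lq f by blast
        also have "\<dots> \<le> (l + 1) * (e / (3 * (l + 1)))"
          using q d by (intro mult_mono) (auto simp: s_def dist_commute)
        also have "(l + 1) * (e / (3 * (l + 1))) = e / 3"
          using d nonzero_mult_div_cancel_left[of "l + 1" e] by (simp add: field_simps)
        finally show ?thesis by simp
      qed
      have "Cauchy (\<lambda>n. f (r n) q)"
        using convD[of q] q qH by (auto intro: convergent_Cauchy)
      then obtain N where N: "\<And>m n. m \<ge> N \<Longrightarrow> n \<ge> N \<Longrightarrow> dist (f (r m) q) (f (r n) q) < e / 3"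
        using metric_CauchyD[of _ "e / 3"] e by fastforce
      show "\<exists>N. \<forall>m\<ge>N. \<forall>n\<ge>N. dist (f (r m) z) (f (r n) z) < e"
      proof (intro exI allI impI)
        fix m n assume mn: "m \<ge> N" "n \<ge> N"
        have "dist (f (r m) z) (f (r n) z) \<le> dist (f (r m) q) (f (r m) z) + dist (f (r m) q) (f (r n) q) + dist (f (r n) q) (f (r n) z)"
          using dist_triangle[of "f (r m) z" "f (r n) z" "f (r m) q"] dist_triangle[of "f (r m) q" "f (r n) z" "f (r n) q"]
          by (simp add: dist_commute)
        then show "dist (f (r m) z) (f (r n) z) < e"
          using close[of "r m"] close[of "r n"] N[OF mn] unfolding dist_norm by argo
      qed
    qed
    then show ?thesis by (rule Cauchy_convergent)
  qed
  then show ?thesis using that r by blast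
qed

section \<open>Differences and limits in square norm\<close>

lemma ennreal_tendsto_0I:
  fixes X :: "'a \<Rightarrow> ennreal"
  assumes "\<And>e::real. e > 0 \<Longrightarrow> \<forall>\<^sub>F n in F. X n \<le> ennreal e"
  shows "(X \<longlongrightarrow> 0) F"
proof (rule order_tendstoI)
  fix a :: ennreal assume "0 < a"
  then obtain b where b: "0 < b" "b < a" using dense by blast
  then obtain e where e: "b = ennreal e" "e > 0"
    by (cases b) auto
  show "\<forall>\<^sub>F n in F. X n < a"
    using assms[OF e(2)] by eventually_elim (use b e in auto)
qed auto

lemma norm_diff_sq_le: "ennreal ((cmod (a - b))^2) \<le> 2 * ennreal ((cmod a)^2) + 2 * ennreal ((cmod b)^2)"
proof -
  have "(cmod (a - b))^2 \<le> (cmod a + cmod b)^2"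
    by (intro power_mono norm_triangle_ineq4) auto
  also have "\<dots> \<le> 2 * (cmod a)^2 + 2 * (cmod b)^2"
    using sum_squares_bound[of "cmod a" "cmod b"] by (simp add: power2_sum)
  finally have "ennreal ((cmod (a - b))^2) \<le> ennreal (2 * (cmod a)^2 + 2 * (cmod b)^2)"
    by (rule ennreal_leI)
  then show ?thesis by (simp add: ennreal_mult)
qed

lemma nn_integral_norm_diff_sq_le:
  assumes "sq_on S f \<in> borel_measurable M"
    and "sq_on S g \<in> borel_measurable M"
  shows "sq_mass M S (\<lambda>z. f z - g z) \<le>
    2 * sq_mass M S f +
    2 * sq_mass M S g"
proof -
  have "sq_mass M S (\<lambda>z. f z - g z) \<le>
    (\<integral>\<^sup>+z. 2 * (indicator S z * ennreal ((cmod (f z))^2)) + 2 * (indicator S z * ennreal ((cmod (g z))^2)) \<partial>M)"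
    by (intro nn_integral_mono) (use norm_diff_sq_le in \<open>auto simp: indicator_def\<close>)
  also have "\<dots> = 2 * sq_mass M S f +
    2 * sq_mass M S g"
    using assms by (subst nn_integral_add) (auto simp: nn_integral_cmult)
  finally show ?thesis .
qed

lemma A2_diff:
  assumes f: "f \<in> A2 k" and g: "g \<in> A2 k"
  shows "(\<lambda>z. f z - g z) \<in> A2 k" "normA2sq k (\<lambda>z. f z - g z) \<le> 2 * normA2sq k f + 2 * normA2sq k g"
proof -
  show le: "normA2sq k (\<lambda>z. f z - g z) \<le> 2 * normA2sq k f + 2 * normA2sq k g"
    unfolding normA2sq_lborel
    using measurable_holo2_sq[OF A2_holo2[OF f]] measurable_holo2_sq[OF A2_holo2[OF g]]
    by (intro nn_integral_norm_diff_sq_le) auto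
  have "holo2 (\<lambda>z. f z - g z) (Hk k)"
    unfolding holo2_def
  proof (intro conjI ballI open_Hk)
    fix z assume z: "z \<in> Hk k"
    obtain a b where "(f has_derivative (\<lambda>h. a * fst h + b * snd h)) (at z)"
      using A2_holo2[OF f] z unfolding holo2_def by blast
    moreover obtain a' b' where "(g has_derivative (\<lambda>h. a' * fst h + b' * snd h)) (at z)"
      using A2_holo2[OF g] z unfolding holo2_def by blast
    ultimately have "((\<lambda>z. f z - g z) has_derivative (\<lambda>h. (a * fst h + b * snd h) - (a' * fst h + b' * snd h))) (at z)"
      by (rule has_derivative_diff)
    also have "(\<lambda>h. (a * fst h + b * snd h) - (a' * fst h + b' * snd h)) = (\<lambda>h. (a - a') * fst h + (b - b') * snd h)"
      by (auto simp: algebra_simps)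
    finally show "\<exists>a b. ((\<lambda>z. f z - g z) has_derivative (\<lambda>h. a * fst h + b * snd h)) (at z)" by blast
  qed
  moreover have "2 * normA2sq k f + 2 * normA2sq k g < \<infinity>"
    using f g by (simp add: A2_def ennreal_mult_less_top)
  ultimately show "(\<lambda>z. f z - g z) \<in> A2 k"
    using le unfolding A2_def by (auto intro: le_less_trans)
qed

text \<open>Fatou's lemma. It provides norm bounds for pointwise limits and, in the necessity part,
  identifies an L^2 limit as zero.\<close>

lemma nn_integral_sq_limit_le:
  fixes h :: "nat \<Rightarrow> 'a \<Rightarrow> complex"
  assumes "\<And>n. (sq_on S (h n)) \<in> borel_measurable M"
    and lim: "\<And>z. z \<in> S \<Longrightarrow> (\<lambda>n. h n z) \<longlonglongrightarrow> g z"
    and K: "\<And>n. (sq_mass M S (h n)) \<le> K n"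
  shows "sq_mass M S g \<le> liminf K"
proof -
  have "indicator S z * ennreal ((cmod (g z))^2) = liminf (\<lambda>n. indicator S z * ennreal ((cmod (h n z))^2))" for z
  proof (cases "z \<in> S")
    case True
    have "(\<lambda>n. ennreal ((cmod (h n z))^2)) \<longlonglongrightarrow> ennreal ((cmod (g z))^2)"
      using lim[OF True] by (intro tendsto_ennrealI tendsto_intros)
    from lim_imp_Liminf[OF _ this] show ?thesis using True by simp
  next
    case False
    then show ?thesis by (simp add: Liminf_const)
  qed
  then have "sq_mass M S g =
      (\<integral>\<^sup>+z. liminf (\<lambda>n. indicator S z * ennreal ((cmod (h n z))^2)) \<partial>M)"
    by simp
  also have "\<dots> \<le> liminf (\<lambda>n. \<integral>\<^sup>+z. indicator S z * ennreal ((cmod (h n z))^2) \<partial>M)"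
    by (rule nn_integral_liminf) fact
  also have "\<dots> \<le> liminf K"
    using K by (intro Liminf_mono) auto
  finally show ?thesis .
qed

section \<open>Distance to the boundary and small tails\<close>

lemma frontier_segmentI:
  fixes p w :: "'a::real_normed_vector"
  assumes S: "open S" and p: "p \<notin> S"
    and seg: "\<And>t. 0 \<le> t \<Longrightarrow> t < 1 \<Longrightarrow> w + t *\<^sub>R (p - w) \<in> S"
  shows "p \<in> frontier S"
proof -
  define t where "t n = 1 - inverse (real (Suc n))" for n
  have "t \<longlonglongrightarrow> 1 - 0"
    unfolding t_def by (intro tendsto_intros LIMSEQ_inverse_real_of_nat)
  then have "(\<lambda>n. w + t n *\<^sub>R (p - w)) \<longlonglongrightarrow> w + 1 *\<^sub>R (p - w)"
    by (intro tendsto_intros) simp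
  moreover have "w + t n *\<^sub>R (p - w) \<in> S" for n
    by (rule seg) (auto simp: t_def inverse_le_1_iff)
  ultimately have "p \<in> closure S"
    unfolding closure_sequential by (intro exI[of _ "\<lambda>n. w + t n *\<^sub>R (p - w)"]) auto
  then show ?thesis
    using S p by (simp add: frontier_def interior_open)
qed

text \<open>An explicit boundary point is reached along a segment inside H_k: either the second
  coordinate is pushed radially to the unit circle, or \<open>u\<close> is, with \<open>v\<close>
  held fixed.\<close>

lemma infdist_frontier_tail:
  assumes k: "k > 0" and w: "w \<in> tail k \<rho>"
  shows "infdist w (frontier (Hk k)) \<le> \<rho>"
proof -
  obtain u v where u: "cmod u < 1" and v: "v \<noteq> 0" "cmod v < 1" and wuv: "w = (u * v, v ^ k)"
    using Hk_paramE[of w k] w tail_subset k by blast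
  have "1 - cmod (v ^ k) \<le> \<rho> \<or> 1 - cmod u ^ k \<le> \<rho>"
    using w fst_param_ratio[OF v(1), of u k] by (auto simp: tail_def wuv)
  then have "\<exists>p\<in>frontier (Hk k). dist w p \<le> \<rho>"
  proof
    assume \<rho>: "1 - cmod (v ^ k) \<le> \<rho>"
    define e where "e = cmod (v ^ k)"
    have e: "0 < e" "e < 1" using v k by (auto simp: e_def norm_power cmod_lt_one_power_iff)
    have wH: "cmod (u * v) ^ k < e"
      using Hk_param[OF u v k] by (simp add: Hk_def e_def)
    define p where "p = (u * v, (1 / e) *\<^sub>R v ^ k)"
    show ?thesis
    proof (rule bexI)
      have "dist w p = cmod ((1 - 1 / e) *\<^sub>R v ^ k)"
        by (simp add: wuv p_def dist_Pair_Pair dist_norm scaleR_diff_left)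
      also have "\<dots> = 1 - e"
        using e by (simp add: abs_if e_def[symmetric] field_simps del: norm_scaleR)
           (simp add: e_def[symmetric] field_simps)
      finally show "dist w p \<le> \<rho>" using \<rho> by (simp add: e_def)
      show "p \<in> frontier (Hk k)"
      proof (rule frontier_segmentI[OF open_Hk, of _ _ w])
        show "p \<notin> Hk k" using e by (simp add: p_def Hk_def e_def)
        fix t :: real assume t: "0 \<le> t" "t < 1"
        define s where "s = 1 + t * (1 / e - 1)"
        have eq: "w + t *\<^sub>R (p - w) = (u * v, s *\<^sub>R v ^ k)"
        proof -
          have "v ^ k + t *\<^sub>R ((1 / e) *\<^sub>R v ^ k - v ^ k) = s *\<^sub>R v ^ k"
            by (simp only: s_def scaleR_add_left scaleR_one scaleR_diff_right scaleR_scaleR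
                right_diff_distrib scaleR_diff_left mult_1_right)
          then show ?thesis by (simp add: wuv p_def)
        qed
        have se: "s * e = e + t * (1 - e)"
          using e by (simp add: s_def field_simps)
        have "t * (1 - e) < 1 * (1 - e)" using t e by (intro mult_strict_right_mono) auto
        moreover have "0 \<le> t * (1 - e)" using t e by simp
        ultimately have 1: "e \<le> s * e" "s * e < 1" unfolding se by simp_all
        have "0 \<le> 1 / e - 1" using e by (simp add: le_divide_eq)
        then have "s \<ge> 0"
          unfolding s_def using t(1) by (intro add_nonneg_nonneg mult_nonneg_nonneg) auto
        then have n: "cmod (s *\<^sub>R v ^ k) = s * e" by (simp add: e_def)
        have "cmod (u * v) ^ k < cmod (s *\<^sub>R v ^ k)" "cmod (s *\<^sub>R v ^ k) < 1"
          unfolding n by (rule less_le_trans[OF wH 1(1)], rule 1(2))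
        then show "w + t *\<^sub>R (p - w) \<in> Hk k"
          unfolding eq Hk_def by (simp only: mem_Collect_eq fst_conv snd_conv)
      qed
    qed
  next
    assume \<rho>: "1 - cmod u ^ k \<le> \<rho>"
    \<comment> \<open>The direction of \<open>u\<close>; for \<open>u = 0\<close> any unit vector
      serves, and 1 is chosen.\<close>
    define a where "a = (if u = 0 then 1 else (1 / cmod u) *\<^sub>R u)"
    have a: "cmod a = 1" "u = cmod u *\<^sub>R a" by (auto simp: a_def)
    have au: "a - u = (1 - cmod u) *\<^sub>R a"
      using a(2) by (metis scaleR_diff_left scaleR_one)
    define p where "p = (a * v, v ^ k)"
    show ?thesis
    proof (rule bexI)
      have "dist w p = cmod ((a - u) * v)"
        by (simp add: wuv p_def dist_Pair_Pair dist_norm algebra_simps norm_minus_commute)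
      also have "\<dots> = (1 - cmod u) * cmod v"
        using u by (simp add: au norm_mult a(1))
      also have "\<dots> \<le> 1 - cmod u"
        using u v by (simp add: mult_left_le)
      also have "\<dots> \<le> \<rho>"
        using \<rho> one_diff_power_le(2)[of "cmod u" k] u k by simp
      finally show "dist w p \<le> \<rho>" .
      show "p \<in> frontier (Hk k)"
      proof (rule frontier_segmentI[OF open_Hk, of _ _ w])
        show "p \<notin> Hk k" by (simp add: p_def Hk_def norm_mult norm_power a(1))
        fix t :: real assume t: "0 \<le> t" "t < 1"
        have "w + t *\<^sub>R (p - w) = (((1 - t) *\<^sub>R u + t *\<^sub>R a) * v, v ^ k)"
          by (simp add: wuv p_def algebra_simps)
        moreover have "cmod ((1 - t) *\<^sub>R u + t *\<^sub>R a) < 1"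
        proof -
          have "cmod ((1 - t) *\<^sub>R u + t *\<^sub>R a) \<le> (1 - t) * cmod u + t * 1"
            using t a(1) norm_triangle_ineq[of "(1 - t) *\<^sub>R u" "t *\<^sub>R a"] by simp
          moreover have "(1 - t) * cmod u < (1 - t) * 1" using t u by (intro mult_strict_left_mono) auto
          ultimately show ?thesis by simp
        qed
        ultimately show "w + t *\<^sub>R (p - w) \<in> Hk k"
          using Hk_param[OF _ v k] by simp
      qed
    qed
  qed
  then obtain p where "p \<in> frontier (Hk k)" "dist w p \<le> \<rho>" by blast
  then show ?thesis by (meson infdist_le order_trans)
qed

text \<open>On the region |w2| \<ge> c met by the tail estimate the weight is at least c^\<delta>,
  so the hypothesis makes the unweighted Berezin transform small there.\<close>

lemma uniformly_small_tail:
  assumes k: "k > 0" and \<mu>: "fin_borel_on k \<mu>" and \<delta>: "\<delta> > 0"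
    and B: "tends0_bdry (Hk k) (\<lambda>w. ennreal (cmod (snd w) powr \<delta>) * B_mu k \<mu> w)"
    and \<epsilon>: "\<epsilon> > 0"
  obtains \<rho> where "\<rho> > 0"
    "\<And>f. f \<in> A2 k \<Longrightarrow> sq_mass \<mu> (tail k \<rho>) f \<le> ennreal \<epsilon> * normA2sq k f"
proof -
  obtain C c where C: "C > 0" "c > 0" and tl: "\<And>\<mu> f \<rho>. fin_borel_on k \<mu> \<Longrightarrow> f \<in> A2 k \<Longrightarrow>
      sq_mass \<mu> (tail k \<rho>) f \<le> ennreal C *
       (\<integral>\<^sup>+w. indicator (tail k (2 * real k * \<rho>) \<inter> {w. c \<le> cmod (snd w)}) w *
          B_mu k \<mu> w * ennreal ((cmod (f w))^2) \<partial>lborel)"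
    using tail_integral_le[OF k] by blast
  \<comment> \<open>Compensates in advance for the weight and for the constant of the tail
    estimate.\<close>
  define \<epsilon>' where "\<epsilon>' = c powr \<delta> * (\<epsilon> / C)"
  have "\<epsilon>' > 0" using C \<epsilon> by (simp add: \<epsilon>'_def)
  then obtain \<eta> where \<eta>: "\<eta> > 0" and small: "\<And>w. w \<in> Hk k \<Longrightarrow> infdist w (frontier (Hk k)) < \<eta> \<Longrightarrow>
      ennreal (cmod (snd w) powr \<delta>) * B_mu k \<mu> w < ennreal \<epsilon>'"
    using B unfolding tends0_bdry_def by metis
  \<comment> \<open>The tail that matters is the enlarged one, of width 2 k \<rho> = \<eta> /
    2.\<close>
  define \<rho> where "\<rho> = \<eta> / (4 * real k)"
  have \<rho>: "\<rho> > 0" "2 * real k * \<rho> < \<eta>" using \<eta> k by (auto simp: \<rho>_def)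
  define T where "T = tail k (2 * real k * \<rho>) \<inter> {w. c \<le> cmod (snd w)}"
  have BT: "B_mu k \<mu> w \<le> ennreal (\<epsilon> / C)" if w: "w \<in> T" for w
  proof -
    have "w \<in> Hk k" using w tail_subset by (auto simp: T_def)
    moreover have "infdist w (frontier (Hk k)) < \<eta>"
      using infdist_frontier_tail[OF k, of w "2 * real k * \<rho>"] w \<rho> by (simp add: T_def)
    ultimately have *: "ennreal (cmod (snd w) powr \<delta>) * B_mu k \<mu> w \<le> ennreal \<epsilon>'"
      using small by (simp add: less_imp_le)
    have "ennreal (c powr \<delta>) * B_mu k \<mu> w \<le> ennreal (cmod (snd w) powr \<delta>) * B_mu k \<mu> w"
      using w C \<delta> by (intro mult_right_mono ennreal_leI powr_mono2) (auto simp: T_def)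
    also note *
    also have "ennreal \<epsilon>' = ennreal (c powr \<delta>) * ennreal (\<epsilon> / C)"
      unfolding \<epsilon>'_def using C \<epsilon> by (intro ennreal_mult) auto
    finally have "ennreal (1 / c powr \<delta>) * (ennreal (c powr \<delta>) * B_mu k \<mu> w) \<le>
        ennreal (1 / c powr \<delta>) * (ennreal (c powr \<delta>) * ennreal (\<epsilon> / C))"
      by (rule mult_left_mono) simp
    then show ?thesis
      using C by (simp add: mult.assoc[symmetric] ennreal_mult[symmetric])
  qed
  show ?thesis
  proof (rule that[OF \<rho>(1)])
    fix f assume f: "f \<in> A2 k"
    have "sq_mass \<mu> (tail k \<rho>) f \<le> ennreal C *
       (\<integral>\<^sup>+w. indicator T w * B_mu k \<mu> w * ennreal ((cmod (f w))^2) \<partial>lborel)"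
      unfolding T_def by (rule tl[OF \<mu> f])
    also have "\<dots> \<le> ennreal C * (\<integral>\<^sup>+w. ennreal (\<epsilon> / C) * (indicator (Hk k) w * ennreal ((cmod (f w))^2)) \<partial>lborel)"
    proof (intro mult_left_mono nn_integral_mono)
      fix w :: c2
      show "indicator T w * B_mu k \<mu> w * ennreal ((cmod (f w))^2) \<le>
         ennreal (\<epsilon> / C) * (indicator (Hk k) w * ennreal ((cmod (f w))^2))"
      proof (cases "w \<in> T")
        case True
        then have "w \<in> Hk k" using tail_subset by (auto simp: T_def)
        then show ?thesis using True mult_right_mono[OF BT[OF True]] by simp
      qed simp
    qed simp
    also have "\<dots> = ennreal C * (ennreal (\<epsilon> / C) * normA2sq k f)"
      unfolding normA2sq_lborel using measurable_holo2_sq[OF A2_holo2[OF f]]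
      by (subst nn_integral_cmult) auto
    also have "\<dots> = ennreal \<epsilon> * normA2sq k f"
      using C \<epsilon> by (simp add: mult.assoc[symmetric] ennreal_mult[symmetric])
    finally show "sq_mass \<mu> (tail k \<rho>) f \<le> ennreal \<epsilon> * normA2sq k f" .
  qed
qed

section \<open>From small tails to compactness\<close>

lemma measurable_holo2_sq_subset:
  assumes "holo2 f (Hk k)" "S \<subseteq> Hk k" and [measurable]: "S \<in> sets borel"
  shows "sq_on S f \<in> borel_measurable borel"
proof -
  have [measurable]: "sq_on (Hk k) f \<in> borel_measurable borel"
    by (rule measurable_holo2_sq) fact
  have "(\<lambda>z. indicator S z * (indicator (Hk k) z * ennreal ((cmod (f z))^2))) \<in> borel_measurable borel"
    by measurable
  also have "(\<lambda>z. indicator S z * (indicator (Hk k) z * ennreal ((cmod (f z))^2))) = sq_on S f"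
    using assms(2) by (auto simp: fun_eq_iff indicator_def)
  finally show ?thesis .
qed

text \<open>A pointwise convergent subsequence converges in L^2(\<mu>): the tail is uniformly small
  by hypothesis, and off the tail the interior estimate gives a majorant that \<open>inv\<close>
  makes integrable, corner included. Holomorphy of the limit is never established; Fatou's lemma
  stands in for it.\<close>

lemma vanishing_if_small_tail:
  assumes k: "k > 0" and \<mu>: "carleson k \<mu>"
    and inv: "normL2sq k \<mu> (\<lambda>z. 1 / snd z) < \<infinity>"
    and small: "\<And>\<epsilon>. \<epsilon> > 0 \<Longrightarrow> \<exists>\<rho>>0. \<forall>f\<in>A2 k.
       (sq_mass \<mu> (tail k \<rho>) f) \<le> ennreal \<epsilon> * normA2sq k f"
  shows "vanishing k \<mu>"
  unfolding vanishing_def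
proof (intro conjI allI impI)
  show fin: "fin_borel_on k \<mu>" using \<mu> by (simp add: carleson_def)
  have [measurable_cong]: "sets \<mu> = sets borel" using fin by (simp add: fin_borel_on_def)
  obtain C0 where C0: "\<And>f. f \<in> A2 k \<Longrightarrow> normL2sq k \<mu> f \<le> ennreal C0 * normA2sq k f"
    using \<mu> by (auto simp: carleson_def)
  fix f :: "nat \<Rightarrow> c2 \<Rightarrow> complex"
  assume f: "\<forall>n. f n \<in> A2 k \<and> normA2sq k (f n) \<le> 1"
  obtain r where r: "strict_mono r" and conv: "\<And>z. z \<in> Hk k \<Longrightarrow> convergent (\<lambda>n. f (r n) z)"
    using A2_unit_ball_Montel[OF k, of f] f by blast
  define h where "h n = f (r n)" for n
  have h: "h n \<in> A2 k" "normA2sq k (h n) \<le> 1" for n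
    using f by (auto simp: h_def)
  \<comment> \<open>The value 0 outside H_k makes \<open>g\<close> the everywhere limit of the
    cut-off functions, hence Borel.\<close>
  define g where "g z = (if z \<in> Hk k then lim (\<lambda>n. h n z) else 0)" for z
  have lim: "(\<lambda>n. h n z) \<longlonglongrightarrow> g z" if "z \<in> Hk k" for z
    using conv[OF that] that by (simp add: g_def h_def convergent_LIMSEQ_iff)
  have hm: "(\<lambda>z. indicator (Hk k) z *\<^sub>R h n z) \<in> borel_measurable borel" for n
    by (intro measurable_restrict_continuous holo2_continuous_on[OF A2_holo2[OF h(1)]] open_Hk)
  have gm[measurable]: "g \<in> borel_measurable borel"
  proof (rule borel_measurable_LIMSEQ_metric[OF hm])
    fix z show "(\<lambda>n. indicator (Hk k) z *\<^sub>R h n z) \<longlonglongrightarrow> g z"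
      using lim[of z] by (cases "z \<in> Hk k") (auto simp: g_def)
  qed
  have msq: "sq_on S F \<in> borel_measurable \<mu>"
    if "F \<in> A2 k" "S \<subseteq> Hk k" "S \<in> sets borel" for S F
    using measurable_holo2_sq_subset[OF A2_holo2[OF that(1)] that(2,3)] by measurable
  have gfin: "normL2sq k \<mu> g < \<infinity>"
  proof -
    have "normL2sq k \<mu> g \<le> liminf (\<lambda>n. ennreal C0)"
      unfolding normL2sq_def
    proof (rule nn_integral_sq_limit_le[where h = h])
      show "sq_on (Hk k) (h n) \<in> borel_measurable \<mu>" for n
        by (rule msq[OF h(1)]) auto
      show "sq_mass \<mu> (Hk k) (h n) \<le> ennreal C0" for n
      proof -
        have "normL2sq k \<mu> (h n) \<le> ennreal C0 * 1"
          using C0[OF h(1)] mult_left_mono[OF h(2), of "ennreal C0"] by (rule order_trans) simp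
        then show ?thesis by (simp add: normL2sq_def)
      qed
    qed (rule lim)
    also have "\<dots> < \<infinity>" by (simp add: Liminf_const)
    finally show ?thesis .
  qed
  have "(\<lambda>n. normL2sq k \<mu> (\<lambda>z. h n z - g z)) \<longlonglongrightarrow> 0"
  proof (rule ennreal_tendsto_0I)
    fix e :: real assume e: "e > 0"
    \<comment> \<open>Two members of the unit ball differ by squared norm at most 4, so e/8 becomes
      e/2.\<close>
    obtain \<rho> where \<rho>: "\<rho> > 0" and sm: "\<And>F. F \<in> A2 k \<Longrightarrow>
       sq_mass \<mu> (tail k \<rho>) F \<le> ennreal (e / 8) * normA2sq k F"
      using small[of "e / 8"] e by auto
    \<comment> \<open>The tail hypothesis is applied to \<open>h n - h m\<close>, which is in A^2,
      and then m tends to infinity.\<close>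
    have tail: "sq_mass \<mu> (tail k \<rho>) (\<lambda>z. h n z - g z) \<le> ennreal (e / 2)" for n
    proof -
      have "sq_mass \<mu> (tail k \<rho>) (\<lambda>z. h n z - g z) \<le> liminf (\<lambda>m. ennreal (e / 2))"
      proof (rule nn_integral_sq_limit_le[where h = "\<lambda>m z. h n z - h m z"])
        fix m
        have d: "(\<lambda>z. h n z - h m z) \<in> A2 k" by (rule A2_diff(1)[OF h(1) h(1)])
        show "sq_on (tail k \<rho>) (\<lambda>z. h n z - h m z) \<in> borel_measurable \<mu>"
          by (rule msq[OF d tail_subset]) simp
        have "normA2sq k (\<lambda>z. h n z - h m z) \<le> 2 * normA2sq k (h n) + 2 * normA2sq k (h m)"
          by (rule A2_diff(2)[OF h(1) h(1)])
        also have "\<dots> \<le> 2 * 1 + 2 * 1"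
          by (intro add_mono mult_left_mono h(2)) auto
        also have "\<dots> = ennreal 4" by simp
        finally have "ennreal (e / 8) * normA2sq k (\<lambda>z. h n z - h m z) \<le> ennreal (e / 8) * ennreal 4"
          by (rule mult_left_mono) simp
        also have "\<dots> = ennreal (e / 2)"
          using e by (subst ennreal_mult[symmetric]) auto
        finally show "sq_mass \<mu> (tail k \<rho>) (\<lambda>z. h n z - h m z) \<le> ennreal (e / 2)"
          using sm[OF d] by (rule order_trans[rotated])
      next
        fix z assume "z \<in> tail k \<rho>"
        then have "z \<in> Hk k" using tail_subset by blast
        then show "(\<lambda>m. h n z - h m z) \<longlonglongrightarrow> h n z - g z"
          by (intro tendsto_diff tendsto_const lim)
      qed
      then show ?thesis by (simp add: Liminf_const)
    qed
    obtain c where c: "c > 0" and cb: "\<And>f z. f \<in> A2 k \<Longrightarrow> z \<in> Hk k - tail k \<rho> \<Longrightarrow>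
      ennreal (c * ((cmod (snd z))^2 * (cmod (f z))^2)) \<le> normA2sq k f"
      using interior_bound[OF k \<rho>] by blast
    define S where "S = Hk k - tail k \<rho>"
    have [measurable]: "S \<in> sets borel" unfolding S_def by measurable
    have SH: "S \<subseteq> Hk k" by (auto simp: S_def)
    have hb: "(cmod (h n z))^2 \<le> (1 / c) * (cmod (1 / snd z))^2" if z: "z \<in> S" for n z
    proof -
      have "ennreal (c * ((cmod (snd z))^2 * (cmod (h n z))^2)) \<le> ennreal 1"
        using order_trans[OF cb[OF h(1) z[unfolded S_def]] h(2)] by (simp only: ennreal_1)
      then have "c * ((cmod (snd z))^2 * (cmod (h n z))^2) \<le> 1"
        by (simp only: ennreal_le_iff[OF zero_le_one])
      then show ?thesis
        using c Hk_snd_pos[of z k] z SH by (auto simp: norm_divide power_divide field_simps)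
    qed
    have gb: "(cmod (g z))^2 \<le> (1 / c) * (cmod (1 / snd z))^2" if z: "z \<in> S" for z
    proof (rule LIMSEQ_le_const2)
      show "(\<lambda>n. (cmod (h n z))^2) \<longlonglongrightarrow> (cmod (g z))^2"
        using lim[of z] z SH by (intro tendsto_intros) auto
    qed (use hb[OF z] in auto)
    have "(\<lambda>n. \<integral>\<^sup>+z. indicator S z * ennreal ((cmod (h n z - g z))^2) \<partial>\<mu>) \<longlonglongrightarrow> (\<integral>\<^sup>+z. 0 \<partial>\<mu>)"
    proof (rule nn_integral_dominated_convergence[where w = "\<lambda>z. ennreal (4 / c) * (indicator (Hk k) z * ennreal ((cmod (1 / snd z))^2))"])
      show "sq_on S (\<lambda>z. h n z - g z) \<in> borel_measurable \<mu>" for n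
      proof -
        note hm[of n, measurable]
        have "sq_on S (\<lambda>z. indicator (Hk k) z *\<^sub>R h n z - g z) \<in> borel_measurable \<mu>"
          by measurable
        also have "sq_on S (\<lambda>z. indicator (Hk k) z *\<^sub>R h n z - g z)
          = sq_on S (\<lambda>z. h n z - g z)"
          using SH by (auto simp: fun_eq_iff indicator_def)
        finally show ?thesis .
      qed
      show "(\<lambda>z. ennreal (4 / c) * (indicator (Hk k) z * ennreal ((cmod (1 / snd z))^2))) \<in> borel_measurable \<mu>"
        by measurable
      show "(\<integral>\<^sup>+z. ennreal (4 / c) * (indicator (Hk k) z * ennreal ((cmod (1 / snd z))^2)) \<partial>\<mu>) < \<infinity>"
        using inv unfolding normL2sq_def by (subst nn_integral_cmult) (auto simp: ennreal_mult_less_top)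
      show "AE z in \<mu>. indicator S z * ennreal ((cmod (h n z - g z))^2) \<le>
          ennreal (4 / c) * (indicator (Hk k) z * ennreal ((cmod (1 / snd z))^2))" for n
      proof (rule AE_I2)
        fix z
        show "indicator S z * ennreal ((cmod (h n z - g z))^2) \<le>
          ennreal (4 / c) * (indicator (Hk k) z * ennreal ((cmod (1 / snd z))^2))"
        proof (cases "z \<in> S")
          case True
          have "(cmod (h n z - g z))^2 \<le> (cmod (h n z) + cmod (g z))^2"
            by (intro power_mono norm_triangle_ineq4) auto
          also have "\<dots> \<le> 2 * (cmod (h n z))^2 + 2 * (cmod (g z))^2"
            using sum_squares_bound[of "cmod (h n z)" "cmod (g z)"] by (simp add: power2_sum)
          also have "\<dots> \<le> 2 * ((1 / c) * (cmod (1 / snd z))^2) + 2 * ((1 / c) * (cmod (1 / snd z))^2)"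
            using hb[OF True] gb[OF True] by (intro add_mono mult_left_mono) auto
          also have "\<dots> = (4 / c) * (cmod (1 / snd z))^2" by simp
          finally show ?thesis
            using True SH c by (auto simp: ennreal_mult[symmetric] intro!: ennreal_leI)
        qed simp
      qed
      show "AE z in \<mu>. (\<lambda>n. indicator S z * ennreal ((cmod (h n z - g z))^2)) \<longlonglongrightarrow> 0"
      proof (rule AE_I2)
        fix z
        show "(\<lambda>n. indicator S z * ennreal ((cmod (h n z - g z))^2)) \<longlonglongrightarrow> 0"
        proof (cases "z \<in> S")
          case True
          then have "(\<lambda>n. ennreal ((cmod (h n z - g z))^2)) \<longlonglongrightarrow> ennreal ((cmod (g z - g z))^2)"
            using lim[of z] SH by (intro tendsto_ennrealI tendsto_intros) auto
          then show ?thesis using True by simp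
        qed simp
      qed
    qed simp
    then have "\<forall>\<^sub>F n in sequentially. (sq_mass \<mu> S (\<lambda>z. h n z - g z)) < ennreal (e / 2)"
      using e by (intro order_tendstoD(2)) auto
    then show "\<forall>\<^sub>F n in sequentially. normL2sq k \<mu> (\<lambda>z. h n z - g z) \<le> ennreal e"
    proof eventually_elim
      case (elim n)
      note hm[of n, measurable]
      have split: "indicator (Hk k) z * ennreal ((cmod (h n z - g z))^2) =
         indicator (tail k \<rho>) z * ennreal ((cmod (h n z - g z))^2) +
         indicator S z * ennreal ((cmod (h n z - g z))^2)" for z
        using tail_subset[of k \<rho>] by (auto simp: S_def indicator_def)
      have m: "sq_on A (\<lambda>z. h n z - g z) \<in> borel_measurable \<mu>"
        if A: "A \<subseteq> Hk k" and [measurable]: "A \<in> sets borel" for A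
      proof -
        have "sq_on A (\<lambda>z. indicator (Hk k) z *\<^sub>R h n z - g z) \<in> borel_measurable \<mu>"
          by measurable
        also have "sq_on A (\<lambda>z. indicator (Hk k) z *\<^sub>R h n z - g z) =
          sq_on A (\<lambda>z. h n z - g z)"
          using A by (auto simp: fun_eq_iff indicator_def)
        finally show ?thesis .
      qed
      have "normL2sq k \<mu> (\<lambda>z. h n z - g z) =
         sq_mass \<mu> (tail k \<rho>) (\<lambda>z. h n z - g z) +
         sq_mass \<mu> S (\<lambda>z. h n z - g z)"
        unfolding normL2sq_def split
        by (rule nn_integral_add) (auto intro!: m tail_subset SH)
      also have "\<dots> \<le> ennreal (e / 2) + ennreal (e / 2)"
        using elim by (intro add_mono tail) auto
      also have "\<dots> = ennreal e"
        using e by (subst ennreal_plus[symmetric]) auto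
      finally show ?case .
    qed
  qed
  then show "\<exists>r g. strict_mono r \<and> g \<in> borel_measurable borel \<and> normL2sq k \<mu> g < \<infinity> \<and>
     (\<lambda>n. normL2sq k \<mu> (\<lambda>z. f (r n) z - g z)) \<longlonglongrightarrow> 0"
    using r gm gfin unfolding h_def by blast
qed

section \<open>Disc integrals\<close>

lemma dyadic_interval:
  fixes x :: real
  assumes "x \<ge> 1"
  obtains j where "2 ^ j \<le> x" "x < 2 ^ Suc j"
proof -
  obtain n where n: "x < 2 ^ n" using real_arch_pow[of 2 x] by auto
  define m where "m = (LEAST n. x < 2 ^ n)"
  have m: "x < 2 ^ m" unfolding m_def using n by (rule LeastI)
  then have "m \<noteq> 0" using assms by (intro notI) simp
  then obtain j where j: "m = Suc j" by (cases m) auto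
  have "\<not> x < 2 ^ j"
    using not_less_Least[of j "\<lambda>n. x < 2 ^ n"] j unfolding m_def by simp
  then show ?thesis using that[of j] m j by simp
qed

lemma sets_ball [measurable]: "ball (a :: 'a :: metric_space) r \<in> sets borel"
  by (intro borel_open open_ball)

text \<open>Replaces integration in polar coordinates: a function dominated by constants on
  concentric balls is dominated by their sum, and only areas of balls enter.\<close>

lemma nn_integral_le_dyadic:
  fixes g :: "complex \<Rightarrow> ennreal"
  assumes g: "\<And>\<eta>. g \<eta> \<noteq> 0 \<Longrightarrow> \<exists>j. \<eta> \<in> ball 0 (r j) \<and> g \<eta> \<le> ennreal (c j)"
    and nn: "\<And>j. r j \<ge> 0" "\<And>j. c j \<ge> 0" and s: "(\<lambda>j. c j * (pi * (r j)^2)) sums S"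
  shows "(\<integral>\<^sup>+\<eta>. g \<eta> \<partial>lborel) \<le> ennreal S"
proof -
  have "(\<integral>\<^sup>+\<eta>. g \<eta> \<partial>lborel) \<le> (\<integral>\<^sup>+\<eta>. (\<Sum>j. ennreal (c j) * indicator (ball 0 (r j)) \<eta>) \<partial>(lborel :: complex measure))"
  proof (rule nn_integral_mono)
    fix \<eta>
    show "g \<eta> \<le> (\<Sum>j. ennreal (c j) * indicator (ball 0 (r j)) \<eta>)"
    proof (cases "g \<eta> = 0")
      case False
      then obtain j where j: "\<eta> \<in> ball 0 (r j)" "g \<eta> \<le> ennreal (c j)" using g by blast
      have "g \<eta> \<le> (\<Sum>i\<in>{j}. ennreal (c i) * indicator (ball 0 (r i)) \<eta>)" using j by simp
      also have "\<dots> \<le> (\<Sum>j. ennreal (c j) * indicator (ball 0 (r j)) \<eta>)"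
        by (rule sum_le_suminf) auto
      finally show ?thesis .
    qed simp
  qed
  also have "\<dots> = (\<Sum>j. \<integral>\<^sup>+\<eta>. ennreal (c j) * indicator (ball 0 (r j)) \<eta> \<partial>(lborel :: complex measure))"
    by (rule nn_integral_suminf) auto
  also have "\<dots> = (\<Sum>j. ennreal (c j * (pi * (r j)^2)))"
    using nn by (intro suminf_cong) (subst nn_integral_cmult_indicator, auto simp: emeasure_ball_complex ennreal_mult)
  also have "\<dots> = ennreal S"
    using nn by (intro suminf_ennreal_eq[OF _ s]) auto
  finally show ?thesis .
qed

text \<open>On dyadic shells the area grows like 4^j while the integrand decays like 16^(-j). The
  resulting constant 16/3 is rounded up to 8.\<close>

lemma nn_integral_inverse_fourth:
  assumes \<rho>: "\<rho> > 0"
  shows "(\<integral>\<^sup>+\<eta>. indicator {\<eta>::complex. \<rho> \<le> cmod \<eta>} \<eta> * ennreal (1 / cmod \<eta> ^ 4) \<partial>lborel) \<le> ennreal (8 * pi / \<rho>^2)"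
proof -
  have "(\<lambda>j. (1 / 4) ^ j) sums (1 / (1 - 1 / 4 :: real))"
    by (rule geometric_sums) auto
  then have "(\<lambda>j. 4 * pi / \<rho>^2 * (1 / 4) ^ j) sums (4 * pi / \<rho>^2 * (1 / (1 - 1 / 4)))"
    by (rule sums_mult)
  moreover have "1 / (2 ^ j * \<rho>) ^ 4 * (pi * (2 ^ Suc j * \<rho>)^2) = 4 * pi / \<rho>^2 * (1 / 4) ^ j" for j
  proof -
    have e: "(4::real) ^ j = 2 ^ j * 2 ^ j" by (simp flip: power_mult_distrib)
    show ?thesis
      unfolding power_divide e using \<rho>
      by (simp add: power_mult_distrib divide_simps) (simp add: power2_eq_square power4_eq_xxxx)
  qed
  ultimately have s: "(\<lambda>j. 1 / (2 ^ j * \<rho>) ^ 4 * (pi * (2 ^ Suc j * \<rho>)^2)) sums (4 * pi / \<rho>^2 * (1 / (1 - 1 / 4)))"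
    by simp
  have "(\<integral>\<^sup>+\<eta>. indicator {\<eta>::complex. \<rho> \<le> cmod \<eta>} \<eta> * ennreal (1 / cmod \<eta> ^ 4) \<partial>lborel)
      \<le> ennreal (4 * pi / \<rho>^2 * (1 / (1 - 1 / 4)))"
  proof (rule nn_integral_le_dyadic[OF _ _ _ s])
    fix \<eta> :: complex
    assume "indicator {\<eta>. \<rho> \<le> cmod \<eta>} \<eta> * ennreal (1 / cmod \<eta> ^ 4) \<noteq> 0"
    then have \<eta>: "\<rho> \<le> cmod \<eta>" by (auto simp: indicator_def split: if_splits)
    then have "1 \<le> cmod \<eta> / \<rho>" using \<rho> by simp
    then obtain j where j: "2 ^ j \<le> cmod \<eta> / \<rho>" "cmod \<eta> / \<rho> < 2 ^ Suc j"
      by (rule dyadic_interval)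
    have j': "2 ^ j * \<rho> \<le> cmod \<eta>" "cmod \<eta> < 2 ^ Suc j * \<rho>"
      using j \<rho> by (simp_all only: pos_le_divide_eq pos_divide_less_eq)
    have "1 / cmod \<eta> ^ 4 \<le> 1 / (2 ^ j * \<rho>) ^ 4"
      using j' \<rho> by (intro frac_le power_mono zero_less_power mult_pos_pos) auto
    then show "\<exists>j. \<eta> \<in> ball 0 (2 ^ Suc j * \<rho>) \<and>
        indicator {\<eta>. \<rho> \<le> cmod \<eta>} \<eta> * ennreal (1 / cmod \<eta> ^ 4) \<le> ennreal (1 / (2 ^ j * \<rho>) ^ 4)"
      using j' \<eta> by (intro exI[of _ j]) (auto intro: ennreal_leI)
  qed (use \<rho> in auto)
  also have "\<dots> \<le> ennreal (8 * pi / \<rho>^2)"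
    using \<rho> by (intro ennreal_leI) (simp add: field_simps)
  finally show ?thesis .
qed

lemma nn_integral_powr_near_zero:
  assumes a: "0 \<le> a" "a < 2"
  obtains L where "L \<ge> 0"
    "(\<integral>\<^sup>+\<eta>. indicator (ball 0 1) \<eta> * ennreal (cmod \<eta> powr (- a)) \<partial>lborel) \<le> ennreal L"
proof -
  \<comment> \<open>The ratio of consecutive shells: the integrand gains 2^a, the area loses 4. It
    is below 1 exactly because a < 2.\<close>
  define q :: real where "q = 2 powr (a - 2)"
  have q: "0 < q" "q < 1"
    using a powr_less_mono[of "a - 2" 0 2] by (auto simp: q_def)
  have "(\<lambda>j. q ^ j) sums (1 / (1 - q))"
    using q by (intro geometric_sums) auto
  then have s0: "(\<lambda>j. 2 powr a * 4 * pi * q ^ j) sums (2 powr a * 4 * pi * (1 / (1 - q)))"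
    by (rule sums_mult)
  have eq: "2 powr (a * real (Suc j)) * (pi * (2 / 2 ^ j)^2) = 2 powr a * 4 * pi * q ^ j" for j
  proof -
    have "q ^ j = 2 powr ((a - 2) * real j)"
      unfolding q_def by (simp add: powr_power mult.commute)
    also have "\<dots> = 2 powr (a * real j) / 2 powr (2 * real j)"
      by (simp add: left_diff_distrib powr_diff)
    also have "2 powr (2 * real j) = (2 ^ j)^2"
      by (simp add: powr_realpow[symmetric] powr_powr powr_mult_base mult.commute flip: powr_numeral)
    finally have "q ^ j = 2 powr (a * real j) / (2 ^ j)^2" .
    moreover have "2 powr (a * real (Suc j)) = 2 powr a * 2 powr (a * real j)"
      by (simp add: powr_add[symmetric] algebra_simps)
    ultimately show ?thesis
      by (simp add: power_divide)
  qed
  show ?thesis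
  proof (rule that[of "2 powr a * 4 * pi * (1 / (1 - q))"])
    show "0 \<le> 2 powr a * 4 * pi * (1 / (1 - q))" using q by simp
    show "(\<integral>\<^sup>+\<eta>. indicator (ball 0 1) \<eta> * ennreal (cmod \<eta> powr (- a)) \<partial>lborel)
       \<le> ennreal (2 powr a * 4 * pi * (1 / (1 - q)))"
    \<comment> \<open>Shell j gives |\<eta>| \<le> 2^(-j) with equality possible, so the open ball
      gets twice this radius.\<close>
    proof (rule nn_integral_le_dyadic[where r = "\<lambda>j. 2 / 2 ^ j" and c = "\<lambda>j. 2 powr (a * real (Suc j))"])
      show "(\<lambda>j. 2 powr (a * real (Suc j)) * (pi * (2 / 2 ^ j)^2)) sums (2 powr a * 4 * pi * (1 / (1 - q)))"
        unfolding eq by (rule s0)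
      fix \<eta> :: complex
      assume nz: "indicator (ball 0 1) \<eta> * ennreal (cmod \<eta> powr (- a)) \<noteq> 0"
      then have \<eta>: "cmod \<eta> < 1" by (auto simp: indicator_def split: if_splits)
      have \<eta>0: "0 < cmod \<eta>" using nz by (auto simp: indicator_def split: if_splits)
      have "1 \<le> 1 / cmod \<eta>" using \<eta> \<eta>0 by simp
      then obtain j where j: "2 ^ j \<le> 1 / cmod \<eta>" "1 / cmod \<eta> < 2 ^ Suc j"
        by (rule dyadic_interval)
      have "cmod \<eta> \<le> 1 / 2 ^ j"
        using j \<eta>0 by (simp add: field_simps)
      also have "\<dots> < 2 / 2 ^ j" by (simp add: divide_strict_right_mono)
      finally have 1: "\<eta> \<in> ball 0 (2 / 2 ^ j)" by simp
      have "cmod \<eta> powr (- a) = (1 / cmod \<eta>) powr a"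
        using \<eta>0 by (simp add: powr_minus_divide powr_divide)
      also have "\<dots> \<le> (2 ^ Suc j) powr a"
        using j \<eta>0 a by (intro powr_mono2) auto
      also have "\<dots> = 2 powr (a * real (Suc j))"
        by (simp only: powr_realpow[symmetric, of 2] powr_powr zero_less_numeral mult.commute)
      finally have "cmod \<eta> powr (- a) \<le> 2 powr (a * real (Suc j))" .
      then show "\<exists>j. \<eta> \<in> ball 0 (2 / 2 ^ j) \<and>
          indicator (ball 0 1) \<eta> * ennreal (cmod \<eta> powr (- a)) \<le> ennreal (2 powr (a * real (Suc j)))"
        using 1 \<eta> by (intro exI[of _ j]) (auto intro: ennreal_leI)
    qed auto
  qed
qed

text \<open>For small \<open>c\<close> the integrand is bounded by 16. Otherwise the pole 1/c is
  translated to the origin; the disc keeps distance 1/|c| - 1 \<ge> 1 - |c| from it, and the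
  integral of the inverse fourth power applies. The factor 16 reappears from |c| \<ge> 1/2, giving
  16 * 8.\<close>

lemma nn_integral_disc_kernel:
  fixes c :: complex
  assumes c: "cmod c < 1"
  shows "(\<integral>\<^sup>+\<xi>. indicator (ball 0 1) \<xi> * ennreal (1 / cmod (1 - c * \<xi>) ^ 4) \<partial>lborel) \<le> ennreal (128 * pi / (1 - cmod c)^2)"
proof (cases "cmod c < 1 / 2")
  case True
  have "(\<integral>\<^sup>+\<xi>. indicator (ball 0 1) \<xi> * ennreal (1 / cmod (1 - c * \<xi>) ^ 4) \<partial>lborel) \<le>
     (\<integral>\<^sup>+\<xi>. ennreal 16 * indicator (ball 0 1) \<xi> \<partial>(lborel :: complex measure))"
  proof (rule nn_integral_mono)
    fix \<xi> :: complex
    show "indicator (ball 0 1) \<xi> * ennreal (1 / cmod (1 - c * \<xi>) ^ 4) \<le> ennreal 16 * indicator (ball 0 1) \<xi>"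
    proof (cases "\<xi> \<in> ball 0 1")
      case \<xi>: True
      have "cmod (c * \<xi>) \<le> (1 / 2) * 1"
        unfolding norm_mult using True \<xi> by (intro mult_mono) auto
      then have h: "1 / 2 \<le> cmod (1 - c * \<xi>)"
        using norm_triangle_ineq2[of 1 "c * \<xi>"] by simp
      then have "(1 / 2) ^ 4 \<le> cmod (1 - c * \<xi>) ^ 4" by (intro power_mono) auto
      then have "1 / cmod (1 - c * \<xi>) ^ 4 \<le> 1 / (1 / 2) ^ 4"
        using h by (intro divide_left_mono mult_pos_pos) (auto intro: less_le_trans[of 0 "1/2"])
      then show ?thesis using \<xi> by (auto intro: ennreal_leI simp: power_divide simp del: ennreal_numeral)
    qed simp
  qed
  also have "\<dots> = ennreal (16 * pi)"
    by (subst nn_integral_cmult_indicator) (auto simp: emeasure_ball_complex ennreal_mult simp del: ennreal_numeral)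
  also have "\<dots> \<le> ennreal (128 * pi / (1 - cmod c)^2)"
  proof (rule ennreal_leI)
    have "(1 - cmod c)^2 \<le> 1" using c by (intro power_le_one) auto
    then have "16 * pi * (1 - cmod c)^2 \<le> 16 * pi * 1" by (intro mult_left_mono) auto
    also have "\<dots> \<le> 128 * pi" by simp
    finally show "16 * pi \<le> 128 * pi / (1 - cmod c)^2"
      using c by (simp add: pos_le_divide_eq)
  qed
  finally show ?thesis .
next
  case False
  define a where "a = 1 - cmod c"
  have a: "a > 0" using c by (simp add: a_def)
  have c0: "c \<noteq> 0" using False by auto
  define h :: "complex \<Rightarrow> ennreal" where "h \<eta> = indicator {\<eta>. a \<le> cmod \<eta>} \<eta> * ennreal (1 / cmod \<eta> ^ 4)" for \<eta>
  have [measurable]: "h \<in> borel_measurable borel"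
    unfolding h_def by measurable
  have "(\<integral>\<^sup>+\<xi>. indicator (ball 0 1) \<xi> * ennreal (1 / cmod (1 - c * \<xi>) ^ 4) \<partial>lborel) \<le>
     (\<integral>\<^sup>+\<xi>. ennreal 16 * h (- (1 / c) + \<xi>) \<partial>lborel)"
  proof (rule nn_integral_mono)
    fix \<xi> :: complex
    show "indicator (ball 0 1) \<xi> * ennreal (1 / cmod (1 - c * \<xi>) ^ 4) \<le> ennreal 16 * h (- (1 / c) + \<xi>)"
    proof (cases "\<xi> \<in> ball 0 1")
      case True
      define \<eta> where "\<eta> = - (1 / c) + \<xi>"
      have "1 - c * \<xi> = - (c * \<eta>)" using c0 by (simp add: \<eta>_def algebra_simps)
      then have n: "cmod (1 - c * \<xi>) = cmod c * cmod \<eta>" by (simp add: norm_mult)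
      have "1 / cmod c - 1 \<le> cmod \<eta>"
        using norm_triangle_ineq2[of "1 / c" \<xi>] True by (simp add: \<eta>_def norm_divide norm_minus_commute)
      moreover have "1 - cmod c \<le> 1 / cmod c - 1"
      proof -
        have "2 * cmod c \<le> 1 + cmod c * cmod c"
          using sum_squares_bound[of 1 "cmod c"] by (simp add: power2_eq_square)
        then show ?thesis using c0 by (simp add: field_simps)
      qed
      ultimately have \<eta>: "a \<le> cmod \<eta>" by (simp add: a_def)
      have "((1 / 2) * cmod \<eta>) ^ 4 \<le> cmod (1 - c * \<xi>) ^ 4"
        unfolding n using False by (intro power_mono mult_right_mono) auto
      then have "1 / cmod (1 - c * \<xi>) ^ 4 \<le> 1 / ((1 / 2) * cmod \<eta>) ^ 4"
        using \<eta> a c0 by (intro divide_left_mono mult_pos_pos) (auto simp: n intro!: zero_less_power mult_pos_pos)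
      also have "\<dots> = 16 * (1 / cmod \<eta> ^ 4)" by (simp add: power_divide)
      finally have "ennreal (1 / cmod (1 - c * \<xi>) ^ 4) \<le> ennreal 16 * ennreal (1 / cmod \<eta> ^ 4)"
        by (subst ennreal_mult[symmetric]) (auto intro: ennreal_leI)
      then show ?thesis using True \<eta> by (simp add: h_def \<eta>_def del: ennreal_numeral)
    qed simp
  qed
  also have "\<dots> = ennreal 16 * (\<integral>\<^sup>+\<xi>. h \<xi> \<partial>lborel)"
    by (subst nn_integral_cmult, measurable) (subst nn_integral_complex_translate, auto)
  also have "\<dots> \<le> ennreal 16 * ennreal (8 * pi / a^2)"
    unfolding h_def using nn_integral_inverse_fourth[OF a] by (intro mult_left_mono) auto
  also have "\<dots> = ennreal (128 * pi / (1 - cmod c)^2)"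
    unfolding a_def by (subst ennreal_mult[symmetric]) auto
  finally show ?thesis .
qed

text \<open>Averaging a geometric series over the k-th roots of unity keeps only the exponents
  divisible by \<open>k\<close>. Written with finite sums of length \<open>k\<close>, only the
  exponent 0 survives.\<close>

lemma sum_inverse_roots_unity:
  fixes \<eta> :: complex
  assumes k: "k > 0" and \<eta>: "cmod \<eta> < 1"
  defines "\<omega> \<equiv> cis (2 * pi / real k)"
  shows "(\<Sum>j<k. 1 / (1 - \<omega> ^ j * \<eta>)) = of_nat k / (1 - \<eta> ^ k)"
proof -
  have wk: "\<omega> ^ k = 1"
    unfolding \<omega>_def Complex.DeMoivre using k by simp
  have wn: "\<omega> ^ n \<noteq> 1" if "0 < n" "n < k" for n
  proof
    assume "\<omega> ^ n = 1"
    then have "cis (real n * (2 * pi / real k)) = 1" by (simp add: \<omega>_def Complex.DeMoivre)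
    then obtain m :: int where "real n * (2 * pi / real k) = 2 * pi * of_int m"
      by (auto simp: complex_eq_iff cos_one_2pi_int mult_ac)
    then have "(2 * pi) * (real n / real k) = (2 * pi) * of_int m" by (simp add: mult_ac)
    then have "real n / real k = of_int m" by (subst (asm) mult_left_cancel) auto
    moreover have "0 < real n / real k" "real n / real k < 1" using that by auto
    ultimately have "0 < real_of_int m" "real_of_int m < 1" by metis+
    then have "0 < m" "m < 1" by simp_all
    then show False by simp
  qed
  have ek: "\<eta> ^ k \<noteq> 1"
  proof
    assume "\<eta> ^ k = 1"
    then have "cmod \<eta> ^ k = 1" by (metis norm_one norm_power)
    then show False using \<eta> k cmod_lt_one_power_iff[OF k, of \<eta>] by simp
  qed
  have summand: "1 / (1 - \<omega> ^ j * \<eta>) = (\<Sum>n<k. (\<omega> ^ j * \<eta>) ^ n) / (1 - \<eta> ^ k)" for j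
  proof -
    have "(\<omega> ^ j * \<eta>) ^ k = \<eta> ^ k"
      by (simp add: power_mult_distrib power_mult[symmetric] mult.commute[of j] power_mult wk)
    then have prod: "1 - \<eta> ^ k = (1 - \<omega> ^ j * \<eta>) * (\<Sum>n<k. (\<omega> ^ j * \<eta>) ^ n)"
      using one_diff_power_eq[of "\<omega> ^ j * \<eta>" k] by simp
    have cancel: "1 / B = S / A" if "A = B * S" "A \<noteq> 0" for A B S :: complex
      using that by (auto simp: field_simps)
    show ?thesis
      by (rule cancel[OF prod]) (use ek in simp)
  qed
  have "(\<Sum>j<k. 1 / (1 - \<omega> ^ j * \<eta>)) = (\<Sum>j<k. \<Sum>n<k. (\<omega> ^ j * \<eta>) ^ n) / (1 - \<eta> ^ k)"
    unfolding summand by (simp add: sum_divide_distrib)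
  also have "(\<Sum>j<k. \<Sum>n<k. (\<omega> ^ j * \<eta>) ^ n) = (\<Sum>n<k. \<eta> ^ n * (\<Sum>j<k. (\<omega> ^ n) ^ j))"
    by (subst sum.swap) (simp add: power_mult_distrib power_mult[symmetric] mult.commute sum_distrib_left)
  also have "\<dots> = (\<Sum>n<k. if n = 0 then of_nat k else 0)"
  proof (rule sum.cong)
    fix n assume n: "n \<in> {..<k}"
    show "\<eta> ^ n * (\<Sum>j<k. (\<omega> ^ n) ^ j) = (if n = 0 then of_nat k else 0)"
    proof (cases "n = 0")
      case False
      have "(\<omega> ^ n) ^ k = 1" by (metis mult.commute power_mult power_one wk)
      then have "(\<Sum>j<k. (\<omega> ^ n) ^ j) = 0"
        using wn[of n] n False by (simp add: geometric_sum)
      then show ?thesis using False by simp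
    qed simp
  qed simp
  also have "\<dots> = of_nat k" using k by (subst sum.delta) auto
  finally show ?thesis .
qed

text \<open>One of the \<open>k\<close> terms is at least their mean, and the mean dominates 1 / |1
  - \<eta>^k|; its fourth power is one of the summands on the right.\<close>

lemma inverse_one_minus_power_le:
  fixes \<eta> :: complex
  assumes k: "k > 0" and \<eta>: "cmod \<eta> < 1"
  shows "1 / cmod (1 - \<eta> ^ k) ^ 4 \<le> (\<Sum>j<k. 1 / cmod (1 - cis (2 * pi / real k) ^ j * \<eta>) ^ 4)"
proof -
  define x where "x j = 1 / cmod (1 - cis (2 * pi / real k) ^ j * \<eta>)" for j
  have "real k * (1 / cmod (1 - \<eta> ^ k)) = cmod (of_nat k / (1 - \<eta> ^ k))"
    by (simp add: norm_divide)
  also have "\<dots> \<le> (\<Sum>j<k. x j)"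
    unfolding sum_inverse_roots_unity[OF k \<eta>, symmetric] x_def
    by (rule order_trans[OF norm_sum]) (simp add: norm_divide)
  finally have le: "(\<Sum>j<k. 1 / cmod (1 - \<eta> ^ k)) \<le> (\<Sum>j<k. x j)" by simp
  have "\<exists>j<k. 1 / cmod (1 - \<eta> ^ k) \<le> x j"
  proof (rule ccontr)
    assume "\<not> (\<exists>j<k. 1 / cmod (1 - \<eta> ^ k) \<le> x j)"
    then have "(\<Sum>j<k. x j) < (\<Sum>j<k. 1 / cmod (1 - \<eta> ^ k))"
      using k by (intro sum_strict_mono) auto
    then show False using le by simp
  qed
  then obtain j where j: "j < k" "1 / cmod (1 - \<eta> ^ k) \<le> x j" by blast
  have "1 / cmod (1 - \<eta> ^ k) ^ 4 = (1 / cmod (1 - \<eta> ^ k)) ^ 4" by (simp add: power_divide)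
  also have "\<dots> \<le> x j ^ 4" using j by (intro power_mono) auto
  also have "\<dots> \<le> (\<Sum>j<k. x j ^ 4)"
    using j by (intro member_le_sum) (auto simp: x_def)
  finally show ?thesis by (simp add: x_def power_divide)
qed

text \<open>With a k-th root \<open>d\<close> of \<open>c\<close> the power kernel is dominated by
  \<open>k\<close> rotated copies of the plain one. Returning from 1 - |d| to 1 - |c| costs k^2,
  which makes k^3 in total.\<close>

lemma nn_integral_disc_power_kernel:
  fixes c :: complex
  assumes k: "k > 0" and c: "cmod c < 1"
  shows "(\<integral>\<^sup>+\<xi>. indicator (ball 0 1) \<xi> * ennreal (1 / cmod (1 - c * \<xi> ^ k) ^ 4) \<partial>lborel) \<le>
    ennreal (real k ^ 3 * (128 * pi) / (1 - cmod c)^2)"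
proof -
  obtain d where d: "d ^ k = c"
  proof (cases "c = 0")
    case True
    then show ?thesis using that[of 0] k by simp
  next
    case False
    then show ?thesis using that[of "exp (Ln c / of_nat k)"] k by (simp add: exp_of_nat_mult[symmetric])
  qed
  have dk: "cmod d ^ k = cmod c" by (simp add: d norm_power[symmetric])
  have d1: "cmod d < 1" using c dk cmod_lt_one_power_iff[OF k, of d] by simp
  define \<omega> where "\<omega> = cis (2 * pi / real k)"
  have "(\<integral>\<^sup>+\<xi>. indicator (ball 0 1) \<xi> * ennreal (1 / cmod (1 - c * \<xi> ^ k) ^ 4) \<partial>lborel) \<le>
    (\<integral>\<^sup>+\<xi>. (\<Sum>j<k. indicator (ball 0 1) \<xi> * ennreal (1 / cmod (1 - (\<omega> ^ j * d) * \<xi>) ^ 4)) \<partial>lborel)"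
  proof (rule nn_integral_mono)
    fix \<xi> :: complex
    show "indicator (ball 0 1) \<xi> * ennreal (1 / cmod (1 - c * \<xi> ^ k) ^ 4) \<le>
      (\<Sum>j<k. indicator (ball 0 1) \<xi> * ennreal (1 / cmod (1 - (\<omega> ^ j * d) * \<xi>) ^ 4))"
    proof (cases "\<xi> \<in> ball 0 1")
      case True
      have "cmod (d * \<xi>) < 1"
        using True d1 mult_strict_mono'[of "cmod d" 1 "cmod \<xi>" 1] by (simp add: norm_mult)
      from inverse_one_minus_power_le[OF k this]
      have "1 / cmod (1 - c * \<xi> ^ k) ^ 4 \<le> (\<Sum>j<k. 1 / cmod (1 - (\<omega> ^ j * d) * \<xi>) ^ 4)"
        by (simp add: power_mult_distrib d \<omega>_def mult.assoc)
      then have "ennreal (1 / cmod (1 - c * \<xi> ^ k) ^ 4) \<le> (\<Sum>j<k. ennreal (1 / cmod (1 - (\<omega> ^ j * d) * \<xi>) ^ 4))"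
        by (subst sum_ennreal) (auto intro: ennreal_leI)
      then show ?thesis using True by simp
    qed simp
  qed
  also have "\<dots> = (\<Sum>j<k. \<integral>\<^sup>+\<xi>. indicator (ball 0 1) \<xi> * ennreal (1 / cmod (1 - (\<omega> ^ j * d) * \<xi>) ^ 4) \<partial>lborel)"
    by (rule nn_integral_sum) measurable
  also have "\<dots> \<le> (\<Sum>j<k. ennreal (128 * pi / (1 - cmod d)^2))"
  proof (rule sum_mono)
    fix j
    have "cmod (\<omega> ^ j * d) = cmod d" by (simp add: norm_mult norm_power \<omega>_def)
    then show "(\<integral>\<^sup>+\<xi>. indicator (ball 0 1) \<xi> * ennreal (1 / cmod (1 - (\<omega> ^ j * d) * \<xi>) ^ 4) \<partial>lborel) \<le>
       ennreal (128 * pi / (1 - cmod d)^2)"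
      using nn_integral_disc_kernel[of "\<omega> ^ j * d"] d1 by simp
  qed
  also have "\<dots> = ennreal (real k * (128 * pi / (1 - cmod d)^2))"
    by (simp add: ennreal_of_nat_eq_real_of_nat ennreal_mult[symmetric])
  also have "\<dots> \<le> ennreal (real k ^ 3 * (128 * pi) / (1 - cmod c)^2)"
  proof (rule ennreal_leI)
    have "1 - cmod c \<le> real k * (1 - cmod d)"
      using one_diff_power_le(1)[of "cmod d" k] d1 k dk by simp
    then have "(1 - cmod c)^2 \<le> (real k * (1 - cmod d))^2"
      using c by (intro power_mono) auto
    then have "1 / (real k * (1 - cmod d))^2 \<le> 1 / (1 - cmod c)^2"
      using c d1 k by (intro divide_left_mono) auto
    then have "real k ^ 3 * (128 * pi) * (1 / (real k * (1 - cmod d))^2) \<le> real k ^ 3 * (128 * pi) * (1 / (1 - cmod c)^2)"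
      by (intro mult_left_mono) auto
    moreover have "real k ^ 3 * (128 * pi) * (1 / (real k * (1 - cmod d))^2) = real k * (128 * pi / (1 - cmod d)^2)"
      using k by (simp add: power_mult_distrib power3_eq_cube power2_eq_square)
    ultimately show "real k * (128 * pi / (1 - cmod d)^2) \<le> real k ^ 3 * (128 * pi) / (1 - cmod c)^2"
      by simp
  qed
  finally show ?thesis .
qed

text \<open>The weight and the kernel are singular at different places. For |\<xi>| < 1/2 the kernel
  is at most 16, elsewhere the weight is at most 2^a \<le> 4, so the product is bounded by a sum of
  separately integrable terms.\<close>

lemma nn_integral_disc_weighted_kernel:
  assumes a: "0 \<le> a" "a < 2"
  obtains L where "L \<ge> 0" "\<And>c. cmod c < 1 \<Longrightarrow>
    (\<integral>\<^sup>+\<xi>. indicator (ball 0 1) \<xi> * ennreal (cmod \<xi> powr (- a) / cmod (1 - c * \<xi>) ^ 4) \<partial>lborel)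
      \<le> ennreal (L / (1 - cmod c)^2)"
proof -
  obtain L0 where L0: "L0 \<ge> 0"
    "(\<integral>\<^sup>+\<eta>. indicator (ball 0 1) \<eta> * ennreal (cmod \<eta> powr (- a)) \<partial>lborel) \<le> ennreal L0"
    using nn_integral_powr_near_zero[OF a] .
  show ?thesis
  proof (rule that[of "16 * L0 + 4 * (128 * pi)"])
    show "0 \<le> 16 * L0 + 4 * (128 * pi)" using L0 by simp
    fix c :: complex assume c: "cmod c < 1"
    have "(\<integral>\<^sup>+\<xi>. indicator (ball 0 1) \<xi> * ennreal (cmod \<xi> powr (- a) / cmod (1 - c * \<xi>) ^ 4) \<partial>lborel) \<le>
       (\<integral>\<^sup>+\<xi>. ennreal 16 * (indicator (ball 0 1) \<xi> * ennreal (cmod \<xi> powr (- a))) +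
          ennreal 4 * (indicator (ball 0 1) \<xi> * ennreal (1 / cmod (1 - c * \<xi>) ^ 4)) \<partial>lborel)"
    proof (rule nn_integral_mono)
      fix \<xi> :: complex
      show "indicator (ball 0 1) \<xi> * ennreal (cmod \<xi> powr (- a) / cmod (1 - c * \<xi>) ^ 4) \<le>
         ennreal 16 * (indicator (ball 0 1) \<xi> * ennreal (cmod \<xi> powr (- a))) +
          ennreal 4 * (indicator (ball 0 1) \<xi> * ennreal (1 / cmod (1 - c * \<xi>) ^ 4))"
      proof (cases "\<xi> \<in> ball 0 1")
        case True
        have "cmod \<xi> powr (- a) / cmod (1 - c * \<xi>) ^ 4 \<le>
            16 * cmod \<xi> powr (- a) + 4 * (1 / cmod (1 - c * \<xi>) ^ 4)"
        proof (cases "cmod \<xi> < 1 / 2")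
          case small: True
          have "cmod (c * \<xi>) \<le> 1 * (1 / 2)"
            unfolding norm_mult using c small by (intro mult_mono) auto
          then have h: "1 / 2 \<le> cmod (1 - c * \<xi>)"
            using norm_triangle_ineq2[of 1 "c * \<xi>"] by simp
          then have "(1 / 2) ^ 4 \<le> cmod (1 - c * \<xi>) ^ 4" by (intro power_mono) auto
          then have "cmod \<xi> powr (- a) / cmod (1 - c * \<xi>) ^ 4 \<le> cmod \<xi> powr (- a) / (1 / 2) ^ 4"
            using h by (intro divide_left_mono mult_pos_pos) (auto intro: less_le_trans[of 0 "1/2"])
          also have "\<dots> = 16 * cmod \<xi> powr (- a)" by (simp add: power_divide)
          finally show ?thesis by (simp add: add_increasing2)
        next
          case False
          have "cmod \<xi> powr (- a) \<le> (1 / 2) powr (- a)"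
            using False a by (intro powr_mono2') auto
          also have "\<dots> = 2 powr a"
            by (simp add: powr_minus_divide powr_divide)
          also have "\<dots> \<le> 2 powr 2" using a by (intro powr_mono) auto
          finally have "cmod \<xi> powr (- a) \<le> 4" by simp
          then have "cmod \<xi> powr (- a) / cmod (1 - c * \<xi>) ^ 4 \<le> 4 / cmod (1 - c * \<xi>) ^ 4"
            by (intro divide_right_mono) auto
          then show ?thesis by (simp add: add_increasing)
        qed
        then have "ennreal (cmod \<xi> powr (- a) / cmod (1 - c * \<xi>) ^ 4) \<le>
          ennreal 16 * ennreal (cmod \<xi> powr (- a)) + ennreal 4 * ennreal (1 / cmod (1 - c * \<xi>) ^ 4)"
          by (simp add: ennreal_mult[symmetric] ennreal_plus[symmetric] ennreal_leI del: ennreal_plus ennreal_numeral)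
        then show ?thesis using True by simp
      qed simp
    qed
    also have "\<dots> = ennreal 16 * (\<integral>\<^sup>+\<xi>. indicator (ball 0 1) \<xi> * ennreal (cmod \<xi> powr (- a)) \<partial>lborel) +
       ennreal 4 * (\<integral>\<^sup>+\<xi>. indicator (ball 0 1) \<xi> * ennreal (1 / cmod (1 - c * \<xi>) ^ 4) \<partial>lborel)"
      by (subst nn_integral_add) (auto simp: nn_integral_cmult simp del: ennreal_numeral)
    also have "\<dots> \<le> ennreal 16 * ennreal L0 + ennreal 4 * ennreal (128 * pi / (1 - cmod c)^2)"
      by (intro add_mono mult_left_mono L0 nn_integral_disc_kernel c) auto
    also have "\<dots> = ennreal (16 * L0 + 4 * (128 * pi / (1 - cmod c)^2))"
      using L0 by (simp add: ennreal_mult[symmetric] ennreal_plus[symmetric] del: ennreal_plus ennreal_numeral)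
    also have "\<dots> \<le> ennreal ((16 * L0 + 4 * (128 * pi)) / (1 - cmod c)^2)"
    proof (rule ennreal_leI)
      have "(1 - cmod c)^2 \<le> 1" using c by (intro power_le_one) auto
      then have "16 * L0 * (1 - cmod c)^2 \<le> 16 * L0 * 1" using L0 by (intro mult_left_mono) auto
      then have "16 * L0 \<le> 16 * L0 / (1 - cmod c)^2"
        using c by (simp add: pos_le_divide_eq)
      then show "16 * L0 + 4 * (128 * pi / (1 - cmod c)^2) \<le> (16 * L0 + 4 * (128 * pi)) / (1 - cmod c)^2"
        by (simp add: add_divide_distrib)
    qed
    finally show "(\<integral>\<^sup>+\<xi>. indicator (ball 0 1) \<xi> * ennreal (cmod \<xi> powr (- a) / cmod (1 - c * \<xi>) ^ 4) \<partial>lborel)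
      \<le> ennreal ((16 * L0 + 4 * (128 * pi)) / (1 - cmod c)^2)" .
  qed
qed

section \<open>Norm estimates for the test functions\<close>

text \<open>The differentiability clause of \<open>holo2\<close> at a single point, isolated so that
  closure rules can use nonvanishing of a denominator at that point.\<close>

definition cdiff2 :: "(c2 \<Rightarrow> complex) \<Rightarrow> c2 \<Rightarrow> bool" where
  "cdiff2 f z \<longleftrightarrow> (\<exists>a b. (f has_derivative (\<lambda>h. a * fst h + b * snd h)) (at z))"

lemma cdiff2I: "(f has_derivative F) (at z) \<Longrightarrow> (\<And>h. F h = a * fst h + b * snd h) \<Longrightarrow> cdiff2 f z"
  unfolding cdiff2_def by (metis (no_types, lifting) ext)

lemma cdiff2_const: "cdiff2 (\<lambda>z. c) z"
  by (rule cdiff2I[where a = 0 and b = 0], rule has_derivative_const) simp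

lemma cdiff2_fst: "cdiff2 fst z"
  by (rule cdiff2I[where a = 1 and b = 0], rule has_derivative_fst, rule has_derivative_ident) simp

lemma cdiff2_snd: "cdiff2 snd z"
  by (rule cdiff2I[where a = 0 and b = 1], rule has_derivative_snd, rule has_derivative_ident) simp

lemma cdiff2_diff:
  assumes "cdiff2 f z" "cdiff2 g z"
  shows "cdiff2 (\<lambda>z. f z - g z) z"
proof -
  obtain a b a' b' where "(f has_derivative (\<lambda>h. a * fst h + b * snd h)) (at z)"
    "(g has_derivative (\<lambda>h. a' * fst h + b' * snd h)) (at z)"
    using assms unfolding cdiff2_def by blast
  from has_derivative_diff[OF this] show ?thesis
    by (rule cdiff2I[where a = "a - a'" and b = "b - b'"]) (simp add: algebra_simps)
qed

lemma cdiff2_mult: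
  assumes "cdiff2 f z" "cdiff2 g z"
  shows "cdiff2 (\<lambda>z. f z * g z) z"
proof -
  obtain a b a' b' where "(f has_derivative (\<lambda>h. a * fst h + b * snd h)) (at z)"
    "(g has_derivative (\<lambda>h. a' * fst h + b' * snd h)) (at z)"
    using assms unfolding cdiff2_def by blast
  from has_derivative_mult[OF this] show ?thesis
    by (rule cdiff2I[where a = "a * g z + f z * a'" and b = "b * g z + f z * b'"]) (simp add: algebra_simps)
qed

lemma cdiff2_power: "cdiff2 f z \<Longrightarrow> cdiff2 (\<lambda>z. f z ^ n) z"
  by (induction n) (auto intro: cdiff2_const cdiff2_mult)

lemma cdiff2_divide:
  assumes "cdiff2 f z" "cdiff2 g z" "g z \<noteq> 0"
  shows "cdiff2 (\<lambda>z. f z / g z) z"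
proof -
  obtain a b a' b' where "(f has_derivative (\<lambda>h. a * fst h + b * snd h)) (at z)"
    "(g has_derivative (\<lambda>h. a' * fst h + b' * snd h)) (at z)"
    using assms unfolding cdiff2_def by blast
  from has_derivative_divide'[OF this assms(3)] show ?thesis
    by (rule cdiff2I[where a = "(a * g z - f z * a') / (g z * g z)" and b = "(b * g z - f z * b') / (g z * g z)"])
       (simp add: add_divide_distrib diff_divide_distrib algebra_simps)
qed

text \<open>Everything follows from |t| \<le> |z2| and |s^k| \<le> |z1|^k |w2|. The bounds depend on
  \<open>w\<close> only through |t|, which is needed when \<open>w\<close> runs to the boundary with
  \<open>z\<close> fixed.\<close>

lemma kernel_factors:
  assumes k: "k > 0" and z: "z \<in> Hk k" and w: "w \<in> Hk k"
  defines "s \<equiv> fst z * cnj (fst w)" and "t \<equiv> snd z * cnj (snd w)"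
  shows "cmod (1 - t) \<ge> 1 - cmod (snd z)" "t \<noteq> 0"
    "cmod (t - s ^ k) \<ge> cmod t * (1 - cmod (fst z) ^ k / cmod (snd z))"
    "1 - t \<noteq> 0" "t - s ^ k \<noteq> 0"
proof -
  have z': "0 < cmod (snd z)" "cmod (snd z) < 1" "cmod (fst z) ^ k < cmod (snd z)"
    and w': "0 < cmod (snd w)" "cmod (snd w) < 1" "cmod (fst w) ^ k < cmod (snd w)"
    using z w Hk_snd_pos by (auto simp: Hk_def)
  have nt: "cmod t = cmod (snd z) * cmod (snd w)" by (simp add: t_def norm_mult)
  then show t0: "t \<noteq> 0" using z' w' by auto
  have "cmod t \<le> cmod (snd z)" using z' w' by (simp add: nt mult_left_le)
  then show 1: "cmod (1 - t) \<ge> 1 - cmod (snd z)"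
    using norm_triangle_ineq2[of 1 t] by simp
  have "cmod (s ^ k) = cmod (fst z) ^ k * cmod (fst w) ^ k"
    by (simp add: s_def norm_mult norm_power power_mult_distrib)
  also have "\<dots> \<le> cmod (fst z) ^ k * cmod (snd w)"
    using w' by (intro mult_left_mono) auto
  finally have "cmod t - cmod (s ^ k) \<ge> cmod t - cmod (fst z) ^ k * cmod (snd w)" by simp
  also have "cmod t - cmod (fst z) ^ k * cmod (snd w) = cmod t * (1 - cmod (fst z) ^ k / cmod (snd z))"
    using z' by (simp add: nt right_diff_distrib)
  finally show 2: "cmod (t - s ^ k) \<ge> cmod t * (1 - cmod (fst z) ^ k / cmod (snd z))"
    using norm_triangle_ineq2[of t "s ^ k"] by linarith
  have "0 < 1 - cmod (snd z)" using z' by simp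
  then show "1 - t \<noteq> 0" using 1 by auto
  have "0 < cmod t * (1 - cmod (fst z) ^ k / cmod (snd z))"
    using t0 z' by simp
  then show "t - s ^ k \<noteq> 0" using 2 by auto
qed

lemma holo2_Pk:
  assumes k: "k > 0" and w: "w \<in> Hk k"
  shows "holo2 (\<lambda>z. c * Pk k z w) (Hk k)"
proof -
  have "cdiff2 (\<lambda>z. c * Pk k z w) z" if z: "z \<in> Hk k" for z
    unfolding Pk_def Let_def
    by (intro cdiff2_mult cdiff2_const cdiff2_divide cdiff2_power cdiff2_diff cdiff2_fst cdiff2_snd)
       (use kernel_factors[OF k z w] in auto)
  then show ?thesis
    unfolding holo2_def cdiff2_def using open_Hk by blast
qed

text \<open>The numerator is at least 1, and each factor 1 - x^2 is at most 2 (1 - x); two of them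
  squared give 16.\<close>

lemma Kb_diag_bounds:
  assumes k: "k > 0" and w: "w \<in> Hk k"
  shows "1 / (16 * real k * pi^2 * ((cmod (snd w))^2 * (1 - cmod (snd w))^2 *
       (1 - cmod (fst w) ^ k / cmod (snd w))^2)) \<le> Re (Kb k w w)"
proof -
  obtain u v where u: "cmod u < 1" and v: "v \<noteq> 0" "cmod v < 1" and wuv: "w = (u * v, v ^ k)"
    using Hk_paramE[OF w k] by blast
  define T g where "T = cmod (v ^ k)" and "g = cmod u ^ k"
  have T: "0 < T" "T < 1" and g: "0 \<le> g" "g < 1"
    using u v k by (auto simp: T_def g_def norm_power cmod_lt_one_power_iff)
  obtain R where R: "R \<ge> 1" "Re (Kb k (u * v, v ^ k) (u * v, v ^ k)) =
      R / (real k * pi^2 * T^2 * (1 - T^2)^2 * (1 - g^2)^2)"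
    unfolding T_def g_def using Kb_diag[OF k v(1)] by metis
  have sq: "0 < 1 - x^2 \<and> 1 - x^2 \<le> 2 * (1 - x)" if "0 \<le> x" "x < 1" for x :: real
  proof -
    have e: "1 - x^2 = (1 - x) * (1 + x)" by (simp add: power2_eq_square algebra_simps)
    have "(1 - x) * (1 + x) \<le> (1 - x) * 2" using that by (intro mult_left_mono) auto
    moreover have "0 < (1 - x) * (1 + x)" using that by (intro mult_pos_pos) auto
    ultimately show ?thesis using e by (simp add: mult.commute)
  qed
  have "real k * pi^2 * T^2 * (1 - T^2)^2 * (1 - g^2)^2 \<le> real k * pi^2 * T^2 * (2 * (1 - T))^2 * (2 * (1 - g))^2"
    using sq[of T] sq[of g] T g by (intro mult_mono power_mono) auto
  also have "\<dots> = 16 * real k * pi^2 * (T^2 * (1 - T)^2 * (1 - g)^2)"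
    unfolding power_mult_distrib by simp
  finally have le: "real k * pi^2 * T^2 * (1 - T^2)^2 * (1 - g^2)^2 \<le> 16 * real k * pi^2 * (T^2 * (1 - T)^2 * (1 - g)^2)" .
  have pos: "0 < real k * pi^2 * T^2 * (1 - T^2)^2 * (1 - g^2)^2"
    using sq[of T] sq[of g] T g k by (intro mult_pos_pos zero_less_power) auto
  have "1 / (16 * real k * pi^2 * (T^2 * (1 - T)^2 * (1 - g)^2)) \<le> R / (real k * pi^2 * T^2 * (1 - T^2)^2 * (1 - g^2)^2)"
    using R(1) le pos by (intro frac_le) auto
  then show ?thesis
    unfolding wuv R(2) fst_conv snd_conv fst_param_ratio[OF v(1)] T_def g_def by simp
qed

lemma Kb_diag_pos:
  assumes k: "k > 0" and w: "w \<in> Hk k"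
  shows "0 < Re (Kb k w w)"
proof -
  have "0 < 1 - cmod (snd w)" "0 < 1 - cmod (fst w) ^ k / cmod (snd w)" "0 < cmod (snd w)"
    using w Hk_snd_pos[OF w] by (auto simp: Hk_def)
  then have "0 < 1 / (16 * real k * pi^2 * ((cmod (snd w))^2 * (1 - cmod (snd w))^2 *
       (1 - cmod (fst w) ^ k / cmod (snd w))^2))"
    using k by simp
  then show ?thesis using Kb_diag_bounds[OF k w] by linarith
qed

text \<open>In the coordinates \<open>(z\<^sub>1 / v, z\<^sub>2)\<close> with \<open>v ^ k = z\<^sub>2\<close> the kernel splits into a function
  of \<open>z\<^sub>1 / v\<close> times a function of \<open>z\<^sub>2\<close>, so its norm is computed by two disc integrals.\<close>

lemma normA2sq_Pk_le:
  assumes k: "k > 0"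
  obtains L where "L > 0" "\<And>w. w \<in> Hk k \<Longrightarrow> normA2sq k (\<lambda>z. Pk k z w) \<le>
    ennreal (L / ((cmod (snd w))^2 * (1 - cmod (snd w))^2 * (1 - cmod (fst w) ^ k / cmod (snd w))^2))"
proof -
  \<comment> \<open>|P|^2 contributes |z2|^(-2) and the Jacobian |v|^2 = |z2|^(2/k). It is the
    Jacobian that brings the exponent below the critical value 2.\<close>
  define a where "a = 2 - 2 / real k"
  have a: "0 \<le> a" "a < 2" using k by (auto simp: a_def divide_le_eq)
  obtain L where L: "L \<ge> 0" and Lint: "\<And>c. cmod c < 1 \<Longrightarrow>
    (\<integral>\<^sup>+\<xi>. indicator (ball 0 1) \<xi> * ennreal (cmod \<xi> powr (- a) / cmod (1 - c * \<xi>) ^ 4) \<partial>lborel)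
      \<le> ennreal (L / (1 - cmod c)^2)"
    using nn_integral_disc_weighted_kernel[OF a] by blast
  define L1 where "L1 = real k ^ 3 * (128 * pi)"
  have L1: "L1 > 0" using k by (simp add: L1_def)
  show ?thesis
  \<comment> \<open>\<open>L\<close> is only known to be nonnegative; adding 1 yields a positive
    constant.\<close>
  proof (rule that[of "L1 * (L + 1)"])
    show "0 < L1 * (L + 1)" using L L1 by simp
    fix w assume w: "w \<in> Hk k"
    define w1 w2 where "w1 = fst w" and "w2 = snd w"
    define g where "g = cmod w1 ^ k / cmod w2"
    have w': "0 < cmod w2" "cmod w2 < 1" "g < 1"
      using w Hk_snd_pos[OF w] by (auto simp: Hk_def w1_def w2_def g_def)
    have g0: "0 \<le> g" by (simp add: g_def)
    define H where "H z = indicator (Hk k) z * ennreal ((cmod (Pk k z w))^2)" for z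
    have [measurable]: "H \<in> borel_measurable borel"
      unfolding H_def by measurable
    \<comment> \<open>The parameter of the inner disc integral; its modulus is |w1|^k / |w2|, below
      1 precisely because \<open>w\<close> lies in H_k.\<close>
    define c where "c = cnj w1 ^ k / cnj w2"
    have c: "cmod c = g" by (simp add: c_def g_def norm_divide norm_power)
    define G where "G z2 = L1 / (1 - g)^2 * (1 / (cmod w2)^2) * (cmod z2 powr (- a) / cmod (1 - cnj w2 * z2) ^ 4)" for z2
    have inner: "(\<integral>\<^sup>+z1. H (z1, z2) \<partial>lborel) \<le> indicator (ball 0 1) z2 * ennreal (G z2)" for z2
    proof (cases "z2 \<noteq> 0 \<and> cmod z2 < 1")
      case False
      then have "(z1, z2) \<notin> Hk k" for z1
        using Hk_snd_pos[of "(z1, z2)" k] by (auto simp: Hk_def)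
      then show ?thesis by (simp add: H_def)
    next
      case True
      define v where "v = exp (Ln z2 / of_nat k)"
      have v: "v ^ k = z2" "v \<noteq> 0"
        using True k by (auto simp: v_def exp_of_nat_mult[symmetric])
      have nv: "cmod v ^ k = cmod z2" by (simp add: v norm_power[symmetric])
      define t where "t = z2 * cnj w2"
      define b where "b = 1 / ((cmod t)^2 * cmod (1 - t) ^ 4)"
      have t0: "t \<noteq> 0" using True w' by (auto simp: t_def)
      \<comment> \<open>The separation of variables rests on t - s^k = t (1 - c \<xi>^k), in which
        \<open>v\<close> occurs only through v^k = z2.\<close>
      have Hv: "H (v * \<xi>, z2) = indicator (ball 0 1) \<xi> * (ennreal b * ennreal (1 / cmod (1 - c * \<xi> ^ k) ^ 4))" for \<xi>
      proof -
        have "(v * \<xi>, z2) \<in> Hk k \<longleftrightarrow> cmod \<xi> ^ k < 1"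
          using True nv by (simp add: Hk_def norm_mult power_mult_distrib)
        then have mem: "(v * \<xi>, z2) \<in> Hk k \<longleftrightarrow> \<xi> \<in> ball 0 1"
          using cmod_lt_one_power_iff[OF k, of \<xi>] by simp
        have "t - (v * \<xi> * cnj w1) ^ k = t * (1 - c * \<xi> ^ k)"
          using w' by (simp add: t_def c_def power_mult_distrib v field_simps)
        then have "Pk k (v * \<xi>, z2) w = t / ((1 - t)^2 * (t * (1 - c * \<xi> ^ k))^2)"
          unfolding Pk_def Let_def by (simp add: t_def w1_def w2_def)
        also have "\<dots> = 1 / (t * (1 - t)^2 * (1 - c * \<xi> ^ k)^2)"
          using t0 by (simp add: power2_eq_square)
        finally have "(cmod (Pk k (v * \<xi>, z2) w))^2 = b * (1 / cmod (1 - c * \<xi> ^ k) ^ 4)"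
          by (simp add: b_def norm_divide norm_mult norm_power power_divide power_mult_distrib)
        moreover have "ennreal (b * x) = ennreal b * ennreal x" if "x \<ge> 0" for x
          using that by (intro ennreal_mult) (auto simp: b_def)
        ultimately have "ennreal ((cmod (Pk k (v * \<xi>, z2) w))^2) = ennreal b * ennreal (1 / cmod (1 - c * \<xi> ^ k) ^ 4)"
          by (metis divide_nonneg_nonneg norm_ge_zero zero_le_one zero_le_power)
        then show ?thesis
          using mem by (simp add: H_def indicator_def)
      qed
      have "(\<integral>\<^sup>+z1. H (z1, z2) \<partial>lborel) = ennreal ((cmod v)^2) * (\<integral>\<^sup>+\<xi>. H (v * \<xi>, z2) \<partial>lborel)"
        by (rule nn_integral_complex_mult[OF _ v(2)])
           (rule measurable_compose[OF _ \<open>H \<in> _\<close>], auto intro!: borel_measurable_continuous_onI continuous_intros)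
      also have "(\<integral>\<^sup>+\<xi>. H (v * \<xi>, z2) \<partial>lborel) = ennreal b * (\<integral>\<^sup>+\<xi>. indicator (ball 0 1) \<xi> * ennreal (1 / cmod (1 - c * \<xi> ^ k) ^ 4) \<partial>lborel)"
        unfolding Hv by (subst nn_integral_cmult[symmetric]) (auto simp: mult_ac)
      also have "ennreal ((cmod v)^2) * \<dots> \<le> ennreal ((cmod v)^2) * (ennreal b * ennreal (L1 / (1 - g)^2))"
        using nn_integral_disc_power_kernel[OF k, of c] w' unfolding c L1_def
        by (intro mult_left_mono) auto
      also have "\<dots> = ennreal ((cmod v)^2 * (b * (L1 / (1 - g)^2)))"
      proof -
        have "0 \<le> b" "0 \<le> L1 / (1 - g)^2" using L1 by (auto simp: b_def)
        then show ?thesis by (simp only: ennreal_mult mult_nonneg_nonneg zero_le_power2)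
      qed
      also have "(cmod v)^2 * (b * (L1 / (1 - g)^2)) = G z2"
      proof -
        have "cmod v = cmod z2 powr (1 / real k)"
        proof -
          have "cmod z2 powr (1 / real k) = (cmod v powr real k) powr (1 / real k)"
            using v by (simp add: nv[symmetric] powr_realpow)
          also have "\<dots> = cmod v" using v k by (simp add: powr_powr)
          finally show ?thesis ..
        qed
        then have "(cmod v)^2 = cmod z2 powr (2 / real k)"
          using True by (simp add: powr_power)
        moreover have "cmod z2 powr (- a) = cmod z2 powr (2 / real k) / (cmod z2)^2"
          using True by (simp add: a_def powr_diff powr_numeral)
        moreover have "cmod (1 - t) = cmod (1 - cnj w2 * z2)" by (simp add: t_def mult.commute)
        ultimately show ?thesis
          by (simp add: G_def b_def t_def norm_mult power_mult_distrib mult_ac)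
      qed
      finally show ?thesis using True by simp
    qed
    have "normA2sq k (\<lambda>z. Pk k z w) = (\<integral>\<^sup>+z. H z \<partial>lborel)"
      by (simp add: normA2sq_lborel H_def)
    also have "\<dots> = (\<integral>\<^sup>+z2. (\<integral>\<^sup>+z1. H (z1, z2) \<partial>lborel) \<partial>lborel)"
      by (subst lborel_pair.nn_integral_snd) (auto simp: lborel_prod)
    also have "\<dots> \<le> (\<integral>\<^sup>+z2. indicator (ball 0 1) z2 * ennreal (G z2) \<partial>lborel)"
      by (rule nn_integral_mono) (rule inner)
    also have "\<dots> = (\<integral>\<^sup>+z2. ennreal (L1 / (1 - g)^2 * (1 / (cmod w2)^2)) *
        (indicator (ball 0 1) z2 * ennreal (cmod z2 powr (- a) / cmod (1 - cnj w2 * z2) ^ 4)) \<partial>lborel)"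
    proof (rule nn_integral_cong)
      fix z2 :: complex
      have "0 \<le> L1 / (1 - g)^2 * (1 / (cmod w2)^2)" using L1 by simp
      from ennreal_mult'[OF this] show "indicator (ball 0 1) z2 * ennreal (G z2) = ennreal (L1 / (1 - g)^2 * (1 / (cmod w2)^2)) *
        (indicator (ball 0 1) z2 * ennreal (cmod z2 powr (- a) / cmod (1 - cnj w2 * z2) ^ 4))"
        unfolding G_def
        by (cases "z2 \<in> ball 0 1") (simp_all only: indicator_simps mult_1_left mult_zero_left mult_zero_right not_False_eq_True)
    qed
    also have "\<dots> = ennreal (L1 / (1 - g)^2 * (1 / (cmod w2)^2)) *
        (\<integral>\<^sup>+z2. indicator (ball 0 1) z2 * ennreal (cmod z2 powr (- a) / cmod (1 - cnj w2 * z2) ^ 4) \<partial>lborel)"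
      by (rule nn_integral_cmult) measurable
    also have "\<dots> \<le> ennreal (L1 / (1 - g)^2 * (1 / (cmod w2)^2)) * ennreal (L / (1 - cmod w2)^2)"
      using Lint[of "cnj w2"] w' by (intro mult_left_mono) auto
    also have "\<dots> = ennreal (L1 / (1 - g)^2 * (1 / (cmod w2)^2) * (L / (1 - cmod w2)^2))"
      using L L1 by (subst ennreal_mult) auto
    also have "\<dots> \<le> ennreal (L1 * (L + 1) / ((cmod w2)^2 * (1 - cmod w2)^2 * (1 - g)^2))"
    proof (rule ennreal_leI)
      have "L1 / (1 - g)^2 * (1 / (cmod w2)^2) * (L / (1 - cmod w2)^2) = L1 * L / ((cmod w2)^2 * (1 - cmod w2)^2 * (1 - g)^2)"
        by (simp add: mult_ac)
      also have "\<dots> \<le> L1 * (L + 1) / ((cmod w2)^2 * (1 - cmod w2)^2 * (1 - g)^2)"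
        using L1 by (intro divide_right_mono mult_left_mono) auto
      finally show "L1 / (1 - g)^2 * (1 / (cmod w2)^2) * (L / (1 - cmod w2)^2) \<le>
         L1 * (L + 1) / ((cmod w2)^2 * (1 - cmod w2)^2 * (1 - g)^2)" .
    qed
    finally show "normA2sq k (\<lambda>z. Pk k z w) \<le>
      ennreal (L1 * (L + 1) / ((cmod (snd w))^2 * (1 - cmod (snd w))^2 * (1 - cmod (fst w) ^ k / cmod (snd w))^2))"
      by (simp add: w1_def w2_def g_def)
  qed
qed

lemma normA2sq_scale:
  assumes "f \<in> borel_measurable borel"
  shows "normA2sq k (\<lambda>z. of_real a * f z) = ennreal (a^2) * normA2sq k f"
  unfolding normA2sq_lborel using assms
  by (subst nn_integral_cmult[symmetric])
     (auto simp: norm_mult power_mult_distrib ennreal_mult mult_ac intro!: nn_integral_cong)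

text \<open>The test functions of the necessity part. The constant \<open>C\<close> is chosen once
  so that all of them lie in the unit ball of A^2; then \<open>T_mu\<close> is \<open>C\<close>
  times their squared norm in L^2(\<mu>).\<close>

definition normalized_Pk :: "nat \<Rightarrow> real \<Rightarrow> c2 \<Rightarrow> c2 \<Rightarrow> complex" where
  "normalized_Pk k C w z = of_real (1 / sqrt (C * Re (Kb k w w))) * Pk k z w"

lemma normalized_Pk_norm:
  assumes k: "k > 0" and C: "C > 0" and w: "w \<in> Hk k"
  shows "(cmod (normalized_Pk k C w z))^2 = (1 / C) * ((cmod (Pk k z w))^2 / Re (Kb k w w))"
  using Kb_diag_pos[OF k w] C
  by (simp add: normalized_Pk_def norm_mult power_mult_distrib norm_divide power_divide)

lemma T_mu_normalized_Pk:
  assumes k: "k > 0" and C: "C > 0" and w: "w \<in> Hk k" and \<mu>: "sets \<mu> = sets borel"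
  shows "T_mu k \<mu> w = ennreal C * normL2sq k \<mu> (normalized_Pk k C w)"
proof -
  have [measurable_cong]: "sets \<mu> = sets borel" by fact
  have "ennreal C * normL2sq k \<mu> (normalized_Pk k C w) =
     (\<integral>\<^sup>+z. ennreal C * (indicator (Hk k) z * ennreal ((1 / C) * ((cmod (Pk k z w))^2 / Re (Kb k w w)))) \<partial>\<mu>)"
    unfolding normL2sq_def normalized_Pk_norm[OF k C w] by (rule nn_integral_cmult[symmetric]) measurable
  also have "\<dots> = T_mu k \<mu> w"
    unfolding T_mu_def
  proof (rule nn_integral_cong)
    fix z
    define x where "x = (cmod (Pk k z w))^2 / Re (Kb k w w)"
    have "x \<ge> 0"
      using Kb_diag_pos[OF k w] by (simp add: x_def)
    then have "ennreal C * ennreal ((1 / C) * x) = ennreal x"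
      using C by (simp add: ennreal_mult[symmetric])
    then show "ennreal C * (indicator (Hk k) z * ennreal ((1 / C) * ((cmod (Pk k z w))^2 / Re (Kb k w w)))) =
      indicator (Hk k) z * ennreal ((cmod (Pk k z w))^2 / Re (Kb k w w))"
      unfolding x_def by (cases "z \<in> Hk k") (simp_all only: indicator_simps mult_1_left mult_zero_left mult_zero_right not_False_eq_True)
  qed
  finally show ?thesis ..
qed

text \<open>The upper bound for the norm of P(.,w) and the lower bound for K(w,w) contain the same
  boundary expression \<open>D\<close>, so \<open>C\<close> is just the quotient of the
  constants.\<close>

lemma normalized_Pk_unit_ball:
  assumes k: "k > 0"
  obtains C where "C > 0" "\<And>w. w \<in> Hk k \<Longrightarrow> normalized_Pk k C w \<in> A2 k \<and> normA2sq k (normalized_Pk k C w) \<le> 1"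
proof -
  obtain L where L: "L > 0" and bnd: "\<And>w. w \<in> Hk k \<Longrightarrow> normA2sq k (\<lambda>z. Pk k z w) \<le>
    ennreal (L / ((cmod (snd w))^2 * (1 - cmod (snd w))^2 * (1 - cmod (fst w) ^ k / cmod (snd w))^2))"
    using normA2sq_Pk_le[OF k] by blast
  define C where "C = L * (16 * real k * pi^2)"
  have C: "C > 0" using L k by (simp add: C_def)
  show ?thesis
  proof (rule that[OF C])
    fix w assume w: "w \<in> Hk k"
    define D where "D = (cmod (snd w))^2 * (1 - cmod (snd w))^2 * (1 - cmod (fst w) ^ k / cmod (snd w))^2"
    have "0 < 1 - cmod (snd w)" "0 < 1 - cmod (fst w) ^ k / cmod (snd w)" "0 < cmod (snd w)"
      using w Hk_snd_pos[OF w] by (auto simp: Hk_def)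
    then have D: "D > 0" unfolding D_def by (intro mult_pos_pos zero_less_power) auto
    have K: "1 / (16 * real k * pi^2 * D) \<le> Re (Kb k w w)"
      using Kb_diag_bounds[OF k w] by (simp add: D_def)
    have Kpos: "0 < Re (Kb k w w)" by (rule Kb_diag_pos[OF k w])
    have "L / D = C * (1 / (16 * real k * pi^2 * D))"
      using k by (simp add: C_def)
    also have "\<dots> \<le> C * Re (Kb k w w)" using C K by (intro mult_left_mono) auto
    finally have LD: "L / D \<le> C * Re (Kb k w w)" .
    have "normA2sq k (normalized_Pk k C w) = ennreal ((1 / sqrt (C * Re (Kb k w w)))^2) * normA2sq k (\<lambda>z. Pk k z w)"
      unfolding normalized_Pk_def by (rule normA2sq_scale) measurable
    also have "(1 / sqrt (C * Re (Kb k w w)))^2 = 1 / (C * Re (Kb k w w))"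
      using C Kpos by (simp add: power_divide)
    also have "ennreal (1 / (C * Re (Kb k w w))) * normA2sq k (\<lambda>z. Pk k z w) \<le> ennreal (1 / (C * Re (Kb k w w))) * ennreal (L / D)"
      using bnd[OF w] by (intro mult_left_mono) (auto simp: D_def)
    also have "\<dots> \<le> ennreal (1 / (C * Re (Kb k w w))) * ennreal (C * Re (Kb k w w))"
      using LD by (intro mult_left_mono ennreal_leI) auto
    also have "\<dots> = 1"
      using C Kpos by (subst ennreal_mult[symmetric]) auto
    finally have le: "normA2sq k (normalized_Pk k C w) \<le> 1" .
    moreover have "holo2 (normalized_Pk k C w) (Hk k)"
      using holo2_Pk[OF k w] unfolding normalized_Pk_def[abs_def] .
    ultimately show "normalized_Pk k C w \<in> A2 k \<and> normA2sq k (normalized_Pk k C w) \<le> 1"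
      by (simp add: A2_def order_le_less_trans[OF le])
  qed
qed

section \<open>Necessity\<close>

lemma frontier_Hk_nonempty:
  assumes "k > 0"
  shows "frontier (Hk k) \<noteq> {}"
proof -
  have "(0, 1 / 2) \<in> Hk k" "(0, 0) \<notin> Hk k" using assms by (auto simp: Hk_def zero_power)
  then show ?thesis by (metis UNIV_I empty_iff frontier_eq_empty)
qed

text \<open>A converse to the distance estimate for tails, valid away from the corner: a point (0,
  z2) with small z2 is near the boundary without being in a thin tail. With |w2| \<ge> c the
  complement of the tail is compact, hence at positive distance from the boundary.\<close>

lemma near_frontier_tail:
  assumes k: "k > 0" and c: "c > 0" and \<rho>: "\<rho> > 0"
  obtains \<eta> where "\<eta> > 0"
    "\<And>w. w \<in> Hk k \<Longrightarrow> c \<le> cmod (snd w) \<Longrightarrow> infdist w (frontier (Hk k)) < \<eta> \<Longrightarrow> w \<in> tail k \<rho>"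
proof -
  \<comment> \<open>The quotient condition is multiplied by |w2|, which makes closedness immediate
    on all of the space.\<close>
  define Q where "Q = {w::c2. c \<le> cmod (snd w) \<and> cmod (snd w) \<le> 1 - \<rho> \<and> cmod (fst w) ^ k \<le> (1 - \<rho>) * cmod (snd w)}"
  have Qc: "w \<in> Hk k" if "w \<in> Q" for w
  proof -
    have "(1 - \<rho>) * cmod (snd w) < 1 * cmod (snd w)"
      using that c \<rho> by (intro mult_strict_right_mono) (auto simp: Q_def)
    then show ?thesis using that \<rho> by (auto simp: Q_def Hk_def)
  qed
  have "closed Q"
    unfolding Q_def by (intro closed_Collect_conj closed_Collect_le continuous_intros)
  moreover have "bounded Q"
  proof (rule bounded_subset)
    show "bounded (cball (0::complex) 1 \<times> cball (0::complex) 1)"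
      by (intro bounded_Times bounded_cball)
    show "Q \<subseteq> cball 0 1 \<times> cball 0 1"
    proof
      fix w assume "w \<in> Q"
      then have "w \<in> Hk k" by (rule Qc)
      then have "cmod (fst w) ^ k < 1" "cmod (snd w) < 1" by (auto simp: Hk_def)
      then show "w \<in> cball 0 1 \<times> cball 0 1"
        using cmod_lt_one_power_iff[OF k, of "fst w"] by (cases w) auto
    qed
  qed
  ultimately have "compact Q" by (simp add: compact_eq_bounded_closed)
  moreover have "Q \<inter> frontier (Hk k) = {}"
    using Qc open_Hk[of k] by (auto simp: frontier_def interior_open)
  ultimately obtain d where d: "d > 0" "\<And>x y. x \<in> Q \<Longrightarrow> y \<in> frontier (Hk k) \<Longrightarrow> d \<le> dist x y"
    using separate_compact_closed[of Q "frontier (Hk k)"] frontier_closed by metis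
  show ?thesis
  proof (rule that[OF d(1)])
    fix w assume w: "w \<in> Hk k" "c \<le> cmod (snd w)" "infdist w (frontier (Hk k)) < d"
    obtain y where "y \<in> frontier (Hk k)" "infdist w (frontier (Hk k)) = dist w y"
      using infdist_attains_inf[OF frontier_closed frontier_Hk_nonempty[OF k]] by blast
    then have "w \<notin> Q" using d(2)[of w y] w(3) by auto
    then have "1 - cmod (snd w) \<le> \<rho> \<or> (1 - \<rho>) * cmod (snd w) < cmod (fst w) ^ k"
      using w(2) by (auto simp: Q_def)
    moreover have "0 < cmod (snd w)" using Hk_snd_pos[OF w(1)] .
    ultimately have "1 - cmod (snd w) \<le> \<rho> \<or> 1 - \<rho> < cmod (fst w) ^ k / cmod (snd w)"
      by (simp only: pos_less_divide_eq)
    then have "1 - cmod (snd w) \<le> \<rho> \<or> 1 - cmod (fst w) ^ k / cmod (snd w) \<le> \<rho>"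
      by auto
    then show "w \<in> tail k \<rho>"
      using w(1) by (auto simp: tail_def)
  qed
qed

text \<open>For fixed \<open>z\<close> and |w2| \<ge> c the kernel P(z,w) is bounded, while K(w,w)
  blows up: one of the two boundary distances of \<open>w\<close> tends to 0 and the other is at
  most 1.\<close>

lemma normalized_Pk_tendsto_0:
  assumes k: "k > 0" and C: "C > 0" and c: "c > 0" and z: "z \<in> Hk k"
    and w: "\<And>n::nat. w n \<in> Hk k \<and> c \<le> cmod (snd (w n))"
    and lim: "(\<lambda>n. infdist (w n) (frontier (Hk k))) \<longlonglongrightarrow> 0"
  shows "(\<lambda>n. normalized_Pk k C (w n) z) \<longlonglongrightarrow> 0"
proof -
  define g where "g = 1 - cmod (fst z) ^ k / cmod (snd z)"
  have z': "0 < cmod (snd z)" "0 < 1 - cmod (snd z)" "0 < g"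
    using z Hk_snd_pos[OF z] by (auto simp: Hk_def g_def)
  define A where "A = 1 / (cmod (snd z) * c * (1 - cmod (snd z))^2 * g^2)"
  have A: "A > 0" using z' c by (simp add: A_def)
  have Pb: "cmod (Pk k z (w n)) \<le> A" for n
  proof -
    define s t where "s = fst z * cnj (fst (w n))" and "t = snd z * cnj (snd (w n))"
    have wn: "w n \<in> Hk k" "c \<le> cmod (snd (w n))" using w by auto
    note kf = kernel_factors[OF k z wn(1), folded s_def t_def g_def]
    have t: "cmod (snd z) * c \<le> cmod t" "0 < cmod t"
      using wn(2) z' kf(2) by (auto simp: t_def norm_mult)
    have "cmod (Pk k z (w n)) = cmod t / ((cmod (1 - t))^2 * (cmod (t - s ^ k))^2)"
      unfolding Pk_def Let_def s_def[symmetric] t_def[symmetric] by (simp add: norm_divide norm_mult norm_power)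
    also have "\<dots> \<le> cmod t / ((1 - cmod (snd z))^2 * (cmod t * g)^2)"
    proof (rule divide_left_mono)
      have "0 \<le> cmod t * g" using t z' by simp
      then have "(cmod t * g)^2 \<le> (cmod (t - s ^ k))^2" using kf(3) by (intro power_mono)
      moreover have "(1 - cmod (snd z))^2 \<le> (cmod (1 - t))^2" using kf(1) z'(2) by (intro power_mono) auto
      ultimately show "(1 - cmod (snd z))^2 * (cmod t * g)^2 \<le> (cmod (1 - t))^2 * (cmod (t - s ^ k))^2"
        by (intro mult_mono) auto
      have "0 < (1 - cmod (snd z))^2 * (cmod t * g)^2"
        using z' t by (intro mult_pos_pos zero_less_power)
      moreover have "0 < (cmod (1 - t))^2 * (cmod (t - s ^ k))^2"
        using kf(4,5) by simp
      ultimately show "0 < (cmod (1 - t))^2 * (cmod (t - s ^ k))^2 * ((1 - cmod (snd z))^2 * (cmod t * g)^2)"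
        by (rule mult_pos_pos[rotated])
    qed simp
    also have "\<dots> = 1 / (cmod t * (1 - cmod (snd z))^2 * g^2)"
      using t(2) by (simp add: power2_eq_square)
    also have "\<dots> \<le> A"
      unfolding A_def
    proof (rule divide_left_mono)
      show "cmod (snd z) * c * (1 - cmod (snd z))^2 * g^2 \<le> cmod t * (1 - cmod (snd z))^2 * g^2"
        using t(1) by (intro mult_right_mono) auto
      show "0 < cmod t * (1 - cmod (snd z))^2 * g^2 * (cmod (snd z) * c * (1 - cmod (snd z))^2 * g^2)"
        using t(2) z' c by (intro mult_pos_pos zero_less_power)
    qed simp
    finally show ?thesis .
  qed
  define D where "D = 16 * real k * pi^2 / C * A^2"
  have D: "D > 0" using k C A by (simp add: D_def)
  show ?thesis
  proof (rule tendstoI)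
    fix e :: real assume e: "e > 0"
    \<comment> \<open>The final bound is \<open>sqrt D * \<rho>\<close>, at most e/2 for this
      choice.\<close>
    define \<rho> where "\<rho> = min 1 (e / (2 * sqrt D))"
    have \<rho>: "\<rho> > 0" using e D by (simp add: \<rho>_def)
    obtain \<eta> where \<eta>: "\<eta> > 0" and tl: "\<And>w. w \<in> Hk k \<Longrightarrow> c \<le> cmod (snd w) \<Longrightarrow>
        infdist w (frontier (Hk k)) < \<eta> \<Longrightarrow> w \<in> tail k \<rho>"
      using near_frontier_tail[OF k c \<rho>] by blast
    have "\<forall>\<^sub>F n in sequentially. infdist (w n) (frontier (Hk k)) < \<eta>"
      using order_tendstoD(2)[OF lim \<eta>] .
    then show "\<forall>\<^sub>F n in sequentially. dist (normalized_Pk k C (w n) z) 0 < e"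
    proof eventually_elim
      case (elim n)
      have wn: "w n \<in> Hk k" and wt: "w n \<in> tail k \<rho>" using w tl elim by auto
      define p q where "p = 1 - cmod (snd (w n))" and "q = 1 - cmod (fst (w n)) ^ k / cmod (snd (w n))"
      have pq: "0 < p" "p \<le> 1" "0 < q" "q \<le> 1" "0 < cmod (snd (w n))" "cmod (snd (w n)) < 1"
        using wn Hk_snd_pos[OF wn] by (auto simp: Hk_def p_def q_def)
      have "p \<le> \<rho> \<or> q \<le> \<rho>" using wt by (auto simp: tail_def p_def q_def)
      then have "p * q \<le> \<rho>"
      proof
        assume "p \<le> \<rho>"
        then show ?thesis using mult_mono[of p \<rho> q 1] pq \<rho> by simp
      next
        assume "q \<le> \<rho>"
        then show ?thesis using mult_mono[of p 1 q \<rho>] pq \<rho> by simp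
      qed
      then have "(cmod (snd (w n)) * (p * q))^2 \<le> (1 * \<rho>)^2"
        using pq by (intro power_mono mult_mono) auto
      then have sq: "(cmod (snd (w n)))^2 * p^2 * q^2 \<le> \<rho>^2"
        by (simp add: power_mult_distrib mult.assoc)
      have sqpos: "0 < (cmod (snd (w n)))^2 * p^2 * q^2"
        using pq by (intro mult_pos_pos zero_less_power) auto
      have Kpos: "0 < Re (Kb k (w n) (w n))" by (rule Kb_diag_pos[OF k wn])
      define Y where "Y = 16 * real k * pi^2 * ((cmod (snd (w n)))^2 * p^2 * q^2)"
      have "Y > 0" using sqpos k unfolding Y_def by (intro mult_pos_pos) auto
      moreover have "1 / Y \<le> Re (Kb k (w n) (w n))"
        using Kb_diag_bounds[OF k wn] by (simp only: Y_def p_def q_def)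
      ultimately have "1 \<le> Re (Kb k (w n) (w n)) * Y"
        by (simp only: pos_divide_le_eq)
      then have "1 / Re (Kb k (w n) (w n)) \<le> Y"
        unfolding pos_divide_le_eq[OF Kpos] by (simp only: mult.commute)
      also have "Y = 16 * real k * pi^2 * ((cmod (snd (w n)))^2 * p^2 * q^2)"
        by (rule Y_def)
      also have "\<dots> \<le> 16 * real k * pi^2 * \<rho>^2"
        using sq by (intro mult_left_mono) auto
      finally have K: "1 / Re (Kb k (w n) (w n)) \<le> 16 * real k * pi^2 * \<rho>^2" .
      have "(cmod (normalized_Pk k C (w n) z))^2 = (1 / C) * ((cmod (Pk k z (w n)))^2 * (1 / Re (Kb k (w n) (w n))))"
        by (subst normalized_Pk_norm[OF k C wn]) simp
      also have "\<dots> \<le> (1 / C) * (A^2 * (16 * real k * pi^2 * \<rho>^2))"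
      proof (rule mult_left_mono)
        show "(cmod (Pk k z (w n)))^2 * (1 / Re (Kb k (w n) (w n))) \<le> A^2 * (16 * real k * pi^2 * \<rho>^2)"
          by (rule mult_mono[OF power_mono[OF Pb[of n]] K]) (use Kpos in auto)
      qed (use C in simp)
      also have "\<dots> = D * \<rho>^2" by (simp add: D_def)
      also have "\<dots> = (sqrt D * \<rho>)^2" using D by (simp add: power_mult_distrib)
      finally have "(cmod (normalized_Pk k C (w n) z))^2 \<le> (sqrt D * \<rho>)^2" .
      then have "cmod (normalized_Pk k C (w n) z) \<le> sqrt D * \<rho>"
        by (rule power2_le_imp_le) (use D \<rho> in auto)
      also have "\<dots> \<le> sqrt D * (e / (2 * sqrt D))"
        unfolding \<rho>_def using D by (intro mult_left_mono min.cobounded2) simp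
      also have "\<dots> = e / 2" using D by simp
      also have "\<dots> < e" using e by simp
      finally show ?case by simp
    qed
  qed
qed

text \<open>The exponent 1 serves for every vanishing measure. Since \<open>T_mu\<close> is bounded,
  a sequence violating the limit cannot approach the corner, so its test functions tend to 0
  pointwise. Compactness gives an L^2(\<mu>) limit, which must be 0, against a positive lower bound
  of the norms.\<close>

lemma vanishing_imp_T_mu:
  assumes k: "k > 0" and \<mu>: "carleson k \<mu>" and van: "vanishing k \<mu>"
  shows "tends0_bdry (Hk k) (\<lambda>w. ennreal (cmod (snd w) powr 1) * T_mu k \<mu> w)"
proof (rule ccontr)
  have fin: "fin_borel_on k \<mu>" using \<mu> by (simp add: carleson_def)
  then have sets: "sets \<mu> = sets borel" by (simp add: fin_borel_on_def)
  have [measurable_cong]: "sets \<mu> = sets borel" by (rule sets)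
  obtain C0 where C0: "\<And>f. f \<in> A2 k \<Longrightarrow> normL2sq k \<mu> f \<le> ennreal C0 * normA2sq k f"
    using \<mu> by (auto simp: carleson_def)
  obtain C where C: "C > 0" and unit: "\<And>w. w \<in> Hk k \<Longrightarrow> normalized_Pk k C w \<in> A2 k \<and> normA2sq k (normalized_Pk k C w) \<le> 1"
    using normalized_Pk_unit_ball[OF k] by blast
  \<comment> \<open>The Carleson constant is an arbitrary real; the maximum makes the bound positive
    so that it can be divided by.\<close>
  define K where "K = C * max C0 1"
  have K: "K > 0" using C by (simp add: K_def)
  have TK: "T_mu k \<mu> w \<le> ennreal K" if w: "w \<in> Hk k" for w
  proof -
    have "normL2sq k \<mu> (normalized_Pk k C w) \<le> ennreal C0 * normA2sq k (normalized_Pk k C w)"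
      using C0 unit[OF w] by blast
    also have "\<dots> \<le> ennreal (max C0 1) * 1"
      using unit[OF w] by (intro mult_mono ennreal_leI) auto
    finally have "ennreal C * normL2sq k \<mu> (normalized_Pk k C w) \<le> ennreal C * ennreal (max C0 1)"
      by (intro mult_left_mono) auto
    then show ?thesis
      using C by (simp add: T_mu_normalized_Pk[OF k C w sets] K_def ennreal_mult)
  qed
  assume "\<not> ?thesis"
  then obtain \<epsilon> where \<epsilon>: "\<epsilon> > 0" and bad: "\<And>\<eta>. \<eta> > 0 \<Longrightarrow>
      \<exists>w\<in>Hk k. infdist w (frontier (Hk k)) < \<eta> \<and> \<not> ennreal (cmod (snd w) powr 1) * T_mu k \<mu> w < ennreal \<epsilon>"
    unfolding tends0_bdry_def by blast
  have "\<exists>w. w \<in> Hk k \<and> infdist w (frontier (Hk k)) < inverse (real (Suc n)) \<and>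
      ennreal \<epsilon> \<le> ennreal (cmod (snd w)) * T_mu k \<mu> w" for n
  proof -
    obtain w' where w': "w' \<in> Hk k" "infdist w' (frontier (Hk k)) < inverse (real (Suc n))"
      "\<not> ennreal (cmod (snd w') powr 1) * T_mu k \<mu> w' < ennreal \<epsilon>"
      using bad[of "inverse (real (Suc n))"] by auto
    then have "ennreal \<epsilon> \<le> ennreal (cmod (snd w')) * T_mu k \<mu> w'"
      by (simp add: not_less)
    then show ?thesis using w' by blast
  qed
  then obtain w where w: "\<And>n. w n \<in> Hk k" "\<And>n. infdist (w n) (frontier (Hk k)) < inverse (real (Suc n))"
    "\<And>n. ennreal \<epsilon> \<le> ennreal (cmod (snd (w n))) * T_mu k \<mu> (w n)"
    by metis
  have lim: "(\<lambda>n. infdist (w n) (frontier (Hk k))) \<longlonglongrightarrow> 0"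
  proof (rule tendsto_sandwich[OF _ _ tendsto_const LIMSEQ_inverse_real_of_nat])
    show "\<forall>\<^sub>F n in sequentially. 0 \<le> infdist (w n) (frontier (Hk k))"
      by (simp add: infdist_nonneg)
    show "\<forall>\<^sub>F n in sequentially. infdist (w n) (frontier (Hk k)) \<le> inverse (real (Suc n))"
      using w(2) by (intro always_eventually allI less_imp_le)
  qed
  \<comment> \<open>This is where the weight acts: boundedness of \<open>T_mu\<close> forces |w2| to
    stay away from 0 along a bad sequence.\<close>
  have low: "\<epsilon> / K \<le> cmod (snd (w n))" for n
  proof -
    have "ennreal \<epsilon> \<le> ennreal (cmod (snd (w n))) * ennreal K"
      using w(3)[of n] mult_left_mono[OF TK[OF w(1)[of n]], of "ennreal (cmod (snd (w n)))"] by (rule order_trans) simp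
    then have "ennreal \<epsilon> \<le> ennreal (cmod (snd (w n)) * K)"
      using K by (simp add: ennreal_mult)
    then have "\<epsilon> \<le> cmod (snd (w n)) * K"
      using K by (subst (asm) ennreal_le_iff) auto
    then show ?thesis using K by (simp add: divide_le_eq)
  qed
  have big: "ennreal (\<epsilon> / C) \<le> normL2sq k \<mu> (normalized_Pk k C (w n))" for n
  proof -
    have "ennreal (cmod (snd (w n))) \<le> ennreal 1"
      using w(1)[of n] by (intro ennreal_leI) (auto simp: Hk_def)
    then have "ennreal \<epsilon> \<le> 1 * T_mu k \<mu> (w n)"
      using w(3)[of n] by (intro order_trans[OF w(3)[of n] mult_right_mono]) auto
    then have "ennreal (1 / C) * ennreal \<epsilon> \<le> ennreal (1 / C) * (ennreal C * normL2sq k \<mu> (normalized_Pk k C (w n)))"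
      unfolding T_mu_normalized_Pk[OF k C w(1) sets] by (intro mult_left_mono) auto
    also have "\<dots> = normL2sq k \<mu> (normalized_Pk k C (w n))"
      using C by (simp add: mult.assoc[symmetric] ennreal_mult[symmetric])
    also have "ennreal (1 / C) * ennreal \<epsilon> = ennreal (\<epsilon> / C)"
      using C \<epsilon> by (simp add: ennreal_mult[symmetric])
    finally show ?thesis .
  qed
  have "\<And>f::nat \<Rightarrow> c2 \<Rightarrow> complex. (\<forall>n. f n \<in> A2 k \<and> normA2sq k (f n) \<le> 1) \<Longrightarrow>
        (\<exists>r g. strict_mono r \<and> g \<in> borel_measurable borel \<and> normL2sq k \<mu> g < \<infinity> \<and>
           (\<lambda>n. normL2sq k \<mu> (\<lambda>z. f (r n) z - g z)) \<longlonglongrightarrow> 0)"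
    using van unfolding vanishing_def by blast
  from this[of "\<lambda>n. normalized_Pk k C (w n)"]
  obtain r g where r: "strict_mono r" and g[measurable]: "g \<in> borel_measurable borel"
    and conv: "(\<lambda>n. normL2sq k \<mu> (\<lambda>z. normalized_Pk k C (w (r n)) z - g z)) \<longlonglongrightarrow> 0"
    using unit w(1) by blast
  define h where "h n = normalized_Pk k C (w (r n))" for n
  have hm[measurable]: "h n \<in> borel_measurable borel" for n
    unfolding h_def normalized_Pk_def by measurable
  have h0: "(\<lambda>n. h n z) \<longlonglongrightarrow> 0" if z: "z \<in> Hk k" for z
    unfolding h_def
  proof (rule normalized_Pk_tendsto_0[OF k C _ z])
    show "\<epsilon> / K > 0" using \<epsilon> K by simp
    show "w (r n) \<in> Hk k \<and> \<epsilon> / K \<le> cmod (snd (w (r n)))" for n using w(1) low by auto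
    show "(\<lambda>n. infdist (w (r n)) (frontier (Hk k))) \<longlonglongrightarrow> 0"
      using LIMSEQ_subseq_LIMSEQ[OF lim r] by (simp add: o_def)
  qed
  have conv': "(\<lambda>n. normL2sq k \<mu> (\<lambda>z. h n z - g z)) \<longlonglongrightarrow> 0"
    using conv by (simp add: h_def)
  \<comment> \<open>Fatou along the pointwise limit 0 shows that the L^2 limit vanishes \<mu>-almost
    everywhere.\<close>
  have "normL2sq k \<mu> (\<lambda>z. 0 - g z) \<le> liminf (\<lambda>n. normL2sq k \<mu> (\<lambda>z. h n z - g z))"
    unfolding normL2sq_def
  proof (rule nn_integral_sq_limit_le[where h = "\<lambda>n z. h n z - g z"])
    show "(\<lambda>n. h n z - g z) \<longlonglongrightarrow> 0 - g z" if "z \<in> Hk k" for z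
      by (rule tendsto_diff[OF h0[OF that] tendsto_const])
  qed auto
  also have "\<dots> = 0"
    using lim_imp_Liminf[OF _ conv'] by simp
  finally have g0: "normL2sq k \<mu> g = 0" by (simp add: normL2sq_def)
  \<comment> \<open>The triangle estimate for squares doubles this to \<epsilon> / (2 C), still
    below the lower bound \<epsilon> / C.\<close>
  have "\<forall>\<^sub>F n in sequentially. normL2sq k \<mu> (\<lambda>z. h n z - g z) < ennreal (\<epsilon> / (4 * C))"
    using \<epsilon> C by (intro order_tendstoD(2)[OF conv']) auto
  then obtain n where n: "normL2sq k \<mu> (\<lambda>z. h n z - g z) < ennreal (\<epsilon> / (4 * C))"
    by (auto simp: eventually_sequentially)
  have "ennreal (\<epsilon> / C) \<le> normL2sq k \<mu> (\<lambda>z. (h n z - g z) - (0 - g z))"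
    using big[of "r n"] by (simp add: h_def)
  also have "\<dots> \<le> 2 * normL2sq k \<mu> (\<lambda>z. h n z - g z) + 2 * normL2sq k \<mu> (\<lambda>z. 0 - g z)"
    unfolding normL2sq_def by (rule nn_integral_norm_diff_sq_le) measurable
  also have "normL2sq k \<mu> (\<lambda>z. 0 - g z) = 0"
    using g0 by (simp add: normL2sq_def)
  also have "2 * normL2sq k \<mu> (\<lambda>z. h n z - g z) + 2 * 0 \<le> 2 * ennreal (\<epsilon> / (4 * C))"
    using n by (auto intro: mult_left_mono)
  also have "\<dots> = ennreal (2 * (\<epsilon> / (4 * C)))"
    using \<epsilon> C by (subst ennreal_mult) auto
  finally have "\<epsilon> / C \<le> 2 * (\<epsilon> / (4 * C))"
    using \<epsilon> C by (subst (asm) ennreal_le_iff) auto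
  then show False using \<epsilon> C by (simp add: field_simps)
qed

text \<open>The two kernels differ by the polynomial factor \<open>kernel_num\<close>, bounded on
  the closed bidisc, and a constant.\<close>

lemma B_mu_le_T_mu:
  assumes k: "k > 0" and \<mu>: "sets \<mu> = sets borel"
  obtains M where "M > 0" "\<And>w. w \<in> Hk k \<Longrightarrow> B_mu k \<mu> w \<le> ennreal M * T_mu k \<mu> w"
proof -
  have [measurable_cong]: "sets \<mu> = sets borel" by fact
  obtain M where M: "M \<ge> 1" "\<And>x y. cmod x \<le> 1 \<Longrightarrow> cmod y \<le> 1 \<Longrightarrow> cmod (kernel_num k x y) \<le> M"
    using kernel_num_bounded[of k] by blast
  define M' where "M' = (M / (real k * pi^2))^2"
  show ?thesis
  proof (rule that[of M'])
    show "M' > 0" using M k by (simp add: M'_def)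
    fix w assume w: "w \<in> Hk k"
    have Kpos: "0 < Re (Kb k w w)" by (rule Kb_diag_pos[OF k w])
    have le: "(cmod (Kb k z w))^2 \<le> M' * (cmod (Pk k z w))^2" if z: "z \<in> Hk k" for z
    proof -
      obtain u v where u: "cmod u < 1" and v: "v \<noteq> 0" "cmod v < 1" and zuv: "z = (u * v, v ^ k)"
        using Hk_paramE[OF z k] by blast
      obtain u' v' where u': "cmod u' < 1" and v': "v' \<noteq> 0" "cmod v' < 1" and wuv: "w = (u' * v', v' ^ k)"
        using Hk_paramE[OF w k] by blast
      have "cmod (kernel_num k (u * cnj u') (v * cnj v')) \<le> M"
        using mult_mono[of "cmod u" 1 "cmod u'" 1] mult_mono[of "cmod v" 1 "cmod v'" 1] u v u' v'
        by (intro M(2)) (auto simp: norm_mult)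
      then have "cmod (Pk k z w) * cmod (kernel_num k (u * cnj u') (v * cnj v')) / (real k * pi^2) \<le> cmod (Pk k z w) * M / (real k * pi^2)"
        by (intro divide_right_mono mult_left_mono) auto
      moreover have "cmod (Kb k z w) = cmod (Pk k z w) * cmod (kernel_num k (u * cnj u') (v * cnj v')) / (real k * pi^2)"
        unfolding zuv wuv Kb_Pk_param[OF v(1) v'(1)] by (simp add: norm_mult norm_divide norm_power)
      ultimately have "cmod (Kb k z w) \<le> M / (real k * pi^2) * cmod (Pk k z w)" by (simp add: mult_ac)
      then have "(cmod (Kb k z w))^2 \<le> (M / (real k * pi^2) * cmod (Pk k z w))^2" by (intro power_mono) auto
      then show ?thesis by (simp only: M'_def power_mult_distrib)
    qed
    have "B_mu k \<mu> w \<le> (\<integral>\<^sup>+z. ennreal M' * (indicator (Hk k) z * ennreal ((cmod (Pk k z w))^2 / Re (Kb k w w))) \<partial>\<mu>)"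
      unfolding B_mu_def
    proof (rule nn_integral_mono)
      fix z
      show "indicator (Hk k) z * ennreal ((cmod (Kb k z w))^2 / Re (Kb k w w)) \<le>
        ennreal M' * (indicator (Hk k) z * ennreal ((cmod (Pk k z w))^2 / Re (Kb k w w)))"
      proof (cases "z \<in> Hk k")
        case True
        have "(cmod (Kb k z w))^2 / Re (Kb k w w) \<le> M' * (cmod (Pk k z w))^2 / Re (Kb k w w)"
          using le[OF True] Kpos by (intro divide_right_mono) auto
        then have "ennreal ((cmod (Kb k z w))^2 / Re (Kb k w w)) \<le> ennreal (M' * ((cmod (Pk k z w))^2 / Re (Kb k w w)))"
          by (intro ennreal_leI) simp
        also have "\<dots> = ennreal M' * ennreal ((cmod (Pk k z w))^2 / Re (Kb k w w))"
          using Kpos by (intro ennreal_mult) (auto simp: M'_def)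
        finally show ?thesis using True by simp
      qed simp
    qed
    also have "\<dots> = ennreal M' * T_mu k \<mu> w"
      unfolding T_mu_def by (rule nn_integral_cmult) measurable
    finally show "B_mu k \<mu> w \<le> ennreal M' * T_mu k \<mu> w" .
  qed
qed

lemma tends0_bdry_mult_bound:
  assumes F: "tends0_bdry U F" and M: "M > 0" and le: "\<And>w. w \<in> U \<Longrightarrow> G w \<le> ennreal M * F w"
  shows "tends0_bdry U G"
  unfolding tends0_bdry_def
proof (intro allI impI)
  fix \<epsilon> :: real assume \<epsilon>: "\<epsilon> > 0"
  then have "\<epsilon> / M > 0" using M by simp
  then obtain \<eta> where \<eta>: "\<eta> > 0" "\<And>w. w \<in> U \<Longrightarrow> infdist w (frontier U) < \<eta> \<Longrightarrow> F w < ennreal (\<epsilon> / M)"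
    using F unfolding tends0_bdry_def by blast
  have "G w < ennreal \<epsilon>" if w: "w \<in> U" "infdist w (frontier U) < \<eta>" for w
  proof -
    have "G w \<le> ennreal M * F w" by (rule le[OF w(1)])
    also have "\<dots> < ennreal M * ennreal (\<epsilon> / M)"
      using \<eta>(2)[OF w] M by (intro ennreal_mult_strict_left_mono) auto
    also have "\<dots> = ennreal \<epsilon>" using M \<epsilon> by (simp add: ennreal_mult[symmetric])
    finally show ?thesis .
  qed
  then show "\<exists>\<eta>>0. \<forall>w\<in>U. infdist w (frontier U) < \<eta> \<longrightarrow> G w < ennreal \<epsilon>"
    using \<eta>(1) by blast
qed

text \<open>Supplies the majorant used near the corner. For w = (0, 1/2) the variable s vanishes and
  P(.,w) becomes a function of z2 alone, bounded below by a multiple of 1/|z2|; the Carleson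
  inequality is then applied to it.\<close>

lemma normL2sq_inverse_snd_finite:
  assumes k: "k > 0" and \<mu>: "carleson k \<mu>"
  shows "normL2sq k \<mu> (\<lambda>z. 1 / snd z) < \<infinity>"
proof -
  have sets[measurable_cong]: "sets \<mu> = sets borel" using \<mu> by (simp add: carleson_def fin_borel_on_def)
  obtain C0 where C0: "\<And>f. f \<in> A2 k \<Longrightarrow> normL2sq k \<mu> f \<le> ennreal C0 * normA2sq k f"
    using \<mu> by (auto simp: carleson_def)
  define w :: c2 where "w = (0, 1 / 2)"
  have w: "w \<in> Hk k" using k by (simp add: w_def Hk_def zero_power)
  obtain C where C: "C > 0" and unit: "normalized_Pk k C w \<in> A2 k \<and> normA2sq k (normalized_Pk k C w) \<le> 1"
    using normalized_Pk_unit_ball[OF k] w by blast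
  define a where "a = C * Re (Kb k w w)"
  have a: "a > 0" using C Kb_diag_pos[OF k w] by (simp add: a_def)
  have fin: "normL2sq k \<mu> (normalized_Pk k C w) < \<infinity>"
  proof -
    have "normL2sq k \<mu> (normalized_Pk k C w) \<le> ennreal C0 * normA2sq k (normalized_Pk k C w)"
      using C0 unit by blast
    also have "\<dots> \<le> ennreal C0 * 1" using unit by (intro mult_left_mono) auto
    also have "\<dots> < \<infinity>" by simp
    finally show ?thesis .
  qed
  have "normL2sq k \<mu> (\<lambda>z. 1 / snd z) \<le> (\<integral>\<^sup>+z. ennreal (4 * a) * (indicator (Hk k) z * ennreal ((cmod (normalized_Pk k C w z))^2)) \<partial>\<mu>)"
    unfolding normL2sq_def
  proof (rule nn_integral_mono)
    fix z
    show "indicator (Hk k) z * ennreal ((cmod (1 / snd z))^2) \<le>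
      ennreal (4 * a) * (indicator (Hk k) z * ennreal ((cmod (normalized_Pk k C w z))^2))"
    proof (cases "z \<in> Hk k")
      case True
      have z: "0 < cmod (snd z)" "cmod (snd z) < 1" using True Hk_snd_pos[OF True] by (auto simp: Hk_def)
      define t where "t = snd z / 2"
      have t: "t \<noteq> 0" "cmod t < 1 / 2" using z by (auto simp: t_def norm_divide)
      have "Pk k z w = t / ((1 - t)^2 * t^2)"
        using k by (simp add: Pk_def w_def t_def Let_def zero_power)
      then have P: "Pk k z w = 1 / ((1 - t)^2 * t)" using t by (simp add: power2_eq_square)
      \<comment> \<open>With |1 - t| \<le> 2 and |t| = |z2| / 2 the modulus of P is at least 1 / (2
        |z2|), which gives the 4 after squaring.\<close>
      have "cmod (1 - t) ^ 2 \<le> 2 ^ 2"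
        using norm_triangle_ineq4[of 1 t] t by (intro power_mono) auto
      then have "(cmod (1 - t))^2 * cmod t \<le> 4 * cmod t"
        by (intro mult_right_mono) auto
      also have "\<dots> = 2 * cmod (snd z)" by (simp add: t_def norm_divide)
      finally have "1 / (2 * cmod (snd z)) \<le> 1 / ((cmod (1 - t))^2 * cmod t)"
        using t z by (intro divide_left_mono mult_pos_pos) auto
      then have "1 / (2 * cmod (snd z)) \<le> cmod (Pk k z w)"
        unfolding P by (simp add: norm_divide norm_mult norm_power)
      then have "(1 / (2 * cmod (snd z)))^2 \<le> (cmod (Pk k z w))^2"
        by (intro power_mono) auto
      then have "(cmod (1 / snd z))^2 \<le> 4 * (cmod (Pk k z w))^2"
        by (simp add: norm_divide power_divide power_mult_distrib)
      also have "\<dots> = 4 * a * (cmod (normalized_Pk k C w z))^2"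
        unfolding normalized_Pk_norm[OF k C w] a_def using C Kb_diag_pos[OF k w] by simp
      finally have "ennreal ((cmod (1 / snd z))^2) \<le> ennreal (4 * a) * ennreal ((cmod (normalized_Pk k C w z))^2)"
        using a by (subst ennreal_mult[symmetric]) (auto intro: ennreal_leI)
      then show ?thesis using True by simp
    qed simp
  qed
  also have "\<dots> = ennreal (4 * a) * normL2sq k \<mu> (normalized_Pk k C w)"
    unfolding normL2sq_def normalized_Pk_def by (rule nn_integral_cmult) measurable
  also have "\<dots> < \<infinity>"
    using fin by (simp add: ennreal_mult_less_top)
  finally show ?thesis .
qed

theorem theorem1p4:
  fixes k :: nat and \<mu> :: "c2 measure"
  assumes "k > 0" and "carleson k \<mu>"
  shows "(vanishing k \<mu> \<longleftrightarrow>
            (\<exists>\<delta>::real>0. tends0_bdry (Hk k)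
               (\<lambda>w. ennreal (norm (snd w) powr \<delta>) * B_mu k \<mu> w)))
       \<and> (vanishing k \<mu> \<longleftrightarrow>
            (\<exists>\<delta>::real>0. tends0_bdry (Hk k)
               (\<lambda>w. ennreal (norm (snd w) powr \<delta>) * T_mu k \<mu> w)))"
proof -
  have fin: "fin_borel_on k \<mu>" using assms(2) by (simp add: carleson_def)
  then have sets: "sets \<mu> = sets borel" by (simp add: fin_borel_on_def)
  have T: "\<exists>\<delta>::real>0. tends0_bdry (Hk k) (\<lambda>w. ennreal (norm (snd w) powr \<delta>) * T_mu k \<mu> w)"
    if "vanishing k \<mu>"
    by (rule exI[of _ 1]) (use vanishing_imp_T_mu[OF assms that] in simp)
  have B: "\<exists>\<delta>::real>0. tends0_bdry (Hk k) (\<lambda>w. ennreal (norm (snd w) powr \<delta>) * B_mu k \<mu> w)"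
    if hyp: "\<exists>\<delta>::real>0. tends0_bdry (Hk k) (\<lambda>w. ennreal (norm (snd w) powr \<delta>) * T_mu k \<mu> w)"
  proof -
    obtain \<delta> :: real where \<delta>: "\<delta> > 0"
      and T: "tends0_bdry (Hk k) (\<lambda>w. ennreal (norm (snd w) powr \<delta>) * T_mu k \<mu> w)"
      using hyp by (elim exE conjE)
    obtain M where M: "M > 0" "\<And>w. w \<in> Hk k \<Longrightarrow> B_mu k \<mu> w \<le> ennreal M * T_mu k \<mu> w"
      using B_mu_le_T_mu[OF assms(1) sets] by blast
    have "tends0_bdry (Hk k) (\<lambda>w. ennreal (norm (snd w) powr \<delta>) * B_mu k \<mu> w)"
    proof (rule tends0_bdry_mult_bound[OF T M(1)])
      fix w assume "w \<in> Hk k"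
      from mult_left_mono[OF M(2)[OF this], of "ennreal (norm (snd w) powr \<delta>)"]
      show "ennreal (norm (snd w) powr \<delta>) * B_mu k \<mu> w \<le> ennreal M * (ennreal (norm (snd w) powr \<delta>) * T_mu k \<mu> w)"
        by (simp add: mult_ac)
    qed
    \<comment> \<open>The pointwise comparison of the transforms leaves the weight alone, so the
      same exponent is kept.\<close>
    then show ?thesis using \<delta> by (intro exI[of _ \<delta>] conjI)
  qed
  have V: "vanishing k \<mu>"
    if hyp: "\<exists>\<delta>::real>0. tends0_bdry (Hk k) (\<lambda>w. ennreal (norm (snd w) powr \<delta>) * B_mu k \<mu> w)"
  proof -
    obtain \<delta> :: real where \<delta>: "\<delta> > 0"
      and Bt: "tends0_bdry (Hk k) (\<lambda>w. ennreal (norm (snd w) powr \<delta>) * B_mu k \<mu> w)"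
      using hyp by (elim exE conjE)
    show ?thesis
    proof (rule vanishing_if_small_tail[OF assms normL2sq_inverse_snd_finite[OF assms]])
      fix \<epsilon> :: real assume \<epsilon>: "\<epsilon> > 0"
      obtain \<rho> where "\<rho> > 0" "\<And>f. f \<in> A2 k \<Longrightarrow>
          sq_mass \<mu> (tail k \<rho>) f \<le> ennreal \<epsilon> * normA2sq k f"
        by (rule uniformly_small_tail[OF assms(1) fin \<delta> Bt \<epsilon>]) (rule that; assumption)
      then show "\<exists>\<rho>>0. \<forall>f\<in>A2 k. (sq_mass \<mu> (tail k \<rho>) f) \<le> ennreal \<epsilon> * normA2sq k f"
        by (intro exI[of _ \<rho>] conjI ballI)
    qed
  qed
  show ?thesis
  proof (intro conjI iffI, goal_cases)
    case 1 then show ?case by (rule B[OF T])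
  next
    case 2 then show ?case by (rule V)
  next
    case 3 then show ?case by (rule T)
  next
    case 4 then show ?case by (rule V[OF B])
  qed
qed

end
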